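(* Let $q$ be a fixed odd prime power, let $2\le s\le t$ and $k\ge 5$ be integers, and let $a_1,\dots,a_k\in\mathbb{F}_q^\times$ satisfy $a_1+\cdots+a_k=0$. There exist constants $c=c(q,k,s,t)>0$ and $C>0$ (depending only on $q,k,s,t,a_1,\dots,a_k$) such that for every integer $n\ge 1$, writing $N=q^n$: if $A\subseteq\mathbb{F}_q^n$ is $K_{s,t}$-free and contains no nontrivial solution to $a_1x_1+\cdots+a_kx_k=0$, then \[ |A|\le C\,N^{1-1/s}(\log N)^{-c}. \]
   Context: A set $A\subseteq\mathbb{F}_q^n$ is $K_{s,t}$-free if there do not exist pairwise distinct $x_1,\dots,x_s\in\mathbb{F}_q^n$ and pairwise distinct $y_1,\dots,y_t\in\mathbb{F}_q^n$ with $x_i+y_j\in A$ for all $1\le i\le s$, $1\le j\le t$. A solution $(x_1,\dots,x_k)\in A^k$ of $a_1x_1+\cdots+a_kx_k=0$ is trivial if $x_1=\cdots=x_k$, and nontrivial otherwise. *)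

theory Defs
  imports Complex_Main "HOL-Library.Cardinality" "Jordan_Normal_Form.Matrix"
begin

text \<open>
  The space of vectors of length \<open>n\<close> over a finite field \<open>'a\<close> is \<^term>\<open>carrier_vec n :: 'a vec set\<close>,
  so that the dimension is a term and can be quantified inside a formula.
\<close>

definition Kst_free :: "nat \<Rightarrow> nat \<Rightarrow> nat \<Rightarrow> 'a::field vec set \<Rightarrow> bool" where
  "Kst_free n s t A \<longleftrightarrow>
     \<not> (\<exists>x y. x ` {1..s} \<subseteq> carrier_vec n \<and> inj_on x {1..s} \<and>
              y ` {1..t} \<subseteq> carrier_vec n \<and> inj_on y {1..t} \<and>
              (\<forall>i\<in>{1..s}. \<forall>j\<in>{1..t}. x i + y j \<in> A))"

definition lin_solution ::
    "nat \<Rightarrow> nat \<Rightarrow> (nat \<Rightarrow> 'a::field) \<Rightarrow> 'a vec set \<Rightarrow> (nat \<Rightarrow> 'a vec) \<Rightarrow> bool" where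
  "lin_solution n k a A x \<longleftrightarrow>
     (\<forall>i\<in>{1..k}. x i \<in> A) \<and>
     finsum_vec TYPE('a) n (\<lambda>i. a i \<cdot>\<^sub>v x i) {1..k} = 0\<^sub>v n"

definition trivial_solution :: "nat \<Rightarrow> (nat \<Rightarrow> 'a vec) \<Rightarrow> bool" where
  "trivial_solution k x \<longleftrightarrow> (\<forall>i\<in>{1..k}. \<forall>j\<in>{1..k}. x i = x j)"

end

theory Submission
  imports Defs "HOL-Library.Function_Algebras" "HOL-Library.FuncSet" "HOL-Number_Theory.Residues"
begin

text \<open>
  Merging variables whose coefficients have nonzero sum (possible since \<open>q\<close> is odd) reduces the
  equation to five variables. For \<open>d \<noteq> 0\<close>, counting copies of \<open>K\<^sub>s\<^sub>,\<^sub>t\<close> bounds \<open>|A \<inter> (A + d)|\<close> by a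
  constant multiple of \<open>R = (N / |A|)\<^bsup>s - 2\<^esup>\<close>, hence the additive energy by \<open>O(R |A|\<^sup>2)\<close>. Let \<open>H\<close> be the
  annihilator of the large Fourier spectrum of \<open>A\<close>. The energy bound shows that \<open>H\<close> has small
  codimension, that \<open>A\<close> has about the expected density on the cosets \<open>x + H\<close> for all \<open>x\<close> in a set \<open>D\<close>
  of density \<open>\<alpha> \<approx> |A|\<^sup>s / N\<^bsup>s - 1\<^esup>\<close>, and that \<open>A\<close> has about as many solutions as its average over the
  cosets of \<open>H\<close>. The set \<open>D\<close> contains at least \<open>\<alpha>\<^bsup>O(1)\<^esup> N\<^sup>4\<close> solutions, by the polynomial method for
  three-term equations and a Varnavides averaging. The losses are polynomial in \<open>\<alpha>\<close> and the
  codimension of \<open>H\<close> may be as large as a constant times \<open>log N\<close>, so \<open>\<alpha>\<close> is at most a negative power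
  of \<open>log N\<close>.
\<close>

section \<open>Slice rank of a diagonal tensor\<close>

text \<open>\<open>A\<close> is too sparse for the polynomial method; the set \<open>D\<close> of
  points with popular cosets is the dense model to which it applies. Up to a constant, the target
  says exactly that \<alpha> is small, so every loss polynomial in \<alpha> is affordable. Five
  variables suit the Fourier argument: in the error term one factor is bounded by the spectral
  threshold and the other four by the fourth moment, which is the additive energy. The energy also
  limits the size of the large spectrum, and the codimension of \<open>H\<close> is bounded simply
  by that size, a power of \<open>1 / \<alpha>\<close>. On the other hand \<open>H\<close> must be
  so large that coinciding pairs do not dominate the second moment of \<open>A\<close> on its
  cosets. These two demands meet when a power of \<open>1 / \<alpha>\<close> is a constant times
  \<open>log N\<close>, and this is where the logarithm comes from. The contradiction is one of
  counting: only the \<open>|A|\<close> constant solutions are allowed, while about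
  \<open>|A| ^ 5 / N\<close> are found, up to a power of \<alpha>.\<close>

lemma card_ge2_field: "2 \<le> CARD('a::{field,finite})"
proof -
  have "card {0, 1::'a} \<le> CARD('a)" by (intro card_mono) auto
  then show ?thesis by simp
qed

text \<open>The map \<open>F\<close> sends vectors on \<open>S\<close> to vectors on
  \<open>J\<close>, and applying \<open>u\<close> afterwards multiplies by the nonzero diagonal
  \<open>g\<close>, so \<open>F\<close> is injective. Comparing numbers of vectors over a finite
  field gives the rank bound without linear algebra.\<close>

lemma card_le_of_diagonal_factorization:
  fixes u v :: "'j \<Rightarrow> 'b \<Rightarrow> 'a::{field,finite}"
  assumes fin: "finite S" "finite J"
    and g: "\<And>x. x \<in> S \<Longrightarrow> g x \<noteq> 0"
    and M: "\<And>x y. x \<in> S \<Longrightarrow> y \<in> S \<Longrightarrow> (\<Sum>j\<in>J. u j x * v j y) = (if x = y then g x else 0)"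
  shows "card S \<le> card J"
proof -
  define F where "F = (\<lambda>w. \<lambda>j\<in>J. \<Sum>y\<in>S. v j y * w y)"
  have rec: "(\<Sum>j\<in>J. u j x * F w j) = g x * w x" if "x \<in> S" for x w
  proof -
    have "(\<Sum>j\<in>J. u j x * F w j) = (\<Sum>j\<in>J. \<Sum>y\<in>S. u j x * v j y * w y)"
      by (simp add: F_def sum_distrib_left mult.assoc)
    also have "\<dots> = (\<Sum>y\<in>S. (\<Sum>j\<in>J. u j x * v j y) * w y)"
      by (subst sum.swap) (simp add: sum_distrib_right)
    also have "\<dots> = (\<Sum>y\<in>S. if x = y then g x * w y else 0)"
      by (intro sum.cong refl) (simp add: M that)
    also have "\<dots> = g x * w x"
      using that fin by simp
    finally show ?thesis .
  qed
  have "inj_on F (S \<rightarrow>\<^sub>E (UNIV :: 'a set))"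
  proof (rule inj_onI)
    fix w w' assume w: "w \<in> S \<rightarrow>\<^sub>E UNIV" "w' \<in> S \<rightarrow>\<^sub>E UNIV" and eq: "F w = F w'"
    have "w x = w' x" if "x \<in> S" for x
      using rec[OF that, of w] rec[OF that, of w'] g[OF that] eq by simp
    then show "w = w'" by (intro PiE_ext[OF w]) auto
  qed
  moreover have "F ` (S \<rightarrow>\<^sub>E UNIV) \<subseteq> J \<rightarrow>\<^sub>E UNIV"
    by (auto simp: F_def)
  ultimately have "card (S \<rightarrow>\<^sub>E (UNIV::'a set)) \<le> card (J \<rightarrow>\<^sub>E (UNIV::'a set))"
    by (intro card_inj_on_le) (auto intro: finite_PiE fin)
  then have "CARD('a) ^ card S \<le> CARD('a) ^ card J"
    by (simp add: card_PiE fin)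
  then show ?thesis
    using card_ge2_field[where 'a = 'a] by (simp add: power_le_imp_le_exp)
qed

text \<open>Take \<open>h\<close> in the kernel with support as large as possible. If the support
  and \<open>J\<close> together were smaller than \<open>B\<close>, pigeonhole would give two
  vectors that agree on the support and under all functionals; adding their difference to
  \<open>h\<close> would enlarge the support.\<close>

lemma kernel_vector_with_large_support:
  fixes f :: "'j \<Rightarrow> 'b \<Rightarrow> 'a::{field,finite}"
  assumes fin: "finite B" "finite J"
  obtains h where "\<And>j. j \<in> J \<Longrightarrow> (\<Sum>x\<in>B. h x * f j x) = 0"
    and "card B \<le> card {x\<in>B. h x \<noteq> 0} + card J"
proof -
  define W where "W = {h. \<forall>j\<in>J. (\<Sum>x\<in>B. h x * f j x) = 0}"
  define supp where "supp = (\<lambda>h. {x\<in>B. h x \<noteq> (0::'a)})"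
  have "(\<lambda>_. 0) \<in> W" by (simp add: W_def)
  moreover have "card (supp h) \<le> card B" for h
    unfolding supp_def by (intro card_mono fin) auto
  ultimately obtain h where h: "h \<in> W" and mx: "\<And>h'. h' \<in> W \<Longrightarrow> card (supp h') \<le> card (supp h)"
    using ex_has_greatest_nat[of "\<lambda>h. h \<in> W" "\<lambda>_. 0" "card \<circ> supp" "Suc (card B)"]
    by (auto simp: less_Suc_eq_le)
  have "card B \<le> card (supp h) + card J"
  proof (rule ccontr)
    assume "\<not> ?thesis"
    then have lt: "card (supp h) + card J < card B" by simp
    define S where "S = supp h"
    have S: "S \<subseteq> B" "finite S" using fin by (auto simp: S_def supp_def)
    define F where "F = (\<lambda>w. (\<lambda>j\<in>J. \<Sum>x\<in>B. w x * f j x, restrict w S))"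
    let ?X = "B \<rightarrow>\<^sub>E (UNIV::'a set)" and ?Y = "(J \<rightarrow>\<^sub>E (UNIV::'a set)) \<times> (S \<rightarrow>\<^sub>E (UNIV::'a set))"
    have "card ?Y < card ?X"
      using lt card_ge2_field[where 'a = 'a]
      by (simp add: card_PiE fin S card_cartesian_product S_def[symmetric] flip: power_add)
    moreover have "F ` ?X \<subseteq> ?Y" by (auto simp: F_def)
    moreover have "finite ?Y" by (intro finite_cartesian_product finite_PiE fin S) auto
    ultimately have "\<not> inj_on F ?X"
      using card_inj_on_le[of F ?X ?Y] by auto
    then obtain w w' where w: "w \<in> ?X" "w' \<in> ?X" "F w = F w'" "w \<noteq> w'"
      by (auto simp: inj_on_def)
    define z where "z = (\<lambda>x. w x - w' x)"
    have "(\<Sum>x\<in>B. z x * f j x) = 0" if "j \<in> J" for j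
      using w(3) that by (auto simp: F_def z_def left_diff_distrib sum_subtractf fun_eq_iff restrict_def split: if_splits)
    then have zW: "(\<lambda>x. h x + z x) \<in> W"
      using h by (simp add: W_def distrib_right sum.distrib)
    have zS: "z x = 0" if "x \<in> S" for x
      using w(3) that by (auto simp: F_def z_def fun_eq_iff restrict_def split: if_splits)
    obtain x0 where x0: "x0 \<in> B" "w x0 \<noteq> w' x0"
      using w PiE_ext[OF w(1,2)] by blast
    have "x0 \<notin> S" using zS x0 by (auto simp: z_def)
    have "insert x0 S \<subseteq> supp (\<lambda>x. h x + z x)"
      using x0 \<open>x0 \<notin> S\<close> zS by (auto simp: S_def supp_def z_def)
    then have "card (insert x0 S) \<le> card (supp (\<lambda>x. h x + z x))"
      using fin by (intro card_mono) (auto simp: supp_def)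
    also have "\<dots> \<le> card S" using mx[OF zW] by (simp add: S_def)
    finally show False using \<open>x0 \<notin> S\<close> S by simp
  qed
  then show ?thesis using h that by (auto simp: W_def supp_def)
qed

text \<open>Pairing the first variable with a kernel vector \<open>h\<close> of the
  \<open>f1\<close> removes the first kind of slice and leaves a matrix with diagonal
  \<open>h\<close> and rank at most \<open>2 * card J\<close>. So the support of \<open>h\<close>
  has at most that many points, and it misses at most \<open>card J\<close> points of
  \<open>B\<close>.\<close>

lemma slice_rank_diagonal:
  fixes f1 f2 f3 :: "'j \<Rightarrow> 'b \<Rightarrow> 'a::{field,finite}"
  assumes fin: "finite B" "finite J"
    and T: "\<And>x y z. x \<in> B \<Longrightarrow> y \<in> B \<Longrightarrow> z \<in> B \<Longrightarrow>
      (if x = y \<and> y = z then 1 else 0) =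
        (\<Sum>j\<in>J. f1 j x * g1 j y z) + (\<Sum>j\<in>J. f2 j y * g2 j x z) + (\<Sum>j\<in>J. f3 j z * g3 j x y)"
  shows "card B \<le> 3 * card J"
proof -
  obtain h where h: "\<And>j. j \<in> J \<Longrightarrow> (\<Sum>x\<in>B. h x * f1 j x) = 0"
    and hc: "card B \<le> card {x\<in>B. h x \<noteq> 0} + card J"
    using kernel_vector_with_large_support[OF fin, of f1] by metis
  define S where "S = {x\<in>B. h x \<noteq> 0}"
  \<comment> \<open>\<open>Inl\<close> indexes the slices in \<open>y\<close> and \<open>Inr\<close>
    those in \<open>z\<close>; the contraction with \<open>h\<close> turns each into a product of
    two functions of one variable.\<close>
  define u where "u = (\<lambda>j y. case j of Inl j \<Rightarrow> f2 j y | Inr j \<Rightarrow> (\<Sum>x\<in>B. h x * g3 j x y))"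
  define v where "v = (\<lambda>j z. case j of Inl j \<Rightarrow> (\<Sum>x\<in>B. h x * g2 j x z) | Inr j \<Rightarrow> f3 j z)"
  have "(\<Sum>j\<in>J <+> J. u j y * v j z) = (if y = z then h y else 0)" if "y \<in> S" "z \<in> S" for y z
  proof -
    have yz: "y \<in> B" "z \<in> B" using that by (auto simp: S_def)
    have "(if y = z then h y else 0) = (\<Sum>x\<in>B. h x * (if x = y \<and> y = z then 1 else 0))"
      using yz fin by (simp add: sum.delta' if_distrib[of "\<lambda>c. _ * c"] cong: if_cong)
    also have "\<dots> = (\<Sum>x\<in>B. h x * ((\<Sum>j\<in>J. f1 j x * g1 j y z) + (\<Sum>j\<in>J. f2 j y * g2 j x z) + (\<Sum>j\<in>J. f3 j z * g3 j x y)))"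
      by (intro sum.cong refl) (simp only: T yz)
    also have "\<dots> = (\<Sum>x\<in>B. \<Sum>j\<in>J. h x * f1 j x * g1 j y z) + (\<Sum>x\<in>B. \<Sum>j\<in>J. f2 j y * (h x * g2 j x z))
        + (\<Sum>x\<in>B. \<Sum>j\<in>J. h x * g3 j x y * f3 j z)"
      by (simp add: distrib_left sum.distrib sum_distrib_left mult_ac)
    also have "(\<Sum>x\<in>B. \<Sum>j\<in>J. h x * f1 j x * g1 j y z) = 0"
      by (subst sum.swap) (simp add: h flip: sum_distrib_right)
    also have "(\<Sum>x\<in>B. \<Sum>j\<in>J. f2 j y * (h x * g2 j x z)) = (\<Sum>j\<in>J. u (Inl j) y * v (Inl j) z)"
      by (subst sum.swap) (simp add: u_def v_def sum_distrib_left)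
    also have "(\<Sum>x\<in>B. \<Sum>j\<in>J. h x * g3 j x y * f3 j z) = (\<Sum>j\<in>J. u (Inr j) y * v (Inr j) z)"
      by (subst sum.swap) (simp add: u_def v_def sum_distrib_right)
    finally show ?thesis
      by (simp add: sum.Plus fin)
  qed
  then have "card S \<le> card (J <+> J)"
    by (intro card_le_of_diagonal_factorization[where g = h and u = u and v = v]) (auto simp: S_def fin)
  then show ?thesis using hc fin by (simp add: S_def card_Plus)
qed

text \<open>For \<open>m = q - 1\<close> this is the factor that one coordinate contributes to the
  indicator of a linear equation. The index \<open>None\<close> stands for the constant 1 and
  \<open>Some (i, j)\<close> for a monomial of the power, so like terms need not be
  collected.\<close>

lemma one_minus_trinomial_power:
  fixes b1 b2 b3 :: "'a::field"
  obtains T :: "(nat \<times> nat) option set" and c e1 e2 e3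
  where "finite T" "\<And>t. t \<in> T \<Longrightarrow> e1 t + e2 t + e3 t \<le> m"
    and "\<And>x y z. 1 - (b1 * x + b2 * y + b3 * z) ^ m = (\<Sum>t\<in>T. c t * x ^ e1 t * y ^ e2 t * z ^ e3 t)"
proof -
  define S where "S = (SIGMA i:{..m}. {..m - i})"
  define T where "T = insert None (Some ` S)"
  define e1 where "e1 = (\<lambda>t::(nat\<times>nat) option. case t of None \<Rightarrow> 0 | Some (i, j) \<Rightarrow> i)"
  define e2 where "e2 = (\<lambda>t::(nat\<times>nat) option. case t of None \<Rightarrow> 0 | Some (i, j) \<Rightarrow> j)"
  define e3 where "e3 = (\<lambda>t::(nat\<times>nat) option. case t of None \<Rightarrow> 0 | Some (i, j) \<Rightarrow> m - i - j)"
  define c where "c = (\<lambda>t. case t of None \<Rightarrow> 1 | Some (i, j) \<Rightarrow>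
    - (of_nat (m choose i) * of_nat ((m - i) choose j) * b1 ^ i * b2 ^ j * b3 ^ (m - i - j)))"
  have finS: "finite S" by (simp add: S_def)
  have "1 - (b1 * x + b2 * y + b3 * z) ^ m = (\<Sum>t\<in>T. c t * x ^ e1 t * y ^ e2 t * z ^ e3 t)" for x y z
  proof -
    have "(b1 * x + b2 * y + b3 * z) ^ m = (b1 * x + (b2 * y + b3 * z)) ^ m" by (simp add: add.assoc)
    also have "\<dots> = (\<Sum>i\<le>m. of_nat (m choose i) * (b1 * x) ^ i * (b2 * y + b3 * z) ^ (m - i))"
      by (rule binomial_ring)
    also have "\<dots> = (\<Sum>i\<le>m. \<Sum>j\<le>m - i. of_nat (m choose i) * (b1 * x) ^ i *
        (of_nat ((m - i) choose j) * (b2 * y) ^ j * (b3 * z) ^ (m - i - j)))"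
      by (simp add: binomial_ring sum_distrib_left)
    also have "\<dots> = (\<Sum>(i, j)\<in>S. of_nat (m choose i) * (b1 * x) ^ i *
        (of_nat ((m - i) choose j) * (b2 * y) ^ j * (b3 * z) ^ (m - i - j)))"
      unfolding S_def by (subst sum.Sigma) auto
    also have "\<dots> = - (\<Sum>t\<in>Some ` S. c t * x ^ e1 t * y ^ e2 t * z ^ e3 t)"
      by (subst sum.reindex) (auto simp: c_def e1_def e2_def e3_def power_mult_distrib mult_ac
          simp flip: sum_negf intro!: sum.cong)
    finally show ?thesis
      unfolding T_def by (subst sum.insert) (auto simp: finS c_def e1_def e2_def e3_def)
  qed
  moreover have "finite T" by (simp add: T_def finS)
  moreover have "e1 t + e2 t + e3 t \<le> m" if "t \<in> T" for t
    using that by (auto simp: T_def S_def e1_def e2_def e3_def)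
  ultimately show ?thesis using that by blast
qed

section \<open>Three-term equations in vector spaces over a finite field\<close>

text \<open>Vectors are functions vanishing from \<open>n\<close> on, so that all dimensions share
  one type and the pointwise \<open>+\<close>, \<open>-\<close>, \<open>0\<close> and finite sums of
  function spaces apply.\<close>

definition fspace :: "nat \<Rightarrow> (nat \<Rightarrow> 'a::zero) set" where
  "fspace n = {x. \<forall>i\<ge>n. x i = 0}"

definition scale :: "'a::times \<Rightarrow> (nat \<Rightarrow> 'a) \<Rightarrow> nat \<Rightarrow> 'a" (infixr "\<star>" 75) where
  "c \<star> x = (\<lambda>i. c * x i)"

lemma scale_apply [simp]: "(c \<star> x) i = c * x i"
  by (simp add: scale_def)

lemma fspace_closed [simp]:
  fixes x y :: "nat \<Rightarrow> 'a::field"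
  assumes "x \<in> fspace n" "y \<in> fspace n"
  shows "x + y \<in> fspace n" "x - y \<in> fspace n"
  using assms by (auto simp: fspace_def)

lemma fspace_closed1 [simp]:
  fixes x :: "nat \<Rightarrow> 'a::field"
  assumes "x \<in> fspace n"
  shows "- x \<in> fspace n" "c \<star> x \<in> fspace n"
  using assms by (auto simp: fspace_def)

lemma zero_in_fspace [simp]: "(0 :: nat \<Rightarrow> 'a::field) \<in> fspace n"
  by (simp add: fspace_def)

lemma scale_simps:
  fixes x y :: "nat \<Rightarrow> 'a::field"
  shows "c \<star> (x + y) = c \<star> x + c \<star> y" "c \<star> (x - y) = c \<star> x - c \<star> y"
    "(b + c) \<star> x = b \<star> x + c \<star> x" "b \<star> c \<star> x = (b * c) \<star> x" "1 \<star> x = x"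
    "c \<star> 0 = 0" "0 \<star> x = 0" "(- c) \<star> x = - (c \<star> x)" "c \<star> (- x) = - (c \<star> x)"
  by (auto simp: fun_eq_iff algebra_simps)

lemma bij_betw_fspace:
  "bij_betw (\<lambda>x. restrict x {..<n}) (fspace n) ({..<n} \<rightarrow>\<^sub>E (UNIV :: 'a::field set))"
proof (rule bij_betwI[where g = "\<lambda>x i. if i < n then x i else 0"])
  fix x :: "nat \<Rightarrow> 'a" assume "x \<in> fspace n"
  then show "(\<lambda>i. if i < n then restrict x {..<n} i else 0) = x"
    by (auto simp: fspace_def fun_eq_iff)
next
  fix y :: "nat \<Rightarrow> 'a" assume "y \<in> {..<n} \<rightarrow>\<^sub>E UNIV"
  then show "restrict (\<lambda>i. if i < n then y i else 0) {..<n} = y"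
    by (auto simp: fun_eq_iff PiE_def extensional_def)
qed (auto simp: fspace_def)

lemma finite_fspace [simp]: "finite (fspace n :: (nat \<Rightarrow> 'a::{field,finite}) set)"
  using bij_betw_finite[OF bij_betw_fspace[of n]] by (auto intro: finite_PiE)

lemma card_fspace: "card (fspace n :: (nat \<Rightarrow> 'a::{field,finite}) set) = CARD('a) ^ n"
  using bij_betw_same_card[OF bij_betw_fspace[of n, where 'a = 'a]] by (simp add: card_PiE)

text \<open>If a product of three monomials has degree at most \<open>m * d\<close>, one of the
  three has degree at most a third of that. The exponents of such a monomial will index the
  slices.\<close>

definition low_exponents :: "nat \<Rightarrow> nat \<Rightarrow> (nat \<Rightarrow> nat) set" where
  "low_exponents m d = {e \<in> {..<d} \<rightarrow>\<^sub>E {..m}. 3 * (\<Sum>j<d. e j) \<le> m * d}"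

lemma finite_low_exponents [simp]: "finite (low_exponents m d)"
  unfolding low_exponents_def
  by (rule finite_subset[of _ "{..<d} \<rightarrow>\<^sub>E {..m}"]) (auto intro: finite_PiE)

text \<open>An exponential moment bound: weighting each exponent vector by a power of some
  \<open>w < 1\<close> factorises over the coordinates and gives
  \<open>\<theta> = (\<Sum>i\<le>m. w ^ (3 * i)) / w ^ m\<close>. At \<open>w = 1\<close> this is
  \<open>m + 1\<close>, and the negative derivative of \<open>h\<close> at 1 makes \<theta> strictly
  smaller just to the left of 1.\<close>

lemma card_low_exponents:
  assumes "m \<ge> 1"
  obtains \<theta> :: real where "0 < \<theta>" "\<theta> < m + 1" "\<And>d. card (low_exponents m d) \<le> \<theta> ^ d"
proof -
  define h where "h = (\<lambda>w::real. real (m + 1) * w ^ m - (\<Sum>i\<le>m. w ^ (3 * i)))"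
  have "2 * (\<Sum>i\<le>m. 3 * i) = 3 * (m * (m + 1))"
    by (induction m) auto
  then have "real (2 * (\<Sum>i\<le>m. 3 * i)) = real (3 * (m * (m + 1)))" by (simp only:)
  then have gs: "(\<Sum>i\<le>m. real (3 * i)) = 3 * (real m * (m + 1) / 2)"
    by (simp only: of_nat_mult of_nat_sum of_nat_add)
  have "(h has_real_derivative ((m + 1) * m - (\<Sum>i\<le>m. real (3 * i)))) (at 1)"
    unfolding h_def by (auto intro!: derivative_eq_intros simp: algebra_simps)
  moreover have "real ((m + 1) * m) - (\<Sum>i\<le>m. real (3 * i)) < 0"
  proof -
    have "real ((m + 1) * m) - (\<Sum>i\<le>m. real (3 * i)) = - (real m * (real m + 1) / 2)"
      unfolding gs by (simp add: field_simps)
    also have "\<dots> < 0" using assms by simp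
    finally show ?thesis .
  qed
  ultimately obtain e where e: "e > 0" "\<And>u. 0 < u \<Longrightarrow> u < e \<Longrightarrow> h 1 < h (1 - u)"
    using DERIV_neg_dec_left by blast
  define w where "w = 1 - min (e / 2) (1 / 2)"
  have w: "0 < w" "w < 1" using e by (auto simp: w_def)
  have "h 1 < h w" unfolding w_def using e by (intro e) auto
  moreover have "h 1 = 0" by (simp add: h_def)
  ultimately have hw: "(\<Sum>i\<le>m. w ^ (3 * i)) < (m + 1) * w ^ m" by (simp add: h_def)
  define \<theta> where "\<theta> = (\<Sum>i\<le>m. w ^ (3 * i)) / w ^ m"
  have "card (low_exponents m d) \<le> \<theta> ^ d" for d
  proof -
    have "card (low_exponents m d) * w ^ (m * d) = (\<Sum>e\<in>low_exponents m d. w ^ (m * d))"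
      by simp
    also have "\<dots> \<le> (\<Sum>e\<in>low_exponents m d. w ^ (3 * (\<Sum>j<d. e j)))"
      using w by (intro sum_mono power_decreasing) (auto simp: low_exponents_def)
    also have "\<dots> \<le> (\<Sum>e\<in>{..<d} \<rightarrow>\<^sub>E {..m}. w ^ (3 * (\<Sum>j<d. e j)))"
      using w by (intro sum_mono2) (auto simp: low_exponents_def intro: finite_PiE)
    also have "\<dots> = (\<Sum>e\<in>{..<d} \<rightarrow>\<^sub>E {..m}. \<Prod>j<d. w ^ (3 * e j))"
      by (simp add: power_sum sum_distrib_left)
    also have "\<dots> = (\<Prod>j<d. \<Sum>i\<le>m. w ^ (3 * i))"
      by (subst prod_sum_PiE) auto
    also have "\<dots> = \<theta> ^ d * w ^ (m * d)"
      using w by (simp add: \<theta>_def power_divide power_mult)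
    finally show ?thesis using w by simp
  qed
  moreover have "0 < \<theta>" unfolding \<theta>_def using w by (intro divide_pos_pos sum_pos) auto
  moreover have "\<theta> < real m + 1" using hw w by (simp add: \<theta>_def field_simps)
  ultimately show ?thesis using that by blast
qed

text \<open>A nonzero \<open>u\<close> satisfies \<open>u ^ (q - 1) = 1\<close>, because
  multiplication by \<open>u\<close> permutes the nonzero elements and so preserves their product.
  Hence each factor is 1 or 0 according to whether the coordinate vanishes.\<close>

lemma indicator_zero_vector_eq_prod:
  fixes w :: "nat \<Rightarrow> 'a::{field,finite}"
  assumes "w \<in> fspace d"
  shows "(if w = 0 then 1 else 0) = (\<Prod>j<d. 1 - w j ^ (CARD('a) - 1))"
proof -
  have one: "u ^ (CARD('a) - 1) = 1" if "u \<noteq> 0" for u :: 'a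
  proof -
    have "(\<Prod>y\<in>UNIV - {0}. u * y) = (\<Prod>y\<in>UNIV - {0::'a}. y)"
      by (rule prod.reindex_bij_witness[of _ "\<lambda>y. y / u" "\<lambda>y. u * y"]) (use that in auto)
    then have "u ^ (CARD('a) - 1) * (\<Prod>y\<in>UNIV - {0::'a}. y) = (\<Prod>y\<in>UNIV - {0::'a}. y)"
      by (simp add: prod.distrib card_Diff_singleton)
    then show ?thesis by simp
  qed
  show ?thesis
  proof (cases "w = 0")
    case True
    then show ?thesis using card_ge2_field[where 'a = 'a] by (simp add: power_0_left)
  next
    case False
    then obtain i where "w i \<noteq> 0" by (auto simp: fun_eq_iff)
    moreover from this have "i < d" using assms by (auto simp: fspace_def not_less[symmetric])
    ultimately show ?thesis using False one by (auto intro!: bexI[of _ i])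
  qed
qed

text \<open>Terms that share the exponent of one variable form a single slice, so the number of
  slices is governed by the exponents in \<open>J\<close> rather than by the terms in
  \<open>C\<close>.\<close>

lemma sum_group_by_exponent:
  fixes F :: "'c \<Rightarrow> 'a::comm_ring_1"
  assumes "finite C" "finite J" "p ` C \<subseteq> J"
  shows "(\<Sum>\<tau>\<in>C. f (p \<tau>) * F \<tau>) = (\<Sum>j\<in>J. f j * (\<Sum>\<tau>\<in>{\<tau>\<in>C. p \<tau> = j}. F \<tau>))"
  by (subst sum.group[OF assms, symmetric]) (auto simp: sum_distrib_left intro!: sum.cong)

text \<open>As the coefficients sum to 0, \<open>triv\<close> makes the indicator of the equation on
  \<open>B\<close> a diagonal tensor. It is also a polynomial of degree at most
  \<open>m * d\<close>, so each monomial has low degree in one of the three variables, and grouping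
  by the exponents of that variable gives three families of slices.\<close>

lemma card_le_low_exponents:
  fixes B :: "(nat \<Rightarrow> 'a::{field,finite}) set"
  assumes b: "b1 + b2 + b3 = 0" and B: "B \<subseteq> fspace d"
    and triv: "\<And>x y z. x \<in> B \<Longrightarrow> y \<in> B \<Longrightarrow> z \<in> B \<Longrightarrow> b1 \<star> x + b2 \<star> y + b3 \<star> z = 0 \<Longrightarrow> x = y \<and> y = z"
  shows "card B \<le> 3 * card (low_exponents (CARD('a) - 1) d)"
proof -
  define m where "m = CARD('a) - 1"
  obtain T :: "(nat \<times> nat) option set" and c e1 e2 e3 where T: "finite T"
    and deg: "\<And>t. t \<in> T \<Longrightarrow> e1 t + e2 t + e3 t \<le> m"
    and expand: "\<And>x y z. 1 - (b1 * x + b2 * y + b3 * z) ^ m = (\<Sum>t\<in>T. c t * x ^ e1 t * y ^ e2 t * z ^ e3 t)"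
    by (rule one_minus_trinomial_power[of m b1 b2 b3]) (rule that)
  define P where "P = {..<d} \<rightarrow>\<^sub>E T"
  have finP: "finite P" unfolding P_def by (intro finite_PiE) (auto simp: T)
  define p where "p = (\<lambda>(e :: (nat \<times> nat) option \<Rightarrow> nat) \<tau>. \<lambda>j\<in>{..<d}. e (\<tau> j))"
  define low where "low = (\<lambda>(e :: (nat \<times> nat) option \<Rightarrow> nat) \<tau>. 3 * (\<Sum>j<d. e (\<tau> j)) \<le> m * d)"
  define mon where "mon = (\<lambda>(e::nat \<Rightarrow> nat) (x::nat \<Rightarrow> 'a). \<Prod>j<d. x j ^ e j)"
  \<comment> \<open>Each term goes to the first variable in which its degree is low, which makes the
    classes disjoint; a term in \<open>C3\<close> is low in the third variable by the degree
    bound.\<close>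
  define C1 where "C1 = {\<tau>\<in>P. low e1 \<tau>}"
  define C2 where "C2 = {\<tau>\<in>P. \<not> low e1 \<tau> \<and> low e2 \<tau>}"
  define C3 where "C3 = {\<tau>\<in>P. \<not> low e1 \<tau> \<and> \<not> low e2 \<tau>}"
  define cf where "cf = (\<lambda>\<tau>. \<Prod>j<d. c (\<tau> j))"
  define J where "J = low_exponents m d"
  have low3: "low e3 \<tau>" if "\<tau> \<in> C3" for \<tau>
  proof -
    have "(\<Sum>j<d. e1 (\<tau> j)) + (\<Sum>j<d. e2 (\<tau> j)) + (\<Sum>j<d. e3 (\<tau> j)) = (\<Sum>j<d. e1 (\<tau> j) + e2 (\<tau> j) + e3 (\<tau> j))"
      by (simp add: sum.distrib)
    also have "\<dots> \<le> (\<Sum>j<d. m)"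
      using that by (intro sum_mono deg) (auto simp: C3_def P_def)
    finally show ?thesis using that by (auto simp: C3_def low_def mult.commute)
  qed
  have pJ: "p e \<tau> \<in> J" if "low e \<tau>" "\<tau> \<in> P" "\<And>t. t \<in> T \<Longrightarrow> e t \<le> m" for e \<tau>
    using that by (auto simp: J_def low_exponents_def p_def low_def P_def)
  have dle: "e1 t \<le> m" "e2 t \<le> m" "e3 t \<le> m" if "t \<in> T" for t using deg[OF that] by auto
  have p1: "p e1 ` C1 \<subseteq> J" using pJ dle by (auto simp: C1_def)
  have p2: "p e2 ` C2 \<subseteq> J" using pJ dle by (auto simp: C2_def)
  have p3: "p e3 ` C3 \<subseteq> J" using pJ dle low3 by (auto simp: C3_def)
  have finC: "finite C1" "finite C2" "finite C3" using finP by (auto simp: C1_def C2_def C3_def)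
  have "card B \<le> 3 * card J"
  proof (rule slice_rank_diagonal[where ?f1.0 = mon and ?f2.0 = mon and ?f3.0 = mon
        and ?g1.0 = "\<lambda>j y z. \<Sum>\<tau>\<in>{\<tau>\<in>C1. p e1 \<tau> = j}. cf \<tau> * mon (p e2 \<tau>) y * mon (p e3 \<tau>) z"
        and ?g2.0 = "\<lambda>j x z. \<Sum>\<tau>\<in>{\<tau>\<in>C2. p e2 \<tau> = j}. cf \<tau> * mon (p e1 \<tau>) x * mon (p e3 \<tau>) z"
        and ?g3.0 = "\<lambda>j x y. \<Sum>\<tau>\<in>{\<tau>\<in>C3. p e3 \<tau> = j}. cf \<tau> * mon (p e1 \<tau>) x * mon (p e2 \<tau>) y"])
    show "finite B" using finite_subset[OF B] by simp
    show "finite J" by (simp add: J_def)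
    fix x y z assume xyz: "x \<in> B" "y \<in> B" "z \<in> B"
    then have G: "x \<in> fspace d" "y \<in> fspace d" "z \<in> fspace d" using B by auto
    have "b1 \<star> x + b2 \<star> x + b3 \<star> x = 0" by (simp add: b scale_simps flip: scale_simps(3))
    then have "(x = y \<and> y = z) \<longleftrightarrow> b1 \<star> x + b2 \<star> y + b3 \<star> z = 0" using triv[OF xyz] by auto
    then have "(if x = y \<and> y = z then 1 else 0 :: 'a) = (if b1 \<star> x + b2 \<star> y + b3 \<star> z = 0 then 1 else 0)"
      by simp
    also have "\<dots> = (\<Prod>j<d. 1 - ((b1 \<star> x + b2 \<star> y + b3 \<star> z) j) ^ (CARD('a) - 1))"
      by (rule indicator_zero_vector_eq_prod) (simp add: G)
    also have "\<dots> = (\<Prod>j<d. \<Sum>t\<in>T. c t * x j ^ e1 t * y j ^ e2 t * z j ^ e3 t)"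
      by (simp add: m_def[symmetric] expand del: One_nat_def)
    also have "\<dots> = (\<Sum>\<tau>\<in>P. \<Prod>j<d. c (\<tau> j) * x j ^ e1 (\<tau> j) * y j ^ e2 (\<tau> j) * z j ^ e3 (\<tau> j))"
      unfolding P_def by (rule prod_sum_PiE) (auto simp: T)
    also have "\<dots> = (\<Sum>\<tau>\<in>P. cf \<tau> * mon (p e1 \<tau>) x * mon (p e2 \<tau>) y * mon (p e3 \<tau>) z)"
      by (simp add: cf_def mon_def p_def prod.distrib)
    also have "P = C1 \<union> C2 \<union> C3" by (auto simp: C1_def C2_def C3_def)
    also have "(\<Sum>\<tau>\<in>C1 \<union> C2 \<union> C3. cf \<tau> * mon (p e1 \<tau>) x * mon (p e2 \<tau>) y * mon (p e3 \<tau>) z) =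
        (\<Sum>\<tau>\<in>C1. mon (p e1 \<tau>) x * (cf \<tau> * mon (p e2 \<tau>) y * mon (p e3 \<tau>) z))
      + (\<Sum>\<tau>\<in>C2. mon (p e2 \<tau>) y * (cf \<tau> * mon (p e1 \<tau>) x * mon (p e3 \<tau>) z))
      + (\<Sum>\<tau>\<in>C3. mon (p e3 \<tau>) z * (cf \<tau> * mon (p e1 \<tau>) x * mon (p e2 \<tau>) y))"
      by (subst sum.union_disjoint, use finC in simp, use finC in simp,
          (auto simp: C1_def C2_def C3_def)[1],
          subst sum.union_disjoint, use finC in simp, use finC in simp,
          (auto simp: C1_def C2_def C3_def)[1]) (simp add: mult_ac)
    finally show "(if x = y \<and> y = z then 1 else 0) =
        (\<Sum>j\<in>J. mon j x * (\<Sum>\<tau>\<in>{\<tau>\<in>C1. p e1 \<tau> = j}. cf \<tau> * mon (p e2 \<tau>) y * mon (p e3 \<tau>) z))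
      + (\<Sum>j\<in>J. mon j y * (\<Sum>\<tau>\<in>{\<tau>\<in>C2. p e2 \<tau> = j}. cf \<tau> * mon (p e1 \<tau>) x * mon (p e3 \<tau>) z))
      + (\<Sum>j\<in>J. mon j z * (\<Sum>\<tau>\<in>{\<tau>\<in>C3. p e3 \<tau> = j}. cf \<tau> * mon (p e1 \<tau>) x * mon (p e2 \<tau>) y))"
      unfolding sum_group_by_exponent[OF finC(1) \<open>finite J\<close> p1, of "\<lambda>j. mon j x"]
        sum_group_by_exponent[OF finC(2) \<open>finite J\<close> p2, of "\<lambda>j. mon j y"]
        sum_group_by_exponent[OF finC(3) \<open>finite J\<close> p3, of "\<lambda>j. mon j z"] .
  qed
  then show ?thesis by (simp add: J_def m_def)
qed

text \<open>The base \<theta> is fixed before the dimension, the set and the coefficients. Its being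
  strictly below \<open>q\<close> is the exponential saving that makes all later losses polynomial
  in the density.\<close>

lemma capset_bound:
  "\<exists>\<theta>::real. 0 < \<theta> \<and> \<theta> < CARD('a::{field,finite}) \<and>
    (\<forall>d (B :: (nat \<Rightarrow> 'a) set) b1 b2 b3. b1 + b2 + b3 = 0 \<longrightarrow> B \<subseteq> fspace d \<longrightarrow>
      (\<forall>x\<in>B. \<forall>y\<in>B. \<forall>z\<in>B. b1 \<star> x + b2 \<star> y + b3 \<star> z = 0 \<longrightarrow> x = y \<and> y = z) \<longrightarrow>
      card B \<le> 3 * \<theta> ^ d)"
proof -
  let ?m = "CARD('a) - 1"
  have m: "?m \<ge> 1" using card_ge2_field[where 'a = 'a] by simp
  obtain \<theta> :: real where \<theta>: "0 < \<theta>" "\<theta> < real ?m + 1" "\<And>d. card (low_exponents ?m d) \<le> \<theta> ^ d"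
    using card_low_exponents[OF m] by metis
  have "card B \<le> 3 * \<theta> ^ d" if "b1 + b2 + b3 = 0" "B \<subseteq> fspace d"
      "\<forall>x\<in>B. \<forall>y\<in>B. \<forall>z\<in>B. b1 \<star> x + b2 \<star> y + b3 \<star> z = 0 \<longrightarrow> x = y \<and> y = z"
    for d and B :: "(nat \<Rightarrow> 'a) set" and b1 b2 b3
  proof -
    have "card B \<le> 3 * card (low_exponents ?m d)"
      using that by (intro card_le_low_exponents) auto
    also have "real \<dots> \<le> 3 * \<theta> ^ d" using \<theta>(3)[of d] by simp
    finally show ?thesis by simp
  qed
  moreover have "\<theta> < CARD('a)" using \<theta>(2) m by simp
  ultimately show ?thesis using \<theta>(1) by blast
qed

section \<open>Supersaturation\<close>

text \<open>Slot \<open>d\<close> of \<open>v\<close> holds the translation and the slots below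
  \<open>d\<close> the linear part, so a random affine map is a uniform choice of
  \<open>d + 1\<close> vectors.\<close>

definition affine_map :: "nat \<Rightarrow> (nat \<Rightarrow> nat \<Rightarrow> 'a::field) \<Rightarrow> (nat \<Rightarrow> 'a) \<Rightarrow> nat \<Rightarrow> 'a" where
  "affine_map d v u = (\<lambda>i. v d i + (\<Sum>j<d. u j * v j i))"

lemma affine_map_combination:
  fixes b1 :: "'a::field"
  assumes "b1 + b2 + b3 = 0" "b1 \<star> u1 + b2 \<star> u2 + b3 \<star> u3 = 0"
  shows "b1 \<star> affine_map d v u1 + b2 \<star> affine_map d v u2 + b3 \<star> affine_map d v u3 = 0"
proof
  fix i
  have "(b1 \<star> affine_map d v u1 + b2 \<star> affine_map d v u2 + b3 \<star> affine_map d v u3) i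
    = (b1 + b2 + b3) * v d i + (\<Sum>j<d. (b1 \<star> u1 + b2 \<star> u2 + b3 \<star> u3) j * v j i)"
    by (simp add: affine_map_def algebra_simps sum_distrib_left sum.distrib)
  also have "\<dots> = 0" using assms by simp
  finally show "(b1 \<star> affine_map d v u1 + b2 \<star> affine_map d v u2 + b3 \<star> affine_map d v u3) i = 0 i" by simp
qed

text \<open>The linear part can be chosen freely; the translation is then solved for so that
  \<open>u\<close> is sent to a prescribed point of \<open>D\<close>.\<close>

lemma card_affine_maps_into:
  fixes D :: "(nat \<Rightarrow> 'a::{field,finite}) set"
  assumes D: "D \<subseteq> fspace n"
  shows "card D * (CARD('a) ^ n) ^ d \<le> card {v \<in> {..d} \<rightarrow>\<^sub>E fspace n. affine_map d v u \<in> D}"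
proof -
  let ?W = "{..<d} \<rightarrow>\<^sub>E (fspace n :: (nat \<Rightarrow> 'a) set)"
  let ?V = "{v \<in> {..d} \<rightarrow>\<^sub>E fspace n. affine_map d v u \<in> D}"
  define F where "F = (\<lambda>(y, w :: nat \<Rightarrow> nat \<Rightarrow> 'a). w(d := (\<lambda>i. y i - (\<Sum>j<d. u j * w j i))))"
  have "inj_on F (D \<times> ?W)"
  proof (rule inj_onI)
    fix p p' assume p: "p \<in> D \<times> ?W" "p' \<in> D \<times> ?W" "F p = F p'"
    obtain y w y' w' where pp: "p = (y, w)" "p' = (y', w')" by (cases p, cases p')
    with p have w: "w \<in> ?W" "w' \<in> ?W" and eq: "F (y, w) = F (y', w')" by auto
    have ww: "w j = w' j" if "j < d" for j
      using fun_cong[OF eq, of j] that by (simp add: F_def)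
    then have "w = w'" by (intro PiE_ext[OF w]) auto
    moreover have "y = y'"
      using fun_cong[OF eq, of d] ww by (simp add: F_def fun_eq_iff)
    ultimately show "p = p'" by (simp add: pp)
  qed
  moreover have "F ` (D \<times> ?W) \<subseteq> ?V"
  proof (rule image_subsetI)
    fix p assume "p \<in> D \<times> ?W"
    then obtain y w where p: "p = (y, w)" and yw: "y \<in> D" "w \<in> ?W" by auto
    then have "y \<in> fspace n" using D by auto
    then have "F (y, w) \<in> {..d} \<rightarrow>\<^sub>E fspace n"
      using yw by (auto simp: F_def PiE_def Pi_def extensional_def fspace_def less_le)
    moreover have "affine_map d (F (y, w)) u = y"
      by (simp add: affine_map_def F_def)
    ultimately show "F p \<in> ?V" using yw p by simp
  qed
  moreover have "finite ?V"
    by (rule finite_subset[of _ "{..d} \<rightarrow>\<^sub>E fspace n"]) (auto intro!: finite_PiE)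
  ultimately have "card (D \<times> ?W) \<le> card ?V" by (intro card_inj_on_le)
  then show ?thesis by (simp add: card_cartesian_product card_PiE card_fspace)
qed

text \<open>At a coordinate \<open>j0\<close> where \<open>u\<close> and \<open>u'\<close> differ,
  the difference of the two values determines \<open>v j0\<close> from the other linear slots, and
  then the translation is determined too. So \<open>d - 1\<close> vectors remain free; multiplying
  by \<open>N\<^sup>2\<close> avoids the subtraction.\<close>

lemma card_affine_maps_through_two_points:
  fixes x y :: "nat \<Rightarrow> 'a::{field,finite}"
  assumes u: "u \<in> fspace d" "u' \<in> fspace d" "u \<noteq> u'"
  shows "card {v \<in> {..d} \<rightarrow>\<^sub>E fspace n. affine_map d v u = x \<and> affine_map d v u' = y} * (CARD('a) ^ n) ^ 2
    \<le> (CARD('a) ^ n) ^ (d + 1)"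
proof -
  let ?V = "{v \<in> {..d} \<rightarrow>\<^sub>E fspace n. affine_map d v u = x \<and> affine_map d v u' = y}"
  obtain j0 where j0: "u j0 \<noteq> u' j0" using u by (auto simp: fun_eq_iff)
  then have j0d: "j0 < d" using u by (auto simp: fspace_def not_less[symmetric])
  let ?I = "{..<d} - {j0}"
  have "inj_on (\<lambda>v. restrict v ?I) ?V"
  proof (rule inj_onI, clarify)
    fix v w
    assume vw: "v \<in> {..d} \<rightarrow>\<^sub>E fspace n" "w \<in> {..d} \<rightarrow>\<^sub>E fspace n"
      and eq: "restrict v ?I = restrict w ?I"
      and e: "affine_map d w u = affine_map d v u" "affine_map d w u' = affine_map d v u'"
    have ag: "v j = w j" if "j < d" "j \<noteq> j0" for j
      using fun_cong[OF eq, of j] that by simp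
    have "v j0 i = w j0 i" for i
    proof -
      have "affine_map d v u i - affine_map d v u' i = affine_map d w u i - affine_map d w u' i"
        by (simp add: e)
      then have "(\<Sum>j<d. (u j - u' j) * v j i) = (\<Sum>j<d. (u j - u' j) * w j i)"
        by (simp add: affine_map_def left_diff_distrib sum_subtractf)
      then have "(u j0 - u' j0) * v j0 i + (\<Sum>j\<in>?I. (u j - u' j) * v j i)
        = (u j0 - u' j0) * w j0 i + (\<Sum>j\<in>?I. (u j - u' j) * w j i)"
        using j0d by (simp add: sum.remove[of "{..<d}" j0])
      moreover have "(\<Sum>j\<in>?I. (u j - u' j) * v j i) = (\<Sum>j\<in>?I. (u j - u' j) * w j i)"
        by (intro sum.cong) (auto simp: ag)
      ultimately show ?thesis using j0 by simp
    qed
    then have ag': "v j = w j" if "j < d" for j using ag that by (cases "j = j0") auto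
    have "v d i = w d i" for i
      using fun_cong[OF e(1), of i] ag' by (simp add: affine_map_def)
    then have "v d = w d" by (simp add: fun_eq_iff)
    then show "v = w" using ag' by (intro PiE_ext[OF vw]) (auto simp: le_less)
  qed
  moreover have "(\<lambda>v. restrict v ?I) ` ?V \<subseteq> ?I \<rightarrow>\<^sub>E fspace n"
    by (auto simp: PiE_def Pi_def)
  ultimately have "card ?V \<le> card (?I \<rightarrow>\<^sub>E (fspace n :: (nat \<Rightarrow> 'a) set))"
    by (intro card_inj_on_le finite_PiE) auto
  also have "\<dots> = (CARD('a) ^ n) ^ (d - 1)"
    using j0d by (simp add: card_PiE card_fspace)
  finally have "card ?V * (CARD('a) ^ n) ^ 2 \<le> (CARD('a) ^ n) ^ (d - 1) * (CARD('a) ^ n) ^ 2"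
    by simp
  also have "\<dots> = (CARD('a) ^ n) ^ (d + 1)"
    using j0d by (simp flip: power_add)
  finally show ?thesis .
qed

definition sols3 :: "'a::field \<Rightarrow> 'a \<Rightarrow> 'a \<Rightarrow> (nat \<Rightarrow> 'a) set \<Rightarrow> ((nat \<Rightarrow> 'a) \<times> (nat \<Rightarrow> 'a) \<times> (nat \<Rightarrow> 'a)) set" where
  "sols3 b1 b2 b3 D = {(x, y, z). x \<in> D \<and> y \<in> D \<and> z \<in> D \<and> b1 \<star> x + b2 \<star> y + b3 \<star> z = 0}"

lemma finite_sols3 [simp]: "finite D \<Longrightarrow> finite (sols3 b1 b2 b3 D)"
  by (rule finite_subset[of _ "D \<times> D \<times> D"]) (auto simp: sols3_def)

text \<open>Averaging over all affine maps from a space of bounded dimension \<open>d\<close>: a positive proportion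
  of them pull \<open>D\<close> back to a set that is too dense to have only trivial solutions.\<close>

lemma varnavides:
  fixes D :: "(nat \<Rightarrow> 'a::{field,finite}) set" and \<alpha> :: real
  assumes b: "b3 \<noteq> 0" "b1 + b2 + b3 = 0" and D: "D \<subseteq> fspace n"
    and \<alpha>: "0 \<le> \<alpha>" "\<alpha> * CARD('a) ^ n \<le> card D"
    and dense: "\<And>B. B \<subseteq> fspace d \<Longrightarrow> \<alpha> / 2 * CARD('a) ^ d \<le> card B \<Longrightarrow>
      \<exists>x\<in>B. \<exists>y\<in>B. \<exists>z\<in>B. b1 \<star> x + b2 \<star> y + b3 \<star> z = 0 \<and> \<not> (x = y \<and> y = z)"
  shows "\<alpha> / 2 * (CARD('a) ^ n) ^ 2 \<le> (CARD('a) ^ d) ^ 2 * card (sols3 b1 b2 b3 D)"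
proof -
  define N Q where "N = real (CARD('a) ^ n)" and "Q = real (CARD('a) ^ d)"
  have NQ: "N > 0" "Q > 0" by (auto simp: N_def Q_def)
  define V where "V = {..d} \<rightarrow>\<^sub>E (fspace n :: (nat \<Rightarrow> 'a) set)"
  have finV: "finite V" unfolding V_def by (intro finite_PiE) auto
  have cardV: "real (card V) = N ^ (d + 1)"
    by (simp add: V_def card_PiE card_fspace N_def)
  have finD: "finite D" using finite_subset[OF D] by simp
  define P where "P = (\<lambda>v. {u \<in> fspace d. affine_map d v u \<in> D})"
  define good where "good = {v\<in>V. \<alpha> / 2 * Q \<le> card (P v)}"
  have fing: "finite good" using finV by (simp add: good_def)
  \<comment> \<open>Pairs of a map \<open>v\<close> and a point \<open>u\<close> sent into
    \<open>D\<close> are counted in two ways. Maps outside \<open>good\<close> account for at most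
    half of the lower bound, and each good map for at most \<open>Q\<close> points.\<close>
  have "Q * (\<alpha> * N * N ^ d) \<le> Q * (card D * N ^ d)"
    using \<alpha> NQ by (intro mult_left_mono mult_right_mono) (auto simp: N_def)
  also have "\<dots> = (\<Sum>u\<in>(fspace d :: (nat \<Rightarrow> 'a) set). card D * N ^ d)"
    by (simp add: card_fspace Q_def)
  also have "\<dots> \<le> (\<Sum>u\<in>(fspace d :: (nat \<Rightarrow> 'a) set). real (card {v\<in>V. affine_map d v u \<in> D}))"
  proof (intro sum_mono)
    fix u :: "nat \<Rightarrow> 'a"
    have "real (card D * (CARD('a) ^ n) ^ d) \<le> card {v\<in>V. affine_map d v u \<in> D}"
      using card_affine_maps_into[OF D, of d u] unfolding V_def of_nat_le_iff .
    then show "real (card D) * N ^ d \<le> card {v\<in>V. affine_map d v u \<in> D}"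
      by (simp add: N_def)
  qed
  also have "\<dots> = real (\<Sum>v\<in>V. card (P v))"
    unfolding P_def of_nat_sum[symmetric]
    by (intro arg_cong[where f = real] sum_multicount_gen) (auto simp: finV)
  also have "\<dots> = (\<Sum>v\<in>good. real (card (P v))) + (\<Sum>v\<in>V - good. real (card (P v)))"
    using finV by (simp add: sum.subset_diff[of good V] good_def)
  also have "\<dots> \<le> (\<Sum>v\<in>good. Q) + (\<Sum>v\<in>V - good. \<alpha> / 2 * Q)"
  proof (intro add_mono sum_mono)
    fix v show "real (card (P v)) \<le> Q"
      unfolding Q_def card_fspace[symmetric] P_def by (intro of_nat_mono card_mono) auto
  next
    fix v assume "v \<in> V - good"
    then show "real (card (P v)) \<le> \<alpha> / 2 * Q" by (auto simp: good_def)
  qed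
  also have "\<dots> \<le> card good * Q + N ^ (d + 1) * (\<alpha> / 2 * Q)"
  proof -
    have "real (card (V - good)) \<le> N ^ (d + 1)"
      unfolding cardV[symmetric] by (intro of_nat_mono card_mono finV) auto
    then show ?thesis using \<alpha> NQ by (auto intro!: mult_right_mono)
  qed
  finally have "Q * (\<alpha> / 2 * N ^ (d + 1)) \<le> Q * card good"
    by (simp add: algebra_simps)
  then have lower: "\<alpha> / 2 * N ^ (d + 1) \<le> card good" using NQ by simp
  define U where "U = {(u, u'). u \<in> fspace d \<and> u' \<in> fspace d \<and> u \<noteq> (u' :: nat \<Rightarrow> 'a)}"
  define fib where "fib = (\<lambda>(u, u') (x, y, z :: nat \<Rightarrow> 'a). {v\<in>V. affine_map d v u = x \<and> affine_map d v u' = y})"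
  let ?T = "sols3 b1 b2 b3 D"
  have UQ: "U \<subseteq> fspace d \<times> fspace d" by (auto simp: U_def)
  have "card U \<le> card ((fspace d :: (nat \<Rightarrow> 'a) set) \<times> (fspace d :: (nat \<Rightarrow> 'a) set))"
    by (rule card_mono[OF _ UQ]) simp
  then have cardU: "real (card U) \<le> Q ^ 2"
    by (simp add: card_cartesian_product card_fspace Q_def power2_eq_square flip: of_nat_mult of_nat_power)
  have finU: "finite U" using finite_subset[OF UQ] by simp
  \<comment> \<open>A good map carries a nontrivial solution of its pullback to a solution in
    \<open>D\<close>, possibly a trivial one. It therefore lies in the fibre given by the points
    \<open>u1\<close>, \<open>u2\<close> and that image.\<close>
  have "good \<subseteq> (\<Union>p\<in>U \<times> ?T. fib (fst p) (snd p))"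
  proof
    fix v assume v: "v \<in> good"
    have "P v \<subseteq> fspace d" "\<alpha> / 2 * CARD('a) ^ d \<le> card (P v)"
      using v by (auto simp: P_def good_def Q_def)
    then obtain u1 u2 u3 where u: "u1 \<in> P v" "u2 \<in> P v" "u3 \<in> P v"
        "b1 \<star> u1 + b2 \<star> u2 + b3 \<star> u3 = 0" "\<not> (u1 = u2 \<and> u2 = u3)"
      using dense[of "P v"] by blast
    \<comment> \<open>If the first two points were equal, the vanishing coefficient sum and
      \<open>b3 \<noteq> 0\<close> would force the third to coincide with them.\<close>
    have "u1 \<noteq> u2"
    proof
      assume eq: "u1 = u2"
      have "b3 * u3 i = b3 * u1 i" for i
      proof -
        have "b1 * u1 i + b2 * u1 i + b3 * u3 i = 0" using fun_cong[OF u(4), of i] eq by simp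
        then have "b3 * u3 i = - (b1 + b2) * u1 i" by (simp add: algebra_simps eq_neg_iff_add_eq_0)
        also have "- (b1 + b2) = b3" by (rule minus_unique[OF b(2)])
        finally show ?thesis .
      qed
      then have "u3 = u1" using b(1) by (auto simp: fun_eq_iff)
      then show False using u(5) eq by simp
    qed
    then have "(u1, u2) \<in> U" using u by (auto simp: U_def P_def)
    moreover have "(affine_map d v u1, affine_map d v u2, affine_map d v u3) \<in> ?T"
      using u affine_map_combination[OF b(2) u(4)] by (auto simp: sols3_def P_def)
    ultimately show "v \<in> (\<Union>p\<in>U \<times> ?T. fib (fst p) (snd p))"
      using v by (intro UN_I[of "((u1, u2), _, _, _)"]) (auto simp: fib_def good_def)
  qed
  then have "card good \<le> card (\<Union>p\<in>U \<times> ?T. fib (fst p) (snd p))"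
    by (intro card_mono) (auto simp: finU finD fib_def finV split: prod.splits)
  also have "\<dots> \<le> (\<Sum>p\<in>U \<times> ?T. card (fib (fst p) (snd p)))"
    by (intro card_UN_le) (auto simp: finU finD)
  finally have "real (card good) * N ^ 2 \<le> (\<Sum>p\<in>U \<times> ?T. real (card (fib (fst p) (snd p)))) * N ^ 2"
    using NQ by (intro mult_right_mono) (simp_all flip: of_nat_sum)
  also have "\<dots> = (\<Sum>p\<in>U \<times> ?T. real (card (fib (fst p) (snd p))) * N ^ 2)"
    by (simp add: sum_distrib_right)
  also have "\<dots> \<le> (\<Sum>p\<in>U \<times> ?T. N ^ (d + 1))"
  proof (intro sum_mono)
    fix p assume "p \<in> U \<times> ?T"
    then obtain u u' x y z where p: "p = ((u, u'), x, y, z)" "u \<in> fspace d" "u' \<in> fspace d" "u \<noteq> u'"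
      by (auto simp: U_def)
    have "real (card (fib (fst p) (snd p)) * (CARD('a) ^ n) ^ 2) \<le> real ((CARD('a) ^ n) ^ (d + 1))"
      unfolding of_nat_le_iff fib_def V_def p using card_affine_maps_through_two_points[OF p(2-4), of n x y] by simp
    then show "real (card (fib (fst p) (snd p))) * N ^ 2 \<le> N ^ (d + 1)"
      by (simp add: N_def)
  qed
  also have "\<dots> = card U * card ?T * N ^ (d + 1)" by (simp add: card_cartesian_product)
  also have "\<dots> \<le> Q ^ 2 * card ?T * N ^ (d + 1)"
    using cardU NQ by (auto intro!: mult_right_mono)
  finally have "real (card good) * N ^ 2 \<le> Q ^ 2 * card ?T * N ^ (d + 1)" .
  moreover have "\<alpha> / 2 * N ^ (d + 1) * N ^ 2 \<le> real (card good) * N ^ 2"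
    using lower NQ by (intro mult_right_mono) auto
  ultimately have "N ^ (d + 1) * (\<alpha> / 2 * N ^ 2) \<le> N ^ (d + 1) * (Q ^ 2 * card ?T)"
    by (simp add: mult_ac)
  then have "\<alpha> / 2 * N ^ 2 \<le> Q ^ 2 * card ?T" using NQ by simp
  then show ?thesis by (simp add: N_def Q_def)
qed

text \<open>With \<open>\<rho> = q / \<theta>\<close>, the dimension used for averaging is the least
  \<open>d\<close> with \<open>6 / \<alpha> < \<rho> ^ d\<close>, so that
  \<open>3 * \<theta> ^ d\<close> is below \<open>\<alpha> / 2 * q ^ d\<close>. Minimality bounds
  \<open>\<rho> ^ (d - 1)\<close> by \<open>6 / \<alpha>\<close>, and as \<open>q\<close> is below
  some power of \<rho>, the loss \<open>q ^ (2 * d)\<close> is polynomial in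
  \<open>1 / \<alpha>\<close>.\<close>

lemma supersaturation3:
  "\<exists>(c::real) K. 0 < c \<and> (\<forall>n (D :: (nat \<Rightarrow> 'a::{field,finite}) set) (\<alpha>::real) b1 b2 b3.
      b3 \<noteq> 0 \<longrightarrow> b1 + b2 + b3 = 0 \<longrightarrow> D \<subseteq> fspace n \<longrightarrow> 0 < \<alpha> \<longrightarrow> \<alpha> * CARD('a) ^ n \<le> card D \<longrightarrow>
      c * \<alpha> ^ K * (CARD('a) ^ n) ^ 2 \<le> card (sols3 b1 b2 b3 D))"
proof -
  define q where "q = real CARD('a)"
  have q: "q \<ge> 2" using card_ge2_field[where 'a = 'a] by (simp add: q_def)
  obtain \<theta> :: real where \<theta>: "0 < \<theta>" "\<theta> < CARD('a)"
    and cap: "\<And>d (B :: (nat \<Rightarrow> 'a) set) b1 b2 b3. b1 + b2 + b3 = 0 \<Longrightarrow> B \<subseteq> fspace d \<Longrightarrow>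
      \<forall>x\<in>B. \<forall>y\<in>B. \<forall>z\<in>B. b1 \<star> x + b2 \<star> y + b3 \<star> z = 0 \<longrightarrow> x = y \<and> y = z \<Longrightarrow>
      card B \<le> 3 * \<theta> ^ d"
    using capset_bound[where 'a = 'a] by blast
  define \<rho> where "\<rho> = q / \<theta>"
  have \<rho>: "\<rho> > 1" using \<theta> by (simp add: \<rho>_def q_def)
  obtain L where L: "q < \<rho> ^ L" using real_arch_pow[OF \<rho>] by blast
  define c where "c = 1 / (2 * q ^ 2 * 6 ^ (2 * L))"
  show ?thesis
  proof (intro exI[of _ c] exI[of _ "2 * L + 1"] conjI allI impI)
    show "0 < c" using q by (simp add: c_def)
    fix n and D :: "(nat \<Rightarrow> 'a) set" and \<alpha> :: real and b1 b2 b3 :: 'a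
    assume b: "b3 \<noteq> 0" "b1 + b2 + b3 = 0" and D: "D \<subseteq> fspace n"
      and \<alpha>: "0 < \<alpha>" "\<alpha> * CARD('a) ^ n \<le> card D"
    have "card D \<le> CARD('a) ^ n" unfolding card_fspace[symmetric] by (intro card_mono D) auto
    then have "\<alpha> * CARD('a) ^ n \<le> 1 * CARD('a) ^ n" using \<alpha>(2) by linarith
    then have \<alpha>1: "\<alpha> \<le> 1" by (simp add: mult_le_cancel_right)
    define d where "d = (LEAST d. 6 / \<alpha> < \<rho> ^ d)"
    have d: "6 / \<alpha> < \<rho> ^ d" unfolding d_def using real_arch_pow[OF \<rho>] by (rule LeastI_ex)
    have "d \<noteq> 0" using d \<alpha> \<alpha>1 by (intro notI) (simp add: field_simps)
    then have d': "\<rho> ^ (d - 1) \<le> 6 / \<alpha>"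
      using not_less_Least[of "d - 1" "\<lambda>d. 6 / \<alpha> < \<rho> ^ d"] by (simp add: d_def)
    have "\<alpha> / 2 * (CARD('a) ^ n) ^ 2 \<le> (CARD('a) ^ d) ^ 2 * card (sols3 b1 b2 b3 D)"
    proof (rule varnavides[OF b D less_imp_le[OF \<alpha>(1)] \<alpha>(2)])
      fix B :: "(nat \<Rightarrow> 'a) set" assume B: "B \<subseteq> fspace d" "\<alpha> / 2 * CARD('a) ^ d \<le> card B"
      show "\<exists>x\<in>B. \<exists>y\<in>B. \<exists>z\<in>B. b1 \<star> x + b2 \<star> y + b3 \<star> z = 0 \<and> \<not> (x = y \<and> y = z)"
      proof (rule ccontr)
        assume "\<not> ?thesis"
        then have "card B \<le> 3 * \<theta> ^ d" using cap[OF b(2) B(1)] by blast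
        with B(2) have "\<alpha> / 2 * q ^ d \<le> 3 * \<theta> ^ d" by (simp add: q_def)
        then have "\<rho> ^ d \<le> 6 / \<alpha>" using \<alpha> \<theta> by (simp add: \<rho>_def power_divide field_simps)
        then show False using d by simp
      qed
    qed
    also have "real ((CARD('a) ^ d) ^ 2 * card (sols3 b1 b2 b3 D)) = q ^ (2 * d) * card (sols3 b1 b2 b3 D)"
      by (simp add: q_def power_mult[symmetric] mult.commute)
    also have "q ^ (2 * d) = q ^ 2 * (q ^ (d - 1)) ^ 2"
      using \<open>d \<noteq> 0\<close> by (cases d) (simp_all add: power_mult_distrib power_mult mult.commute power2_eq_square)
    also have "(q ^ (d - 1)) ^ 2 \<le> ((\<rho> ^ L) ^ (d - 1)) ^ 2"
      using L q by (intro power_mono) auto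
    also have "((\<rho> ^ L) ^ (d - 1)) ^ 2 = (\<rho> ^ (d - 1)) ^ (2 * L)"
      by (simp flip: power_mult add: mult_ac)
    also have "\<dots> \<le> (6 / \<alpha>) ^ (2 * L)"
      using d' \<rho> by (intro power_mono) auto
    finally have "\<alpha> / 2 * (q ^ n) ^ 2 \<le> q ^ 2 * (6 / \<alpha>) ^ (2 * L) * card (sols3 b1 b2 b3 D)"
      using q by (simp add: q_def mult_left_mono mult_right_mono)
    then have "c * \<alpha> ^ (2 * L + 1) * (q ^ n) ^ 2 \<le> card (sols3 b1 b2 b3 D)"
      using \<alpha> q by (simp add: c_def power_divide field_simps)
    then show "c * \<alpha> ^ (2 * L + 1) * (CARD('a) ^ n) ^ 2 \<le> card (sols3 b1 b2 b3 D)"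
      by (simp add: q_def)
  qed
qed

section \<open>From three variables to five\<close>

text \<open>These are the ways to split the term \<open>(b1 + b2) \<star> x\<close> into two terms
  with variables in \<open>D\<close>, which undoes the merging of two variables.\<close>

definition reps :: "'a::field \<Rightarrow> 'a \<Rightarrow> (nat \<Rightarrow> 'a) set \<Rightarrow> (nat \<Rightarrow> 'a) \<Rightarrow> ((nat \<Rightarrow> 'a) \<times> (nat \<Rightarrow> 'a)) set" where
  "reps b1 b2 D x = {(y, z). y \<in> D \<and> z \<in> D \<and> b1 \<star> y + b2 \<star> z = (b1 + b2) \<star> x}"

lemma finite_reps [simp]: "finite D \<Longrightarrow> finite (reps b1 b2 D x)"
  by (rule finite_subset[of _ "D \<times> D"]) (auto simp: reps_def)

lemma card_reps_le:
  assumes "finite D" "b2 \<noteq> 0"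
  shows "card (reps b1 b2 D x) \<le> card D"
proof (rule card_inj_on_le[where f = fst])
  show "inj_on fst (reps b1 b2 D x)"
  proof (rule inj_onI)
    fix p p' assume p: "p \<in> reps b1 b2 D x" "p' \<in> reps b1 b2 D x" "fst p = fst p'"
    then have "b1 \<star> fst p + b2 \<star> snd p = (b1 + b2) \<star> x" "b1 \<star> fst p + b2 \<star> snd p' = (b1 + b2) \<star> x"
      by (auto simp: reps_def)
    then have "b1 \<star> fst p + b2 \<star> snd p = b1 \<star> fst p + b2 \<star> snd p'" by (simp only:)
    then have "b2 \<star> snd p = b2 \<star> snd p'" by simp
    then have "snd p = snd p'" using assms(2) by (auto simp: fun_eq_iff)
    then show "p = p'" using p by (simp add: prod_eq_iff)
  qed
qed (use assms in \<open>auto simp: reps_def\<close>)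

text \<open>Solutions with coefficients \<open>b1\<close>, \<open>b2\<close>,
  \<open>- (b1 + b2)\<close> are sorted by the last variable. Elements with few representations
  carry at most half of the solutions guaranteed by \<open>supersaturation3\<close>, and no element
  carries more than \<open>N\<close>.\<close>

lemma popular_elements:
  "\<exists>(c::real) K. 0 < c \<and> (\<forall>n (D :: (nat \<Rightarrow> 'a::{field,finite}) set) (\<alpha>::real) b1 b2.
      b2 \<noteq> 0 \<longrightarrow> b1 + b2 \<noteq> 0 \<longrightarrow> D \<subseteq> fspace n \<longrightarrow> 0 < \<alpha> \<longrightarrow> \<alpha> * CARD('a) ^ n \<le> card D \<longrightarrow>
      (\<exists>D'\<subseteq>D. c * \<alpha> ^ K * CARD('a) ^ n \<le> card D' \<and>
        (\<forall>x\<in>D'. c * \<alpha> ^ K * CARD('a) ^ n \<le> card (reps b1 b2 D x))))"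
proof -
  obtain c :: real and K where c: "0 < c" and sat: "\<And>n (D :: (nat \<Rightarrow> 'a) set) (\<alpha>::real) b1 b2 b3.
      b3 \<noteq> 0 \<Longrightarrow> b1 + b2 + b3 = 0 \<Longrightarrow> D \<subseteq> fspace n \<Longrightarrow> 0 < \<alpha> \<Longrightarrow> \<alpha> * CARD('a) ^ n \<le> card D \<Longrightarrow>
      c * \<alpha> ^ K * (CARD('a) ^ n) ^ 2 \<le> card (sols3 b1 b2 b3 D)"
    using supersaturation3[where 'a = 'a] by blast
  show ?thesis
  proof (intro exI[of _ "c / 2"] exI[of _ K] conjI allI impI)
    show "0 < c / 2" using c by simp
    fix n and D :: "(nat \<Rightarrow> 'a) set" and \<alpha> :: real and b1 b2 :: 'a
    assume b: "b2 \<noteq> 0" "b1 + b2 \<noteq> 0" and D: "D \<subseteq> fspace n" and \<alpha>: "0 < \<alpha>" "\<alpha> * CARD('a) ^ n \<le> card D"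
    define N where "N = real (CARD('a) ^ n)"
    have N: "N > 0" by (simp add: N_def)
    define \<beta> where "\<beta> = c / 2 * \<alpha> ^ K"
    have \<beta>: "0 \<le> \<beta>" using c \<alpha> by (simp add: \<beta>_def)
    have finD: "finite D" using finite_subset[OF D] by simp
    have "card D \<le> CARD('a) ^ n" unfolding card_fspace[symmetric] by (intro card_mono D) auto
    then have DN: "real (card D) \<le> N" unfolding N_def of_nat_le_iff .
    define D' where "D' = {x\<in>D. \<beta> * N \<le> card (reps b1 b2 D x)}"
    have sub: "D' \<subseteq> D" by (auto simp: D'_def)
    let ?T = "sols3 b1 b2 (- (b1 + b2)) D"
    have "2 * \<beta> * N ^ 2 = c * \<alpha> ^ K * (CARD('a) ^ n) ^ 2" by (simp add: \<beta>_def N_def)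
    also have "\<dots> \<le> card ?T" using b D \<alpha> by (intro sat) auto
    also have "?T = (\<lambda>(x, y, z). (y, z, x)) ` (SIGMA x:D. reps b1 b2 D x)"
    proof -
      have "b1 \<star> y + b2 \<star> z + (- (b1 + b2)) \<star> x = 0 \<longleftrightarrow> b1 \<star> y + b2 \<star> z = (b1 + b2) \<star> x" for x y z
        by (simp only: scale_simps(8) add_uminus_conv_diff right_minus_eq)
      then show ?thesis
        by (auto simp: sols3_def reps_def image_iff simp del: minus_add_distrib)
    qed
    also have "card \<dots> = card (SIGMA x:D. reps b1 b2 D x)"
      by (rule card_image) (auto simp: inj_on_def)
    also have "\<dots> = (\<Sum>x\<in>D. card (reps b1 b2 D x))"
      using finD by (intro card_SigmaI) auto
    also have "real \<dots> = (\<Sum>x\<in>D'. real (card (reps b1 b2 D x))) + (\<Sum>x\<in>D - D'. real (card (reps b1 b2 D x)))"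
      using sub finD by (simp add: sum.subset_diff[of D' D])
    also have "\<dots> \<le> (\<Sum>x\<in>D'. N) + (\<Sum>x\<in>D - D'. \<beta> * N)"
    proof (intro add_mono sum_mono)
      fix x show "real (card (reps b1 b2 D x)) \<le> N"
        using card_reps_le[OF finD b(1), of b1 x] DN by linarith
    qed (auto simp: D'_def)
    also have "\<dots> \<le> card D' * N + N * (\<beta> * N)"
    proof -
      have "card (D - D') \<le> card D" by (intro card_mono finD) auto
      then have "real (card (D - D')) \<le> N" using DN by linarith
      then show ?thesis using \<beta> N by (auto intro!: mult_right_mono)
    qed
    finally have "N * (\<beta> * N) \<le> N * card D'" by (simp add: algebra_simps power2_eq_square)
    then have "\<beta> * N \<le> card D'" using N by simp
    then show "\<exists>D'\<subseteq>D. c / 2 * \<alpha> ^ K * CARD('a) ^ n \<le> card D' \<and>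
        (\<forall>x\<in>D'. c / 2 * \<alpha> ^ K * CARD('a) ^ n \<le> card (reps b1 b2 D x))"
      using sub by (intro exI[of _ D']) (auto simp: D'_def \<beta>_def N_def)
  qed
qed

text \<open>Extensional functions on \<open>{..<5}\<close> take the place of 5-tuples, so that
  \<open>prod_sum_PiE\<close> expands a product of five Fourier transforms directly into a sum over
  such functions.\<close>

definition sols5 :: "(nat \<Rightarrow> 'a::field) \<Rightarrow> (nat \<Rightarrow> 'a) set \<Rightarrow> (nat \<Rightarrow> nat \<Rightarrow> 'a) set" where
  "sols5 a D = {x \<in> {..<5} \<rightarrow>\<^sub>E D. (\<Sum>j<5. a j \<star> x j) = 0}"

lemma lessThan_5: "{..<5::nat} = {0, 1, 2, 3, 4}"
  by auto

lemma finite_sols5 [simp]: "finite D \<Longrightarrow> finite (sols5 a D)"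
  by (rule finite_subset[of _ "{..<5} \<rightarrow>\<^sub>E D"]) (auto simp: sols5_def intro: finite_PiE)

text \<open>A three-term solution for merged coefficients is refined by splitting \<open>x\<close>
  and \<open>y\<close> into pairs. The refinement is injective, since nonzero merged coefficients
  recover \<open>x\<close> and \<open>y\<close> from their pairs.\<close>

lemma card_sols5_ge:
  fixes a :: "nat \<Rightarrow> 'a::field"
  assumes fin: "finite D" and ne: "a 0 + a 1 \<noteq> 0" "a 2 + a 3 \<noteq> 0" and D2: "D2 \<subseteq> D"
  shows "(\<Sum>(x, y, z)\<in>sols3 (a 0 + a 1) (a 2 + a 3) (a 4) D2. card (reps (a 0) (a 1) D x) * card (reps (a 2) (a 3) D y))
    \<le> card (sols5 a D)"
proof -
  let ?T = "sols3 (a 0 + a 1) (a 2 + a 3) (a 4) D2"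
  have fin2: "finite D2" using fin D2 finite_subset by blast
  let ?S = "SIGMA p:?T. reps (a 0) (a 1) D (fst p) \<times> reps (a 2) (a 3) D (fst (snd p))"
  define F where "F = (\<lambda>((x :: nat \<Rightarrow> 'a, y :: nat \<Rightarrow> 'a, z), (x0, x1), (x2, x3)).
    (\<lambda>j\<in>{..<5::nat}. if j = 0 then x0 else if j = 1 then x1 else if j = 2 then x2 else if j = 3 then x3 else (z :: nat \<Rightarrow> 'a)))"
  have "card ?S = (\<Sum>p\<in>?T. card (reps (a 0) (a 1) D (fst p) \<times> reps (a 2) (a 3) D (fst (snd p))))"
    using fin fin2 by (intro card_SigmaI) auto
  also have "\<dots> = (\<Sum>(x, y, z)\<in>?T. card (reps (a 0) (a 1) D x) * card (reps (a 2) (a 3) D y))"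
    by (intro sum.cong) (auto simp: card_cartesian_product)
  finally have "(\<Sum>(x, y, z)\<in>?T. card (reps (a 0) (a 1) D x) * card (reps (a 2) (a 3) D y)) = card ?S"
    by (rule sym)
  also have "card ?S \<le> card (sols5 a D)"
  proof (rule card_inj_on_le[where f = F])
    show "inj_on F ?S"
    proof (rule inj_onI)
      fix p p' assume p: "p \<in> ?S" "p' \<in> ?S" and eq: "F p = F p'"
      obtain x y z x0 x1 x2 x3 where e: "p = ((x, y, z), (x0, x1), (x2, x3))" by (metis surj_pair)
      obtain x' y' z' x0' x1' x2' x3' where e': "p' = ((x', y', z'), (x0', x1'), (x2', x3'))" by (metis surj_pair)
      have "x0 = x0'" "x1 = x1'" "x2 = x2'" "x3 = x3'" "z = z'"
        using fun_cong[OF eq, of 0] fun_cong[OF eq, of 1] fun_cong[OF eq, of 2] fun_cong[OF eq, of 3] fun_cong[OF eq, of 4]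
        by (auto simp: F_def e e')
      moreover from this have "(a 0 + a 1) \<star> x = (a 0 + a 1) \<star> x'" "(a 2 + a 3) \<star> y = (a 2 + a 3) \<star> y'"
        using p by (auto simp: e e' reps_def)
      then have "x = x'" "y = y'" using ne by (auto simp: fun_eq_iff)
      ultimately show "p = p'" by (simp add: e e')
    qed
    show "F ` ?S \<subseteq> sols5 a D"
    proof (rule image_subsetI)
      fix p assume p: "p \<in> ?S"
      obtain x y z x0 x1 x2 x3 where e: "p = ((x, y, z), (x0, x1), (x2, x3))" by (metis surj_pair)
      have r: "a 0 \<star> x0 + a 1 \<star> x1 = (a 0 + a 1) \<star> x" "a 2 \<star> x2 + a 3 \<star> x3 = (a 2 + a 3) \<star> y"
        "(a 0 + a 1) \<star> x + (a 2 + a 3) \<star> y + a 4 \<star> z = 0" "{x0, x1, x2, x3} \<subseteq> D" "z \<in> D"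
        using p D2 by (auto simp: e reps_def sols3_def)
      have "(\<Sum>j<5. a j \<star> F p j) = (a 0 \<star> x0 + a 1 \<star> x1) + (a 2 \<star> x2 + a 3 \<star> x3) + a 4 \<star> z"
        by (simp add: lessThan_5 e F_def add_ac)
      also have "\<dots> = 0" using r by simp
      finally show "F p \<in> sols5 a D" using r(4,5) by (auto simp: sols5_def e F_def)
    qed
  qed (use fin in simp)
  finally show ?thesis .
qed

text \<open>Elements must be popular for both pairs of coefficients, so the popular set is taken
  twice: \<open>D1\<close> inside \<open>D\<close> for \<open>a 0\<close> and \<open>a 1\<close>,
  then \<open>D2\<close> inside \<open>D1\<close> for \<open>a 2\<close> and \<open>a 3\<close>.
  Every three-term solution in \<open>D2\<close> then splits in at least
  \<open>\<gamma> * N * (\<delta> * N)\<close> ways.\<close>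

lemma supersaturation5:
  "\<exists>(c::real) K. 0 < c \<and> (\<forall>n (D :: (nat \<Rightarrow> 'a::{field,finite}) set) (\<alpha>::real) a.
      (\<forall>j<5. a j \<noteq> 0) \<longrightarrow> (\<Sum>j<5. a j) = 0 \<longrightarrow> a 0 + a 1 \<noteq> 0 \<longrightarrow> a 2 + a 3 \<noteq> 0 \<longrightarrow>
      D \<subseteq> fspace n \<longrightarrow> 0 < \<alpha> \<longrightarrow> \<alpha> * CARD('a) ^ n \<le> card D \<longrightarrow>
      c * \<alpha> ^ K * (CARD('a) ^ n) ^ 4 \<le> card (sols5 a D))"
proof -
  obtain c3 :: real and K3 where c3: "0 < c3" and sat: "\<And>n (D :: (nat \<Rightarrow> 'a) set) (\<alpha>::real) b1 b2 b3.
      b3 \<noteq> 0 \<Longrightarrow> b1 + b2 + b3 = 0 \<Longrightarrow> D \<subseteq> fspace n \<Longrightarrow> 0 < \<alpha> \<Longrightarrow> \<alpha> * CARD('a) ^ n \<le> card D \<Longrightarrow>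
      c3 * \<alpha> ^ K3 * (CARD('a) ^ n) ^ 2 \<le> card (sols3 b1 b2 b3 D)"
    using supersaturation3[where 'a = 'a] by blast
  obtain c :: real and K where c: "0 < c" and pop: "\<And>n (D :: (nat \<Rightarrow> 'a) set) (\<alpha>::real) b1 b2.
      b2 \<noteq> 0 \<Longrightarrow> b1 + b2 \<noteq> 0 \<Longrightarrow> D \<subseteq> fspace n \<Longrightarrow> 0 < \<alpha> \<Longrightarrow> \<alpha> * CARD('a) ^ n \<le> card D \<Longrightarrow>
      \<exists>D'\<subseteq>D. c * \<alpha> ^ K * CARD('a) ^ n \<le> card D' \<and>
        (\<forall>x\<in>D'. c * \<alpha> ^ K * CARD('a) ^ n \<le> card (reps b1 b2 D x))"
    using popular_elements[where 'a = 'a] by blast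
  \<comment> \<open>Here \<delta> is \<open>c * c ^ K * \<alpha> ^ (K * K)\<close>; \<open>C\<close>
    and \<open>L\<close> collect the constants and exponents in
    \<open>c3 * \<delta> ^ K3 * \<gamma> * \<delta>\<close>.\<close>
  define C where "C = c3 * (c * c ^ K) ^ K3 * c * (c * c ^ K)"
  define L where "L = K * K * K3 + K + K * K"
  show ?thesis
  proof (intro exI[of _ C] exI[of _ L] conjI allI impI)
    show "0 < C" using c c3 by (simp add: C_def)
    fix n and D :: "(nat \<Rightarrow> 'a) set" and \<alpha> :: real and a :: "nat \<Rightarrow> 'a"
    assume a: "\<forall>j<5. a j \<noteq> 0" "(\<Sum>j<5. a j) = 0" "a 0 + a 1 \<noteq> 0" "a 2 + a 3 \<noteq> 0"
      and D: "D \<subseteq> fspace n" and \<alpha>: "0 < \<alpha>" "\<alpha> * CARD('a) ^ n \<le> card D"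
    define N where "N = real (CARD('a) ^ n)"
    have N: "N > 0" by (simp add: N_def)
    have finD: "finite D" using finite_subset[OF D] by simp
    define \<gamma> where "\<gamma> = c * \<alpha> ^ K"
    define \<delta> where "\<delta> = c * \<gamma> ^ K"
    have pos: "\<gamma> > 0" "\<delta> > 0" using c \<alpha> by (auto simp: \<gamma>_def \<delta>_def)
    have an: "a 1 \<noteq> 0" "a 3 \<noteq> 0" "a 4 \<noteq> 0" using a(1) by auto
    obtain D1 where D1: "D1 \<subseteq> D" "\<gamma> * N \<le> card D1" "\<And>x. x \<in> D1 \<Longrightarrow> \<gamma> * N \<le> card (reps (a 0) (a 1) D x)"
      using pop[OF an(1) a(3) D \<alpha>] unfolding \<gamma>_def N_def by auto
    have D1n: "D1 \<subseteq> fspace n" using D1 D by auto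
    obtain D2 where D2: "D2 \<subseteq> D1" "\<delta> * N \<le> card D2" "\<And>x. x \<in> D2 \<Longrightarrow> \<delta> * N \<le> card (reps (a 2) (a 3) D1 x)"
      using pop[OF an(2) a(4) D1n pos(1), folded N_def, OF D1(2)] unfolding \<delta>_def N_def by auto
    have s0: "(a 0 + a 1) + (a 2 + a 3) + a 4 = 0" using a(2) by (simp add: lessThan_5 add_ac)
    let ?T = "sols3 (a 0 + a 1) (a 2 + a 3) (a 4) D2"
    have T: "c3 * \<delta> ^ K3 * N ^ 2 \<le> card ?T"
      using sat[OF an(3) s0 _ pos(2), of D2 n] D2 D1n by (auto simp: N_def)
    have D2D: "D2 \<subseteq> D" using D1 D2 by auto
    have "C * \<alpha> ^ L * N ^ 4 = c3 * \<delta> ^ K3 * N ^ 2 * ((\<gamma> * N) * (\<delta> * N))"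
      by (simp add: C_def L_def \<delta>_def \<gamma>_def power_mult_distrib power_add power_mult[symmetric] power_numeral_reduce mult_ac)
    also have "\<dots> \<le> card ?T * ((\<gamma> * N) * (\<delta> * N))"
      using T pos N by (intro mult_right_mono) auto
    also have "\<dots> = (\<Sum>p\<in>?T. (\<gamma> * N) * (\<delta> * N))" by simp
    also have "\<dots> \<le> (\<Sum>(x, y, z)\<in>?T. real (card (reps (a 0) (a 1) D x)) * real (card (reps (a 2) (a 3) D y)))"
    proof (intro sum_mono, clarify)
      fix x y z assume "(x, y, z) \<in> ?T"
      then have xy: "x \<in> D1" "y \<in> D2" using D2 by (auto simp: sols3_def)
      have "card (reps (a 2) (a 3) D1 y) \<le> card (reps (a 2) (a 3) D y)"
        using D1(1) by (intro card_mono finite_reps finD) (auto simp: reps_def)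
      then have "\<delta> * N \<le> card (reps (a 2) (a 3) D y)" using D2(3)[OF xy(2)] by linarith
      then show "\<gamma> * N * (\<delta> * N) \<le> real (card (reps (a 0) (a 1) D x)) * real (card (reps (a 2) (a 3) D y))"
        using D1(3)[OF xy(1)] pos N by (intro mult_mono) auto
    qed
    also have "\<dots> = real (\<Sum>(x, y, z)\<in>?T. card (reps (a 0) (a 1) D x) * card (reps (a 2) (a 3) D y))"
      by (simp add: case_prod_unfold)
    also have "\<dots> \<le> card (sols5 a D)"
      using card_sols5_ge[OF finD a(3,4) D2D] of_nat_mono by blast
    finally show "C * \<alpha> ^ L * (CARD('a) ^ n) ^ 4 \<le> card (sols5 a D)" by (simp add: N_def)
  qed
qed

section \<open>Fourier analysis\<close>

text \<open>The additive group of the field is a vector space over the prime field; a subgroup \<open>K\<close> maximal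
  among those avoiding \<open>1\<close> is a hyperplane with complement spanned by \<open>1\<close>, and the character
  reads off the coordinate along \<open>1\<close>.\<close>

lemma ex_nontrivial_additive_character:
  "\<exists>e :: 'a::{field,finite} \<Rightarrow> complex.
    (\<forall>x y. e (x + y) = e x * e y) \<and> (\<forall>x. norm (e x) = 1) \<and> (\<exists>x. e x \<noteq> 1)"
proof -
  define p where "p = CHAR('a)"
  have "p > 0" unfolding p_def by (rule finite_imp_CHAR_pos) simp
  then have p: "prime p" unfolding p_def by (rule prime_CHAR_semidom)
  have p0: "of_nat p = (0::'a)" by (simp add: p_def)
  have cong_iff: "of_nat i = (of_nat j :: 'a) \<longleftrightarrow> [i = j] (mod p)" for i j
    by (simp add: p_def of_nat_eq_iff_cong_CHAR)
  \<comment> \<open>Since \<open>p - 1\<close> acts as -1, differences of natural multiples are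
    natural multiples again, and integers can be avoided.\<close>
  have diff_nat: "of_nat i - of_nat j = (of_nat (i + (p - 1) * j) :: 'a)" for i j
  proof -
    have "(of_nat (p - 1) :: 'a) = - 1"
      using p0 \<open>p > 0\<close> by (simp add: of_nat_diff)
    then show ?thesis by simp
  qed
  have inv: "\<exists>l. of_nat l * of_nat j = (1::'a)" if "of_nat j \<noteq> (0::'a)" for j
  proof -
    have "\<not> p dvd j" using that by (simp add: p_def of_nat_eq_0_iff_char_dvd)
    then have "coprime j p" using prime_imp_coprime_nat[OF p] coprime_commute by blast
    then obtain l where "[j * l = 1] (mod p)" using cong_solve_coprime_nat by auto
    then have "of_nat (j * l) = (of_nat 1 :: 'a)" using cong_iff by blast
    then show ?thesis by (auto simp: mult.commute intro!: exI[of _ l])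
  qed
  define S where "S = {K :: 'a set. 0 \<in> K \<and> (\<forall>x\<in>K. \<forall>y\<in>K. x - y \<in> K) \<and> 1 \<notin> K}"
  have "{0} \<in> S" by (simp add: S_def)
  then obtain K where KS: "K \<in> S" and mx: "\<And>K'. K' \<in> S \<Longrightarrow> card K' \<le> card K"
    using ex_has_greatest_nat[of "\<lambda>K. K \<in> S" "{0}" card "Suc CARD('a)"]
    by (auto simp: less_Suc_eq_le card_mono)
  have K0: "0 \<in> K" and Kd: "\<And>x y. x \<in> K \<Longrightarrow> y \<in> K \<Longrightarrow> x - y \<in> K" and K1: "1 \<notin> K"
    using KS by (auto simp: S_def)
  have Kn: "- x \<in> K" if "x \<in> K" for x using Kd[OF K0 that] by simp
  have Ka: "x + y \<in> K" if "x \<in> K" "y \<in> K" for x y using Kd[OF that(1) Kn[OF that(2)]] by simp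
  have Km: "of_nat l * x \<in> K" if "x \<in> K" for l x
    by (induction l) (auto simp: K0 distrib_right intro!: Ka that)
  \<comment> \<open>If \<open>x\<close> is not in \<open>K\<close>, then \<open>K\<close> together
    with the multiples of \<open>x\<close> is larger, so by maximality it contains 1. Inverting the
    coefficient of \<open>x\<close> in that expression of 1 puts \<open>x\<close> in a class of a
    natural number modulo \<open>K\<close>.\<close>
  have ex: "\<exists>i. x - of_nat i \<in> K" for x
  proof (cases "x \<in> K")
    case True
    then show ?thesis by (auto intro!: exI[of _ 0])
  next
    case False
    define K' where "K' = {k + of_nat j * x | k j. k \<in> K}"
    have "K \<subseteq> K'" by (force simp: K'_def intro: exI[of _ 0])
    moreover have "x \<in> K'" using K0 by (force simp: K'_def intro: exI[of _ 1])
    ultimately have "K \<subset> K'" using False by blast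
    then have "card K < card K'" by (intro psubset_card_mono) auto
    then have "K' \<notin> S" using mx by fastforce
    moreover have "0 \<in> K'" using \<open>K \<subseteq> K'\<close> K0 by blast
    moreover have "y - z \<in> K'" if yz: "y \<in> K'" "z \<in> K'" for y z
    proof -
      obtain k j k' j' where e: "y = k + of_nat j * x" "z = k' + of_nat j' * x" "k \<in> K" "k' \<in> K"
        using yz by (auto simp: K'_def)
      have "y - z = (k - k') + (of_nat j - of_nat j') * x" by (simp add: e algebra_simps)
      also have "\<dots> = (k - k') + of_nat (j + (p - 1) * j') * x" by (simp only: diff_nat)
      finally show ?thesis using Kd[OF e(3,4)] by (auto simp: K'_def simp del: of_nat_add of_nat_mult)
    qed
    ultimately have "1 \<in> K'" by (auto simp: S_def)
    then obtain k j where kj: "1 = k + of_nat j * x" "k \<in> K" by (auto simp: K'_def)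
    have "of_nat j \<noteq> (0::'a)" using kj K1 by auto
    then obtain l where l: "of_nat l * of_nat j = (1::'a)" using inv by blast
    have "of_nat l = of_nat l * (k + of_nat j * x)" using kj by simp
    also have "\<dots> = of_nat l * k + (of_nat l * of_nat j) * x" by (simp add: algebra_simps)
    finally have h: "of_nat l = of_nat l * k + x" using l by simp
    have "x - of_nat l = x - (of_nat l * k + x)" by (subst h) (rule refl)
    then have "x - of_nat l = - (of_nat l * k)" by simp
    then show ?thesis using Kn[OF Km[OF kj(2)]] by metis
  qed
  \<comment> \<open>A nonzero natural multiple of 1 in \<open>K\<close> would have an inverse of the
    same form, and 1 would lie in \<open>K\<close>.\<close>
  have uniq: "[i = j] (mod p)" if "of_nat i - of_nat j \<in> K" for i j
  proof -
    let ?m = "i + (p - 1) * j"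
    have m: "of_nat ?m \<in> K" using that unfolding diff_nat .
    have "(of_nat ?m :: 'a) = 0"
    proof (rule ccontr)
      assume "of_nat ?m \<noteq> (0::'a)"
      then obtain l where "of_nat l * of_nat ?m = (1::'a)" using inv by blast
      then show False using Km[OF m, of l] K1 by simp
    qed
    then have "of_nat i - of_nat j = (0::'a)" by (simp only: diff_nat)
    then show ?thesis using cong_iff by simp
  qed
  define idx where "idx = (\<lambda>x. SOME i. x - of_nat i \<in> K)"
  have idx: "x - of_nat (idx x) \<in> K" for x
    unfolding idx_def using ex by (rule someI_ex)
  define \<omega> where "\<omega> = cis (2 * pi / p)"
  have \<omega>p: "\<omega> ^ p = 1" using \<open>p > 0\<close> by (simp add: \<omega>_def DeMoivre)
  have \<omega>c: "\<omega> ^ i = \<omega> ^ j" if "[i = j] (mod p)" for i j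
  proof -
    have red: "\<omega> ^ k = \<omega> ^ (k mod p)" for k
    proof -
      have "\<omega> ^ k = \<omega> ^ (p * (k div p) + k mod p)" by simp
      also have "\<dots> = \<omega> ^ (k mod p)" by (simp only: power_add power_mult \<omega>p power_one mult_1)
      finally show ?thesis .
    qed
    show ?thesis using that red[of i] red[of j] by (simp add: cong_def)
  qed
  have \<omega>1: "\<omega> \<noteq> 1"
  proof
    assume "\<omega> = 1"
    then have c1: "cos (2 * pi / p) = 1" by (simp add: \<omega>_def complex_eq_iff)
    have "2 * pi / p \<noteq> - (real k * 2 * pi)" for k :: nat
    proof -
      have "0 < 2 * pi / p" "0 \<le> real k * 2 * pi" using \<open>p > 0\<close> by auto
      then show ?thesis by linarith
    qed
    then obtain k :: nat where "2 * pi / p = real k * 2 * pi"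
      using c1 unfolding cos_one_2pi by blast
    then have "k * p = 1" using \<open>p > 0\<close> by (simp add: field_simps flip: of_nat_mult)
    then show False using prime_gt_1_nat[OF p] by simp
  qed
  \<comment> \<open>The index \<open>idx x\<close> is determined only modulo \<open>p\<close>, which
    is all that powers of the \<open>p\<close>-th root of unity \<omega> see.\<close>
  define e where "e = (\<lambda>x. \<omega> ^ idx x)"
  have "e (x + y) = e x * e y" for x y
  proof -
    have "(x - of_nat (idx x)) + (y - of_nat (idx y)) - ((x + y) - of_nat (idx (x + y))) \<in> K"
      by (intro Kd Ka idx)
    then have h: "of_nat (idx (x + y)) - of_nat (idx x + idx y) \<in> K" by (simp add: algebra_simps)
    show ?thesis using \<omega>c[OF uniq[OF h]] by (simp add: e_def power_add)
  qed
  moreover have "norm (e x) = 1" for x by (simp add: e_def \<omega>_def norm_power)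
  moreover have "e 1 \<noteq> 1"
  proof -
    have "- (1 - of_nat (idx 1)) \<in> K" by (intro Kn idx)
    then have h: "of_nat (idx 1) - of_nat 1 \<in> K" by simp
    show ?thesis using \<omega>c[OF uniq[OF h]] \<omega>1 by (simp add: e_def)
  qed
  ultimately show ?thesis by blast
qed

definition dot :: "nat \<Rightarrow> (nat \<Rightarrow> 'a::field) \<Rightarrow> (nat \<Rightarrow> 'a) \<Rightarrow> 'a" where
  "dot n u x = (\<Sum>i<n. u i * x i)"

lemma dot_simps:
  "dot n u (x + y) = dot n u x + dot n u y" "dot n (c \<star> u) x = c * dot n u x"
  "dot n u (c \<star> x) = c * dot n u x" "dot n u 0 = 0" "dot n u (- x) = - dot n u x"
  "dot n u (x - y) = dot n u x - dot n u y"
  by (simp_all add: dot_def algebra_simps sum.distrib sum_distrib_left sum_negf sum_subtractf)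

lemma dot_commute: "dot n u x = dot n x u"
  by (simp add: dot_def mult.commute)

lemma dot_sum: "dot n u (\<Sum>j\<in>J. x j) = (\<Sum>j\<in>J. dot n u (x j))"
proof (induction J rule: infinite_finite_induct)
  case (insert j J)
  have "dot n u (x j + sum x J) = dot n u (x j) + dot n u (sum x J)" by (rule dot_simps)
  then show ?case using insert by (metis sum.insert)
qed (metis sum.infinite sum.empty dot_simps(4))+

lemma dot_eq_0_imp:
  assumes "x \<in> fspace n" "\<And>u. u \<in> fspace n \<Longrightarrow> dot n x u = 0"
  shows "x = 0"
proof
  fix i show "x i = 0 i"
  proof (cases "i < n")
    case True
    have "dot n x (\<lambda>j. if j = i then 1 else 0) = 0"
      using True by (intro assms(2)) (auto simp: fspace_def)
    then show ?thesis using True by (simp add: dot_def if_distrib cong: if_cong)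
  qed (use assms(1) in \<open>auto simp: fspace_def\<close>)
qed

locale additive_character =
  fixes e :: "'a::{field,finite} \<Rightarrow> complex"
  assumes e_add: "e (x + y) = e x * e y"
    and norm_e [simp]: "norm (e x) = 1"
    and e_nontrivial: "\<exists>x. e x \<noteq> 1"
begin

lemma e_nonzero [simp]: "e x \<noteq> 0"
  using norm_e[of x] by (metis norm_zero zero_neq_one)

lemma e_0 [simp]: "e 0 = 1"
  using e_add[of 0 0] by simp

lemma e_minus: "e (- x) = cnj (e x)"
proof -
  have "e x * e (- x) = 1" by (simp flip: e_add)
  moreover have "e x * cnj (e x) = 1" by (simp flip: complex_norm_square)
  ultimately show ?thesis by (metis e_nonzero mult_left_cancel)
qed

lemma e_sum: "e (\<Sum>j\<in>J. x j) = (\<Prod>j\<in>J. e (x j))"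
  by (induction J rule: infinite_finite_induct) (auto simp: e_add)

text \<open>If \<open>dot n u\<close> is nonzero somewhere on \<open>H\<close>, scaling makes it
  take every value on \<open>H\<close>, including one where the character is not 1. Translation by
  such a vector preserves the sum and multiplies it by a number other than 1.\<close>

lemma sum_character_subspace:
  assumes add: "\<And>x y. x \<in> H \<Longrightarrow> y \<in> H \<Longrightarrow> x + y \<in> H" and scale: "\<And>c x. x \<in> H \<Longrightarrow> c \<star> x \<in> H"
  shows "(\<Sum>x\<in>H. e (dot n u x)) = (if \<forall>x\<in>H. dot n u x = 0 then of_nat (card H) else 0)"
proof (cases "\<forall>x\<in>H. dot n u x = 0")
  case True
  then show ?thesis by simp
next
  case False
  then obtain h where h: "h \<in> H" "dot n u h \<noteq> 0" by blast
  obtain c where c: "e c \<noteq> 1" using e_nontrivial by blast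
  define k where "k = (c / dot n u h) \<star> h"
  have k: "k \<in> H" "dot n u k = c" "- k \<in> H"
    using h scale[OF scale[OF h(1)], of "-1"] by (auto simp: k_def dot_simps scale scale_simps)
  have "(\<Sum>x\<in>H. e (dot n u x)) = (\<Sum>x\<in>H. e (dot n u (x + k)))"
    by (rule sum.reindex_bij_witness[of _ "\<lambda>x. x + k" "\<lambda>x. x - k"]) (auto simp: add k add[OF _ k(3), simplified])
  also have "\<dots> = (\<Sum>x\<in>H. e (dot n u x)) * e c"
    by (simp add: dot_simps e_add k sum_distrib_right)
  finally have "(\<Sum>x\<in>H. e (dot n u x)) = 0" using c by simp
  then show ?thesis by (simp add: False)
qed

lemma sum_character_dual:
  assumes "x \<in> fspace n"
  shows "(\<Sum>u\<in>fspace n. e (dot n u x)) = (if x = 0 then of_nat (CARD('a) ^ n) else 0)"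
proof -
  have "(\<forall>u\<in>fspace n. dot n x u = 0) \<longleftrightarrow> x = 0"
    using dot_eq_0_imp[OF assms] by (auto simp: dot_def)
  then show ?thesis
    using sum_character_subspace[of "fspace n" n x] by (simp add: dot_commute[of n _ x] card_fspace)
qed

text \<open>The transform is unnormalised, so its value at 0 is the total mass of \<open>g\<close>,
  and the factor \<open>N\<close> appears in \<open>parseval\<close> and in
  \<open>sum_prod_ft\<close>.\<close>

definition ft :: "nat \<Rightarrow> ((nat \<Rightarrow> 'a) \<Rightarrow> real) \<Rightarrow> (nat \<Rightarrow> 'a) \<Rightarrow> complex" where
  "ft n g u = (\<Sum>x\<in>fspace n. of_real (g x) * e (dot n u x))"

lemma parseval:
  fixes g :: "(nat \<Rightarrow> 'a) \<Rightarrow> real"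
  shows "(\<Sum>u\<in>fspace n. (norm (ft n g u))\<^sup>2) = CARD('a) ^ n * (\<Sum>x\<in>fspace n. (g x)\<^sup>2)"
proof -
  have "complex_of_real ((norm (ft n g u))\<^sup>2)
      = (\<Sum>x\<in>fspace n. \<Sum>y\<in>fspace n. of_real (g x * g y) * e (dot n u (x - y)))" for u
  proof -
    have "complex_of_real ((norm (ft n g u))\<^sup>2) = ft n g u * cnj (ft n g u)"
      by (simp add: complex_norm_square flip: of_real_power)
    also have "\<dots> = (\<Sum>x\<in>fspace n. \<Sum>y\<in>fspace n. of_real (g x) * e (dot n u x) * (of_real (g y) * cnj (e (dot n u y))))"
      by (simp add: ft_def sum_product)
    also have "\<dots> = (\<Sum>x\<in>fspace n. \<Sum>y\<in>fspace n. of_real (g x * g y) * e (dot n u (x - y)))"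
    proof (intro sum.cong refl)
      fix x y
      have "e (dot n u (x - y)) = e (dot n u x) * cnj (e (dot n u y))"
        using e_add[of "dot n u x" "- dot n u y"] by (simp add: dot_simps e_minus)
      then show "of_real (g x) * e (dot n u x) * (of_real (g y) * cnj (e (dot n u y)))
        = of_real (g x * g y) * e (dot n u (x - y))" by simp
    qed
    finally show ?thesis .
  qed
  then have "complex_of_real (\<Sum>u\<in>fspace n. (norm (ft n g u))\<^sup>2)
      = (\<Sum>u\<in>fspace n. \<Sum>x\<in>fspace n. \<Sum>y\<in>fspace n. of_real (g x * g y) * e (dot n u (x - y)))"
    unfolding of_real_sum by (intro sum.cong refl) auto
  also have "\<dots> = (\<Sum>x\<in>fspace n. \<Sum>u\<in>fspace n. \<Sum>y\<in>fspace n. of_real (g x * g y) * e (dot n u (x - y)))"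
    by (rule sum.swap)
  also have "\<dots> = (\<Sum>x\<in>fspace n. \<Sum>y\<in>fspace n. \<Sum>u\<in>fspace n. of_real (g x * g y) * e (dot n u (x - y)))"
    by (intro sum.cong refl sum.swap)
  also have "\<dots> = (\<Sum>x\<in>fspace n. \<Sum>y\<in>fspace n. if y = x then of_real (g x * g x * CARD('a) ^ n) else 0)"
    by (intro sum.cong refl) (auto simp: sum_character_dual simp flip: sum_distrib_left)
  also have "\<dots> = of_real (CARD('a) ^ n * (\<Sum>x\<in>fspace n. (g x)\<^sup>2))"
    by (simp add: sum_distrib_left power2_eq_square mult_ac)
  finally show ?thesis by (simp only: of_real_eq_iff)
qed

text \<open>Expanding the product gives a sum over all 5-tuples, and orthogonality in
  \<open>u\<close> keeps those that solve the equation. The case of an indicator function counts the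
  solutions in a set.\<close>

lemma sum_prod_ft:
  fixes g :: "(nat \<Rightarrow> 'a) \<Rightarrow> real"
  shows "(\<Sum>u\<in>fspace n. \<Prod>j<5. ft n g (a j \<star> u))
    = of_real (CARD('a) ^ n * (\<Sum>x\<in>sols5 a (fspace n). \<Prod>j<5. g (x j)))"
proof -
  let ?P = "{..<5::nat} \<rightarrow>\<^sub>E (fspace n :: (nat \<Rightarrow> 'a) set)"
  have sumin: "(\<Sum>j<5. a j \<star> x j) \<in> fspace n" if "x \<in> ?P" for x
  proof -
    have "x j \<in> fspace n" if "j < 5" for j using \<open>x \<in> ?P\<close> that by auto
    then show ?thesis by (simp add: lessThan_5)
  qed
  have "(\<Prod>j<5. ft n g (a j \<star> u)) = (\<Sum>x\<in>?P. of_real (\<Prod>j<5. g (x j)) * e (dot n u (\<Sum>j<5. a j \<star> x j)))" for u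
  proof -
    have "(\<Prod>j<5. ft n g (a j \<star> u)) = (\<Sum>x\<in>?P. \<Prod>j<5. of_real (g (x j)) * e (dot n (a j \<star> u) (x j)))"
      unfolding ft_def by (rule prod_sum_PiE) auto
    also have "\<dots> = (\<Sum>x\<in>?P. of_real (\<Prod>j<5. g (x j)) * e (dot n u (\<Sum>j<5. a j \<star> x j)))"
      by (simp add: prod.distrib dot_sum e_sum dot_simps)
    finally show ?thesis .
  qed
  then have "(\<Sum>u\<in>fspace n. \<Prod>j<5. ft n g (a j \<star> u))
      = (\<Sum>u\<in>fspace n. \<Sum>x\<in>?P. of_real (\<Prod>j<5. g (x j)) * e (dot n u (\<Sum>j<5. a j \<star> x j)))"
    by simp
  also have "\<dots> = (\<Sum>x\<in>?P. of_real (\<Prod>j<5. g (x j)) * (\<Sum>u\<in>fspace n. e (dot n u (\<Sum>j<5. a j \<star> x j))))"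
    unfolding sum_distrib_left by (rule sum.swap)
  also have "\<dots> = (\<Sum>x\<in>?P. of_real (\<Prod>j<5. g (x j)) * (if (\<Sum>j<5. a j \<star> x j) = 0 then of_nat (CARD('a) ^ n) else 0))"
    by (intro sum.cong refl arg_cong2[where f = "(*)"] sum_character_dual sumin)
  also have "\<dots> = (\<Sum>x\<in>sols5 a (fspace n). of_real (\<Prod>j<5. g (x j)) * of_nat (CARD('a) ^ n))"
    unfolding sols5_def by (rule sum.mono_neutral_cong_right) (auto intro!: finite_PiE)
  also have "\<dots> = of_real (CARD('a) ^ n * (\<Sum>x\<in>sols5 a (fspace n). \<Prod>j<5. g (x j)))"
    by (simp add: sum_distrib_left mult.commute)
  finally show ?thesis .
qed

end

section \<open>Transference\<close>

text \<open>The autocorrelation of the indicator of \<open>A\<close>: the number of ways to write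
  \<open>d\<close> as a difference of two elements. The sum of its squares is the additive
  energy.\<close>

definition corr :: "(nat \<Rightarrow> 'a::field) set \<Rightarrow> (nat \<Rightarrow> 'a) \<Rightarrow> real" where
  "corr A d = card {x \<in> A. x + d \<in> A}"

lemma corr_nonneg [simp]: "0 \<le> corr A d"
  by (simp add: corr_def)

lemma corr_0 [simp]: "corr A 0 = card A"
  by (simp add: corr_def)

lemma sum_squared_le_card_mult:
  fixes f :: "'b \<Rightarrow> real"
  shows "(sum f D)\<^sup>2 \<le> card D * (\<Sum>x\<in>D. (f x)\<^sup>2)"
proof -
  have "(sum f D)\<^sup>2 = (\<Sum>x\<in>D. \<Sum>y\<in>D. f x * f y)"
    by (simp add: power2_eq_square sum_product)
  also have "\<dots> \<le> (\<Sum>x\<in>D. \<Sum>y\<in>D. ((f x)\<^sup>2 + (f y)\<^sup>2) / 2)"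
    using sum_squares_bound[of "f _" "f _"] by (intro sum_mono) (simp add: field_simps)
  also have "\<dots> = card D * (\<Sum>x\<in>D. (f x)\<^sup>2)"
    by (simp add: sum.distrib sum_divide_distrib[symmetric] sum_distrib_left[symmetric])
  finally show ?thesis .
qed

lemma prod4_le:
  fixes w x y z :: real
  shows "w * x * y * z \<le> (w ^ 4 + x ^ 4 + y ^ 4 + z ^ 4) / 4"
proof -
  have "w * x * y * z \<le> ((w * x)\<^sup>2 + (y * z)\<^sup>2) / 2"
    using sum_squares_bound[of "w * x" "y * z"] by (simp add: mult_ac)
  moreover have "(w * x)\<^sup>2 \<le> (w ^ 4 + x ^ 4) / 2" "(y * z)\<^sup>2 \<le> (y ^ 4 + z ^ 4) / 2"
    using sum_squares_bound[of "w\<^sup>2" "x\<^sup>2"] sum_squares_bound[of "y\<^sup>2" "z\<^sup>2"]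
    by (auto simp: power_mult_distrib simp flip: power_mult)
  ultimately show ?thesis by simp
qed

text \<open>Pairs in \<open>A\<close> are grouped by their difference. The weight is real for
  moments of \<open>corr\<close> and complex for its Fourier transform, hence the general
  field.\<close>

lemma sum_corr_mult:
  fixes A :: "(nat \<Rightarrow> 'a::{field,finite}) set" and w :: "(nat \<Rightarrow> 'a) \<Rightarrow> 'b::real_normed_field"
  assumes A: "A \<subseteq> fspace n"
  shows "(\<Sum>d\<in>fspace n. of_real (corr A d) * w d) = (\<Sum>x\<in>A. \<Sum>y\<in>A. w (y - x))"
proof -
  have finA: "finite A" using finite_subset[OF A] by simp
  have "of_real (corr A d) * w d = (\<Sum>x\<in>A. if x + d \<in> A then w d else 0)" for d
    using finA by (simp add: corr_def sum.If_cases Int_def)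
  then have "(\<Sum>d\<in>fspace n. of_real (corr A d) * w d) = (\<Sum>d\<in>fspace n. \<Sum>x\<in>A. if x + d \<in> A then w d else 0)"
    by simp
  also have "\<dots> = (\<Sum>x\<in>A. \<Sum>d\<in>fspace n. if x + d \<in> A then w d else 0)"
    by (rule sum.swap)
  also have "\<dots> = (\<Sum>x\<in>A. \<Sum>d\<in>{d\<in>fspace n. x + d \<in> A}. w d)"
    by (simp add: sum.If_cases Int_def)
  also have "\<dots> = (\<Sum>x\<in>A. \<Sum>y\<in>A. w (y - x))"
  proof (rule sum.cong[OF refl])
    fix x assume "x \<in> A"
    then have "x \<in> fspace n" using A by auto
    then show "(\<Sum>d\<in>{d\<in>fspace n. x + d \<in> A}. w d) = (\<Sum>y\<in>A. w (y - x))"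
      using subsetD[OF A] by (intro sum.reindex_bij_witness[of _ "\<lambda>y. y - x" "\<lambda>d. x + d"]) auto
  qed
  finally show ?thesis .
qed

lemma sum_corr:
  fixes A :: "(nat \<Rightarrow> 'a::{field,finite}) set"
  assumes A: "A \<subseteq> fspace n"
  shows "(\<Sum>d\<in>fspace n. corr A d) = (card A)\<^sup>2"
  using sum_corr_mult[OF A, of "\<lambda>_. 1::real"] by (simp add: power2_eq_square)

text \<open>The difference 0 contributes \<open>(card A)\<^sup>2\<close>, and for the others one
  factor is replaced by \<open>R\<close> while the remaining one sums to at most
  \<open>(card A)\<^sup>2\<close>. The two contributions combine because
  \<open>1 \<le> R\<close>.\<close>

lemma sum_corr_squared_le:
  fixes A :: "(nat \<Rightarrow> 'a::{field,finite}) set" and R :: real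
  assumes A: "A \<subseteq> fspace n" and R: "1 \<le> R" "\<And>d. d \<in> fspace n \<Longrightarrow> d \<noteq> 0 \<Longrightarrow> corr A d \<le> R"
  shows "(\<Sum>d\<in>fspace n. (corr A d)\<^sup>2) \<le> 2 * R * (card A)\<^sup>2"
proof -
  have "(\<Sum>d\<in>fspace n. (corr A d)\<^sup>2) = (card A)\<^sup>2 + (\<Sum>d\<in>fspace n - {0}. (corr A d)\<^sup>2)"
    by (subst sum.remove[of _ 0]) auto
  also have "(\<Sum>d\<in>fspace n - {0}. (corr A d)\<^sup>2) \<le> (\<Sum>d\<in>fspace n - {0}. R * corr A d)"
    unfolding power2_eq_square by (intro sum_mono mult_right_mono R) auto
  also have "\<dots> \<le> (\<Sum>d\<in>fspace n. R * corr A d)"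
    using R by (intro sum_mono2) auto
  also have "\<dots> = R * (card A)\<^sup>2" by (simp add: sum_corr[OF A] flip: sum_distrib_left)
  finally have "(\<Sum>d\<in>fspace n. (corr A d)\<^sup>2) \<le> (card A)\<^sup>2 + R * (card A)\<^sup>2" by simp
  moreover have "1 * real ((card A)\<^sup>2) \<le> R * (card A)\<^sup>2"
    using R(1) by (intro mult_right_mono) auto
  ultimately show ?thesis by linarith
qed

section \<open>Distribution of a set on the cosets of a subspace\<close>

locale subspace_of =
  fixes n and H :: "(nat \<Rightarrow> 'a::{field,finite}) set"
  assumes sub: "H \<subseteq> fspace n" and zero: "0 \<in> H"
    and add: "\<And>x y. x \<in> H \<Longrightarrow> y \<in> H \<Longrightarrow> x + y \<in> H" and scale: "\<And>c x. x \<in> H \<Longrightarrow> c \<star> x \<in> H"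
begin

lemma finite_H: "finite H"
  using finite_subset[OF sub] by simp

lemma uminus: "x \<in> H \<Longrightarrow> - x \<in> H"
  using scale[of x "-1"] by (simp add: scale_simps)

lemma card_pos: "0 < card H"
  using finite_H zero by (auto simp: card_gt_0_iff)

text \<open>The convolution of the indicators of \<open>A\<close> and \<open>H\<close>, kept as a
  function on the whole space instead of the quotient. Division by \<open>card H\<close> is
  postponed until the comparison of solution counts.\<close>

definition coset_count :: "(nat \<Rightarrow> 'a) set \<Rightarrow> (nat \<Rightarrow> 'a) \<Rightarrow> real" where
  "coset_count A x = card {h \<in> H. x + h \<in> A}"

lemma coset_count_nonneg [simp]: "0 \<le> coset_count A x"
  by (simp add: coset_count_def)

lemma sum_coset_count_mult:
  fixes w :: "(nat \<Rightarrow> 'a) \<Rightarrow> 'b::real_normed_field"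
  assumes A: "A \<subseteq> fspace n"
  shows "(\<Sum>x\<in>fspace n. of_real (coset_count A x) * w x) = (\<Sum>h\<in>H. \<Sum>y\<in>A. w (y - h))"
proof -
  have "of_real (coset_count A x) * w x = (\<Sum>h\<in>H. if x + h \<in> A then w x else 0)" for x
    using finite_H by (simp add: coset_count_def sum.If_cases Int_def)
  then have "(\<Sum>x\<in>fspace n. of_real (coset_count A x) * w x) = (\<Sum>x\<in>fspace n. \<Sum>h\<in>H. if x + h \<in> A then w x else 0)"
    by simp
  also have "\<dots> = (\<Sum>h\<in>H. \<Sum>x\<in>fspace n. if x + h \<in> A then w x else 0)"
    by (rule sum.swap)
  also have "\<dots> = (\<Sum>h\<in>H. \<Sum>x\<in>{x\<in>fspace n. x + h \<in> A}. w x)"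
    by (simp add: sum.If_cases Int_def)
  also have "\<dots> = (\<Sum>h\<in>H. \<Sum>y\<in>A. w (y - h))"
  proof (rule sum.cong[OF refl])
    fix h assume "h \<in> H"
    then have "h \<in> fspace n" using sub by auto
    then show "(\<Sum>x\<in>{x\<in>fspace n. x + h \<in> A}. w x) = (\<Sum>y\<in>A. w (y - h))"
      using subsetD[OF A] by (intro sum.reindex_bij_witness[of _ "\<lambda>y. y - h" "\<lambda>x. x + h"]) auto
  qed
  finally show ?thesis .
qed

lemma sum_coset_count: "A \<subseteq> fspace n \<Longrightarrow> (\<Sum>x\<in>fspace n. coset_count A x) = card A * card H"
  using sum_coset_count_mult[of A "\<lambda>_. 1::real"] by simp

text \<open>The second moment counts pairs of points of \<open>A\<close> in a common coset, so it is
  the sum of \<open>corr A (k - h)\<close> over \<open>h\<close> and \<open>k\<close> in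
  \<open>H\<close>. The terms with \<open>k = h\<close> contribute \<open>card A\<close> each, the
  others at most \<open>R\<close>.\<close>

lemma sum_coset_count_squared_le:
  fixes R :: real
  assumes A: "A \<subseteq> fspace n" and R: "0 \<le> R" "\<And>d. d \<in> fspace n \<Longrightarrow> d \<noteq> 0 \<Longrightarrow> corr A d \<le> R"
  shows "(\<Sum>x\<in>fspace n. (coset_count A x)\<^sup>2) \<le> card H * (card A + card H * R)"
proof -
  have finA: "finite A" using finite_subset[OF A] by simp
  have "(\<Sum>x\<in>fspace n. (coset_count A x)\<^sup>2) = (\<Sum>h\<in>H. \<Sum>y\<in>A. coset_count A (y - h))"
    using sum_coset_count_mult[OF A, of "coset_count A"] by (simp add: power2_eq_square)
  also have "\<dots> = (\<Sum>h\<in>H. \<Sum>k\<in>H. corr A (k - h))"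
  proof (rule sum.cong[OF refl])
    fix h assume "h \<in> H"
    have "coset_count A (y - h) = (\<Sum>k\<in>H. if y + (k - h) \<in> A then 1 else 0)" for y
      using finite_H by (simp add: coset_count_def sum.If_cases Int_def algebra_simps)
    then have "(\<Sum>y\<in>A. coset_count A (y - h)) = (\<Sum>y\<in>A. \<Sum>k\<in>H. if y + (k - h) \<in> A then 1 else 0)" by simp
    also have "\<dots> = (\<Sum>k\<in>H. \<Sum>y\<in>A. if y + (k - h) \<in> A then 1 else 0)" by (rule sum.swap)
    also have "\<dots> = (\<Sum>k\<in>H. corr A (k - h))"
      using finA by (simp add: corr_def sum.If_cases Int_def)
    finally show "(\<Sum>y\<in>A. coset_count A (y - h)) = (\<Sum>k\<in>H. corr A (k - h))" .
  qed
  also have "\<dots> \<le> (\<Sum>h\<in>H. card A + card H * R)"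
  proof (intro sum_mono)
    fix h assume h: "h \<in> H"
    have "(\<Sum>k\<in>H. corr A (k - h)) = card A + (\<Sum>k\<in>H - {h}. corr A (k - h))"
      using h finite_H by (subst sum.remove[of _ h]) auto
    also have "(\<Sum>k\<in>H - {h}. corr A (k - h)) \<le> (\<Sum>k\<in>H - {h}. R)"
      using h subsetD[OF sub] by (intro sum_mono R) auto
    also have "\<dots> \<le> card H * R"
      using R(1) finite_H by (auto intro!: mult_right_mono card_mono)
    finally show "(\<Sum>k\<in>H. corr A (k - h)) \<le> card A + card H * R" by simp
  qed
  finally show ?thesis by simp
qed

text \<open>Points whose count is below half the mean carry at most half of the first moment.
  Cauchy-Schwarz on the rest compares with the second moment, which is at most
  \<open>2 * R * (card H)\<^sup>2\<close> because \<open>large\<close> absorbs the diagonal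
  pairs.\<close>

lemma card_popular_cosets:
  fixes R :: real
  assumes A: "A \<subseteq> fspace n" and R: "1 \<le> R" "\<And>d. d \<in> fspace n \<Longrightarrow> d \<noteq> 0 \<Longrightarrow> corr A d \<le> R"
    and large: "card A \<le> card H * R"
  shows "(card A)\<^sup>2 \<le> 8 * R * card {x \<in> fspace n. card A * card H / (2 * CARD('a) ^ n) \<le> coset_count A x}"
proof -
  let ?G = "fspace n :: (nat \<Rightarrow> 'a) set"
  define N where "N = real (CARD('a) ^ n)"
  have N: "N > 0" by (simp add: N_def)
  define m where "m = card A * card H / (2 * N)"
  define D where "D = {x \<in> ?G. m \<le> coset_count A x}"
  have m: "m \<ge> 0" using N by (simp add: m_def)
  have finD: "finite D" by (simp add: D_def)
  have "real (card A * card H) = (\<Sum>x\<in>?G. coset_count A x)"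
    by (simp add: sum_coset_count[OF A])
  also have "\<dots> = (\<Sum>x\<in>D. coset_count A x) + (\<Sum>x\<in>?G - D. coset_count A x)"
    by (simp add: sum.subset_diff[of D ?G] D_def)
  also have "(\<Sum>x\<in>?G - D. coset_count A x) \<le> (\<Sum>x\<in>?G - D. m)"
    by (intro sum_mono) (auto simp: D_def)
  also have "\<dots> \<le> (\<Sum>x\<in>?G. m)" using m by (intro sum_mono2) auto
  also have "\<dots> = card A * card H / 2" using N by (simp add: card_fspace m_def N_def)
  finally have "card A * card H / 2 \<le> (\<Sum>x\<in>D. coset_count A x)" by simp
  then have "(card A * card H / 2)\<^sup>2 \<le> (\<Sum>x\<in>D. coset_count A x)\<^sup>2" by (intro power_mono) auto
  also have "\<dots> \<le> card D * (\<Sum>x\<in>D. (coset_count A x)\<^sup>2)"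
    by (rule sum_squared_le_card_mult)
  also have "\<dots> \<le> card D * (\<Sum>x\<in>?G. (coset_count A x)\<^sup>2)"
    by (auto intro!: mult_left_mono sum_mono2 simp: D_def)
  also have "\<dots> \<le> card D * (card H * (card A + card H * R))"
    using R by (intro mult_left_mono sum_coset_count_squared_le[OF A]) auto
  also have "\<dots> \<le> card D * (card H * (card H * R + card H * R))"
    using large by (intro mult_left_mono add_mono) auto
  finally have "(card H)\<^sup>2 * (card A)\<^sup>2 \<le> (card H)\<^sup>2 * (8 * R * card D)"
    by (simp add: power_mult_distrib power_divide power2_eq_square algebra_simps)
  then show ?thesis using card_pos by (simp add: D_def m_def N_def)
qed

end

section \<open>The large spectrum and averaging over a subspace\<close>

context additive_character
begin

definition ind :: "(nat \<Rightarrow> 'a) set \<Rightarrow> (nat \<Rightarrow> 'a) \<Rightarrow> real" where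
  "ind A x = (if x \<in> A then 1 else 0)"

lemma ft_ind: "A \<subseteq> fspace n \<Longrightarrow> ft n (ind A) u = (\<Sum>x\<in>A. e (dot n u x))"
  unfolding ft_def ind_def by (rule sum.mono_neutral_cong_right) auto

lemma ft_corr:
  assumes A: "A \<subseteq> fspace n"
  shows "ft n (corr A) u = of_real ((norm (ft n (ind A) u))\<^sup>2)"
proof -
  have ed: "e (dot n u (y - x)) = cnj (e (dot n u x)) * e (dot n u y)" for x y
    using e_add[of "- dot n u x" "dot n u y"] by (simp add: dot_simps e_minus)
  have "ft n (corr A) u = (\<Sum>x\<in>A. \<Sum>y\<in>A. e (dot n u (y - x)))"
    unfolding ft_def by (rule sum_corr_mult[OF A])
  also have "\<dots> = cnj (ft n (ind A) u) * ft n (ind A) u"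
    by (simp add: ed ft_ind[OF A] sum_product)
  also have "\<dots> = of_real ((norm (ft n (ind A) u))\<^sup>2)"
    by (simp add: complex_norm_square mult.commute flip: of_real_power)
  finally show ?thesis .
qed

text \<open>The transform of \<open>corr A\<close> is the squared modulus of that of
  \<open>A\<close>, so Parseval for \<open>corr A\<close> identifies the fourth moment with the
  additive energy.\<close>

lemma sum_ft_fourth_power:
  assumes A: "A \<subseteq> fspace n"
  shows "(\<Sum>u\<in>fspace n. (norm (ft n (ind A) u)) ^ 4) = CARD('a) ^ n * (\<Sum>d\<in>fspace n. (corr A d)\<^sup>2)"
proof -
  have "(\<Sum>u\<in>fspace n. (norm (ft n (ind A) u)) ^ 4) = (\<Sum>u\<in>fspace n. (norm (ft n (corr A) u))\<^sup>2)"
    by (simp add: ft_corr[OF A] norm_power flip: power_mult)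
  then show ?thesis using parseval[of n "corr A"] by simp
qed

text \<open>Convolution with \<open>H\<close> acts on frequencies as a multiplier: it is
  \<open>card H\<close> on the frequencies orthogonal to \<open>H\<close> and 0 elsewhere.\<close>

lemma ft_coset_count:
  assumes H: "subspace_of n H" and A: "A \<subseteq> fspace n"
  shows "ft n (subspace_of.coset_count H A) u =
    (if \<forall>h\<in>H. dot n u h = 0 then card H * ft n (ind A) u else 0)"
proof -
  interpret subspace_of n H by (rule H)
  have ed: "e (dot n u (y - h)) = e (dot n u (- h)) * e (dot n u y)" for y h
    using e_add[of "- dot n u h" "dot n u y"] by (simp add: dot_simps)
  have "ft n (coset_count A) u = (\<Sum>h\<in>H. \<Sum>y\<in>A. e (dot n u (y - h)))"
    unfolding ft_def by (rule sum_coset_count_mult[OF A])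
  also have "\<dots> = (\<Sum>h\<in>H. e (dot n u (- h))) * ft n (ind A) u"
    by (simp add: ed ft_ind[OF A] sum_product)
  also have "(\<Sum>h\<in>H. e (dot n u (- h))) = (\<Sum>h\<in>H. e (dot n u h))"
    by (rule sum.reindex_bij_witness[of _ uminus uminus]) (auto intro: uminus)
  also have "\<dots> = (if \<forall>h\<in>H. dot n u h = 0 then of_nat (card H) else 0)"
    by (intro sum_character_subspace add scale)
  finally show ?thesis by auto
qed

lemma sum_prod_ind_sols5:
  assumes A: "A \<subseteq> fspace n"
  shows "(\<Sum>x\<in>sols5 a (fspace n). \<Prod>j<5. ind A (x j)) = card (sols5 a A)"
proof -
  have "(\<Sum>x\<in>sols5 a (fspace n). \<Prod>j<5. ind A (x j)) = (\<Sum>x\<in>sols5 a A. 1)"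
  proof (rule sum.mono_neutral_cong_right)
    show "sols5 a A \<subseteq> sols5 a (fspace n)" using A by (auto simp: sols5_def PiE_def Pi_def)
    show "\<forall>x\<in>sols5 a (fspace n) - sols5 a A. (\<Prod>j<5. ind A (x j)) = 0"
      by (auto simp: sols5_def PiE_def Pi_def ind_def)
    show "(\<Prod>j<5. ind A (x j)) = 1" if "x \<in> sols5 a A" for x
      using that by (intro prod.neutral) (auto simp: sols5_def PiE_def Pi_def ind_def)
  qed simp
  then show ?thesis by simp
qed

definition spec :: "nat \<Rightarrow> (nat \<Rightarrow> 'a) set \<Rightarrow> real \<Rightarrow> (nat \<Rightarrow> 'a) set" where
  "spec n A \<tau> = {u \<in> fspace n. \<tau> < norm (ft n (ind A) u)}"

lemma card_spec_le:
  fixes \<tau> :: real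
  assumes A: "A \<subseteq> fspace n" and \<tau>: "0 \<le> \<tau>"
  shows "card (spec n A \<tau>) * \<tau> ^ 4 \<le> CARD('a) ^ n * (\<Sum>d\<in>fspace n. (corr A d)\<^sup>2)"
proof -
  have "card (spec n A \<tau>) * \<tau> ^ 4 = (\<Sum>u\<in>spec n A \<tau>. \<tau> ^ 4)" by simp
  also have "\<dots> \<le> (\<Sum>u\<in>spec n A \<tau>. norm (ft n (ind A) u) ^ 4)"
    using \<tau> by (intro sum_mono power_mono) (auto simp: spec_def)
  also have "\<dots> \<le> (\<Sum>u\<in>fspace n. norm (ft n (ind A) u) ^ 4)"
    by (intro sum_mono2) (auto simp: spec_def)
  finally show ?thesis by (simp add: sum_ft_fourth_power[OF A])
qed

text \<open>Averaging over the cosets of the annihilator \<open>H\<close> of the large spectrum kills only Fourier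
  coefficients of size at most \<open>\<tau>\<close>; the other four factors are controlled by the additive energy.\<close>

lemma transference_error:
  assumes H: "subspace_of n H" and A: "A \<subseteq> fspace n" and a: "\<And>j. j < 5 \<Longrightarrow> a j \<noteq> 0"
    and \<tau>: "0 \<le> \<tau>" and ann: "\<And>u h. u \<in> spec n A \<tau> \<Longrightarrow> h \<in> H \<Longrightarrow> dot n u h = 0"
  shows "\<bar>card (sols5 a A) - (\<Sum>x\<in>sols5 a (fspace n). \<Prod>j<5. subspace_of.coset_count H A (x j)) / card H ^ 5\<bar>
    \<le> \<tau> * (\<Sum>d\<in>fspace n. (corr A d)\<^sup>2)"
proof -
  interpret subspace_of n H by (rule H)
  let ?G = "fspace n :: (nat \<Rightarrow> 'a) set"
  define N where "N = real (CARD('a) ^ n)"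
  have N: "N > 0" by (simp add: N_def)
  define P where "P = {u \<in> ?G. \<forall>h\<in>H. dot n u h = 0}"
  define F where "F = (\<lambda>u. ft n (ind A) u)"
  define E where "E = (\<Sum>d\<in>?G. (corr A d)\<^sup>2)"
  define TA where "TA = real (card (sols5 a A))"
  define Tf where "Tf = (\<Sum>x\<in>sols5 a ?G. \<Prod>j<5. coset_count A (x j))"
  have hp: "real (card H) ^ 5 > 0" using card_pos by simp
  have TA: "complex_of_real (N * TA) = (\<Sum>u\<in>?G. \<Prod>j<5. F (a j \<star> u))"
    using sum_prod_ft[where g = "ind A" and a = a and n = n] unfolding sum_prod_ind_sols5[OF A]
    by (simp add: F_def TA_def N_def)
  have "complex_of_real (N * Tf) = (\<Sum>u\<in>?G. \<Prod>j<5. ft n (coset_count A) (a j \<star> u))"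
    using sum_prod_ft[where g = "coset_count A" and a = a and n = n] by (simp add: Tf_def N_def)
  also have "\<dots> = (\<Sum>u\<in>?G. if u \<in> P then card H ^ 5 * (\<Prod>j<5. F (a j \<star> u)) else 0)"
  proof (rule sum.cong[OF refl])
    fix u assume u: "u \<in> ?G"
    have "(\<forall>h\<in>H. dot n (a j \<star> u) h = 0) \<longleftrightarrow> u \<in> P" if "j < 5" for j
      using a[OF that] u by (auto simp: P_def dot_simps)
    then have "(\<Prod>j<5. ft n (coset_count A) (a j \<star> u)) = (\<Prod>j<5. if u \<in> P then card H * F (a j \<star> u) else 0)"
      by (intro prod.cong refl) (simp add: ft_coset_count[OF H A] F_def)
    then show "(\<Prod>j<5. ft n (coset_count A) (a j \<star> u)) = (if u \<in> P then card H ^ 5 * (\<Prod>j<5. F (a j \<star> u)) else 0)"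
      by (simp add: prod.distrib)
  qed
  also have "\<dots> = card H ^ 5 * (\<Sum>u\<in>P. \<Prod>j<5. F (a j \<star> u))"
    by (simp add: sum.If_cases P_def Int_def sum_distrib_left)
  finally have Tf: "complex_of_real (N * (Tf / card H ^ 5)) = (\<Sum>u\<in>P. \<Prod>j<5. F (a j \<star> u))"
    using hp by (simp add: field_simps)
  have "complex_of_real (N * (TA - Tf / card H ^ 5)) = complex_of_real (N * TA) - complex_of_real (N * (Tf / card H ^ 5))"
    by (simp add: right_diff_distrib)
  \<comment> \<open>On \<open>P\<close> both products of transforms agree after division by
    \<open>card H ^ 5\<close>, so only frequencies not orthogonal to \<open>H\<close>
    survive.\<close>
  also have "\<dots> = (\<Sum>u\<in>?G - P. \<Prod>j<5. F (a j \<star> u))"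
    unfolding TA Tf by (subst sum.subset_diff[of P ?G]) (auto simp: P_def)
  finally have "norm (complex_of_real (N * (TA - Tf / card H ^ 5))) = norm (\<Sum>u\<in>?G - P. \<Prod>j<5. F (a j \<star> u))"
    by (rule arg_cong)
  also have "\<dots> \<le> (\<Sum>u\<in>?G - P. norm (\<Prod>j<5. F (a j \<star> u)))" by (rule norm_sum)
  also have "\<dots> \<le> (\<Sum>u\<in>?G - P. (\<Sum>j<4. norm (F (a j \<star> u)) ^ 4) / 4 * \<tau>)"
  proof (intro sum_mono)
    fix u assume u: "u \<in> ?G - P"
    \<comment> \<open>If this frequency were in the spectrum, \<open>H\<close> would be orthogonal
      to \<open>a 4 \<star> u\<close>, hence to \<open>u\<close>, against the choice of
      \<open>u\<close> outside \<open>P\<close>.\<close>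
    have "a 4 \<star> u \<notin> spec n A \<tau>"
    proof
      assume u4: "a 4 \<star> u \<in> spec n A \<tau>"
      have "dot n u h = 0" if "h \<in> H" for h using ann[OF u4 that] a[of 4] by (simp add: dot_simps)
      then show False using u by (auto simp: P_def)
    qed
    then have small: "norm (F (a 4 \<star> u)) \<le> \<tau>" using u by (auto simp: spec_def F_def)
    have "norm (\<Prod>j<5. F (a j \<star> u)) = norm (F (a 0 \<star> u)) * norm (F (a 1 \<star> u)) * norm (F (a 2 \<star> u)) * norm (F (a 3 \<star> u)) * norm (F (a 4 \<star> u))"
      by (simp add: lessThan_5 norm_mult mult.assoc)
    also have "\<dots> \<le> (norm (F (a 0 \<star> u)) ^ 4 + norm (F (a 1 \<star> u)) ^ 4 + norm (F (a 2 \<star> u)) ^ 4 + norm (F (a 3 \<star> u)) ^ 4) / 4 * \<tau>"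
      by (intro mult_mono prod4_le small) auto
    also have "\<dots> = (\<Sum>j<4. norm (F (a j \<star> u)) ^ 4) / 4 * \<tau>"
    proof -
      have "{..<4::nat} = {0, 1, 2, 3}" by auto
      then show ?thesis by (simp add: add.assoc)
    qed
    finally show "norm (\<Prod>j<5. F (a j \<star> u)) \<le> (\<Sum>j<4. norm (F (a j \<star> u)) ^ 4) / 4 * \<tau>" .
  qed
  also have "\<dots> \<le> (\<Sum>u\<in>?G. (\<Sum>j<4. norm (F (a j \<star> u)) ^ 4) / 4 * \<tau>)"
    using \<tau> by (intro sum_mono2) (auto intro!: mult_nonneg_nonneg sum_nonneg)
  also have "\<dots> = (\<Sum>j<4. \<Sum>u\<in>?G. norm (F (a j \<star> u)) ^ 4) / 4 * \<tau>"
    by (subst sum.swap) (simp add: sum_distrib_right sum_divide_distrib)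
  \<comment> \<open>Dilation by a nonzero coefficient permutes the frequencies, so each of the four
    sums is the full fourth moment.\<close>
  also have "(\<Sum>j<4. \<Sum>u\<in>?G. norm (F (a j \<star> u)) ^ 4) = (\<Sum>j<4::nat. N * E)"
  proof (rule sum.cong[OF refl])
    fix j :: nat assume "j \<in> {..<4}"
    then have aj: "a j \<noteq> 0" using a[of j] by auto
    have "(\<Sum>u\<in>?G. norm (F (a j \<star> u)) ^ 4) = (\<Sum>u\<in>?G. norm (F u) ^ 4)"
      by (rule sum.reindex_bij_witness[of _ "\<lambda>u. inverse (a j) \<star> u" "\<lambda>u. a j \<star> u"]) (auto simp: scale_simps aj)
    also have "\<dots> = N * E" unfolding F_def E_def N_def by (rule sum_ft_fourth_power[OF A])
    finally show "(\<Sum>u\<in>?G. norm (F (a j \<star> u)) ^ 4) = N * E" .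
  qed
  finally have "N * \<bar>TA - Tf / card H ^ 5\<bar> \<le> N * (\<tau> * E)"
    using N by (simp add: abs_mult mult_ac flip: of_real_mult of_real_diff of_real_divide of_real_power)
  then show ?thesis using N by (simp add: TA_def Tf_def E_def)
qed

end

definition annihilator :: "nat \<Rightarrow> (nat \<Rightarrow> 'a::field) set \<Rightarrow> (nat \<Rightarrow> 'a) set" where
  "annihilator n S = {x \<in> fspace n. \<forall>u\<in>S. dot n u x = 0}"

lemma subspace_of_annihilator: "subspace_of n (annihilator n S :: (nat \<Rightarrow> 'a::{field,finite}) set)"
  by unfold_locales (auto simp: annihilator_def dot_simps)

text \<open>Evaluation against \<open>S\<close> takes at most \<open>q ^ card S\<close> values, and
  each fibre is empty or embeds by translation into the annihilator. The codimension is thus bounded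
  by the size of \<open>S\<close>.\<close>

lemma card_annihilator_ge:
  fixes S :: "(nat \<Rightarrow> 'a::{field,finite}) set"
  assumes "finite S"
  shows "CARD('a) ^ n \<le> CARD('a) ^ card S * card (annihilator n S)"
proof -
  let ?G = "fspace n :: (nat \<Rightarrow> 'a) set"
  define ev where "ev = (\<lambda>x. \<lambda>u\<in>S. dot n u x)"
  define P where "P = S \<rightarrow>\<^sub>E (UNIV :: 'a set)"
  have finP: "finite P" unfolding P_def by (intro finite_PiE assms) auto
  have fib: "card {x\<in>?G. ev x = w} \<le> card (annihilator n S)" for w
  proof (cases "\<exists>x0\<in>?G. ev x0 = w")
    case True
    then obtain x0 where x0: "x0 \<in> ?G" "ev x0 = w" by blast
    show ?thesis
    proof (rule card_inj_on_le[where f = "\<lambda>x. x - x0"])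
      show "(\<lambda>x. x - x0) ` {x\<in>?G. ev x = w} \<subseteq> annihilator n S"
      proof (rule image_subsetI)
        fix x assume x: "x \<in> {x\<in>?G. ev x = w}"
        then have ev: "ev x = ev x0" using x0 by simp
        have "dot n u x = dot n u x0" if "u \<in> S" for u
          using fun_cong[OF ev, of u] that by (simp add: ev_def)
        then show "x - x0 \<in> annihilator n S" using x x0 by (auto simp: annihilator_def dot_simps)
      qed
      show "finite (annihilator n S)" by (simp add: annihilator_def)
    qed (auto simp: inj_on_def)
  next
    case False
    then have "{x\<in>?G. ev x = w} = {}" by blast
    then have "card {x\<in>?G. ev x = w} = 0" by (simp only: card.empty)
    then show ?thesis by linarith
  qed
  have "card ?G \<le> card (\<Union>w\<in>P. {x\<in>?G. ev x = w})"
    by (intro card_mono) (auto simp: finP, auto simp: P_def ev_def)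
  also have "\<dots> \<le> (\<Sum>w\<in>P. card {x\<in>?G. ev x = w})" by (rule card_UN_le[OF finP])
  also have "\<dots> \<le> (\<Sum>w\<in>P. card (annihilator n S))" by (intro sum_mono fib)
  finally show ?thesis by (simp add: card_fspace P_def card_PiE assms)
qed

lemma sols5_mono: "A \<subseteq> B \<Longrightarrow> sols5 a A \<subseteq> sols5 a B"
  unfolding sols5_def using PiE_mono[of "{..<5}" "\<lambda>_. A" "\<lambda>_. B"] by blast

text \<open>\<open>L\<close> is the codimension allowed for the annihilator of the spectrum. Its
  lower bound makes \<open>L\<close> at least the number of large frequencies, and its upper bound
  keeps the annihilator large enough for \<open>card_popular_cosets\<close>.\<close>

lemma many_solutions:
  "\<exists>(c::real) K. 0 < c \<and> (\<forall>n (A :: (nat \<Rightarrow> 'a::{field,finite}) set) (R::real) a \<alpha> L.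
      (\<forall>j<5. a j \<noteq> 0) \<longrightarrow> (\<Sum>j<5. a j) = 0 \<longrightarrow> a 0 + a 1 \<noteq> 0 \<longrightarrow> a 2 + a 3 \<noteq> 0 \<longrightarrow>
      A \<subseteq> fspace n \<longrightarrow> A \<noteq> {} \<longrightarrow> 1 \<le> R \<longrightarrow> (\<forall>d\<in>fspace n. d \<noteq> 0 \<longrightarrow> corr A d \<le> R) \<longrightarrow>
      \<alpha> = (card A)\<^sup>2 / (8 * R * CARD('a) ^ n) \<longrightarrow>
      1 / (4 * (c * \<alpha> ^ (K + 1) / 16) ^ 4 * \<alpha>) \<le> real L \<longrightarrow> CARD('a) ^ L * card A \<le> CARD('a) ^ n * R \<longrightarrow>
      c * \<alpha> ^ K * card A ^ 5 / (64 * CARD('a) ^ n) \<le> card (sols5 a A))"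
proof -
  obtain c :: real and K where c: "0 < c" and sat: "\<And>n (D :: (nat \<Rightarrow> 'a) set) (\<alpha>::real) a.
      \<forall>j<5. a j \<noteq> 0 \<Longrightarrow> (\<Sum>j<5. a j) = 0 \<Longrightarrow> a 0 + a 1 \<noteq> 0 \<Longrightarrow> a 2 + a 3 \<noteq> 0 \<Longrightarrow>
      D \<subseteq> fspace n \<Longrightarrow> 0 < \<alpha> \<Longrightarrow> \<alpha> * CARD('a) ^ n \<le> card D \<Longrightarrow>
      c * \<alpha> ^ K * (CARD('a) ^ n) ^ 4 \<le> card (sols5 a D)"
    using supersaturation5[where 'a = 'a] by blast
  obtain e :: "'a \<Rightarrow> complex" where "additive_character e"
    using ex_nontrivial_additive_character[where 'a = 'a] by (auto simp: additive_character_def)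
  then interpret additive_character e .
  show ?thesis
  proof (intro exI[of _ c] exI[of _ K] conjI allI impI)
    show "0 < c" by (rule c)
    fix n L and A :: "(nat \<Rightarrow> 'a) set" and R \<alpha> :: real and a :: "nat \<Rightarrow> 'a"
    assume a: "\<forall>j<5. a j \<noteq> 0" "(\<Sum>j<5. a j) = 0" "a 0 + a 1 \<noteq> 0" "a 2 + a 3 \<noteq> 0"
      and A: "A \<subseteq> fspace n" "A \<noteq> {}" and R: "1 \<le> R" "\<forall>d\<in>fspace n. d \<noteq> 0 \<longrightarrow> corr A d \<le> R"
      and \<alpha>: "\<alpha> = (card A)\<^sup>2 / (8 * R * CARD('a) ^ n)"
      and L: "1 / (4 * (c * \<alpha> ^ (K + 1) / 16) ^ 4 * \<alpha>) \<le> real L"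
      and L': "CARD('a) ^ L * card A \<le> CARD('a) ^ n * R"
    define N M q where "N = real (CARD('a) ^ n)" and "M = real (card A)" and "q = real CARD('a)"
    have q: "q \<ge> 2" using card_ge2_field[where 'a = 'a] by (simp add: q_def)
    have finA: "finite A" using finite_subset[OF A(1)] by simp
    have pos: "N > 0" "M > 0" "R > 0" using A finA R by (auto simp: N_def M_def card_gt_0_iff)
    have \<alpha>': "\<alpha> = M\<^sup>2 / (8 * R * N)" by (simp add: \<alpha> N_def M_def)
    have \<alpha>0: "\<alpha> > 0" using pos by (simp add: \<alpha>')
    \<comment> \<open>This threshold makes the transference error at most
      \<open>c * \<alpha> ^ K * M ^ 5 / (64 * N)\<close>, half of the main term obtained
      below.\<close>
    define \<epsilon> where "\<epsilon> = c * \<alpha> ^ (K + 1) / 16"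
    have \<epsilon>: "\<epsilon> > 0" using c \<alpha>0 by (simp add: \<epsilon>_def)
    define E where "E = (\<Sum>d\<in>fspace n. (corr A d)\<^sup>2)"
    have E: "E \<le> 2 * R * M\<^sup>2"
      unfolding E_def M_def using sum_corr_squared_le[OF A(1) R(1)] R(2) by simp
    define S where "S = spec n A (\<epsilon> * M)"
    have finS: "finite S" by (simp add: S_def spec_def)
    have "card S * (\<epsilon> * M) ^ 4 \<le> N * E"
      unfolding S_def N_def E_def using \<epsilon> pos by (intro card_spec_le A) auto
    also have "\<dots> \<le> N * (2 * R * M\<^sup>2)" using E pos by simp
    finally have "card S * (\<epsilon> * M) ^ 4 \<le> N * (2 * R * M\<^sup>2)" .
    then have "card S \<le> N * (2 * R * M\<^sup>2) / (\<epsilon> * M) ^ 4" using \<epsilon> pos by (simp add: field_simps)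
    \<comment> \<open>By definition of \<alpha>, the quotient \<open>N * R / M\<^sup>2\<close> is
      \<open>1 / (8 * \<alpha>)\<close>.\<close>
    also have "\<dots> = 1 / (4 * \<epsilon> ^ 4 * \<alpha>)"
      using pos \<epsilon> by (simp add: \<alpha>' field_simps power2_eq_square power4_eq_xxxx)
    also have "\<dots> \<le> L" using L by (simp add: \<epsilon>_def)
    finally have SL: "card S \<le> L" by simp
    define H where "H = annihilator n S"
    interpret subspace_of n H unfolding H_def by (rule subspace_of_annihilator)
    define h where "h = real (card H)"
    have h: "h > 0" using card_pos by (simp add: h_def)
    have "real (CARD('a) ^ n) \<le> real (CARD('a) ^ card S * card H)"
      unfolding H_def of_nat_le_iff by (rule card_annihilator_ge[OF finS])
    then have "N \<le> q ^ card S * h" by (simp add: N_def q_def h_def)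
    also have "\<dots> \<le> q ^ L * h" using SL q h by (intro mult_right_mono power_increasing) auto
    finally have NH: "N \<le> q ^ L * h" .
    have "q ^ L * M \<le> N * R" using L' by (simp add: q_def M_def N_def)
    also have "\<dots> \<le> q ^ L * h * R" using NH pos by (intro mult_right_mono) auto
    finally have "q ^ L * M \<le> q ^ L * (h * R)" by (simp add: mult_ac)
    then have large: "M \<le> h * R" using q by (simp add: mult_le_cancel_left_pos)
    define m where "m = M * h / (2 * N)"
    have m: "m \<ge> 0" using pos h by (simp add: m_def)
    define D where "D = {x \<in> fspace n. m \<le> coset_count A x}"
    have Dn: "D \<subseteq> fspace n" by (auto simp: D_def)
    have "real ((card A)\<^sup>2) \<le> 8 * R * card D"
      using card_popular_cosets[OF A(1) R(1)] R(2) large by (simp add: D_def m_def M_def N_def h_def)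
    then have "\<alpha> * N \<le> card D" using pos by (simp add: \<alpha>' M_def field_simps)
    then have satD: "c * \<alpha> ^ K * N ^ 4 \<le> card (sols5 a D)"
      using sat[OF a Dn \<alpha>0] by (simp add: N_def)
    define Tf where "Tf = (\<Sum>x\<in>sols5 a (fspace n). \<Prod>j<5. coset_count A (x j))"
    have "m ^ 5 * (c * \<alpha> ^ K * N ^ 4) \<le> m ^ 5 * card (sols5 a D)"
      using satD m by (intro mult_left_mono) auto
    also have "\<dots> = (\<Sum>x\<in>sols5 a D. \<Prod>j<5::nat. m)" by simp
    also have "\<dots> \<le> (\<Sum>x\<in>sols5 a D. \<Prod>j<5. coset_count A (x j))"
      using m by (intro sum_mono prod_mono) (auto simp: sols5_def D_def PiE_def Pi_def)
    also have "\<dots> \<le> Tf"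
      unfolding Tf_def by (intro sum_mono2 sols5_mono[OF Dn]) (auto intro!: prod_nonneg)
    finally have "m ^ 5 * (c * \<alpha> ^ K * N ^ 4) / h ^ 5 \<le> Tf / h ^ 5" using h by (simp add: divide_right_mono)
    moreover have "m ^ 5 * (c * \<alpha> ^ K * N ^ 4) / h ^ 5 = 2 * (c * \<alpha> ^ K * M ^ 5 / (64 * N))"
      using h pos by (simp add: m_def power_mult_distrib power_divide field_simps eval_nat_numeral)
    ultimately have main: "2 * (c * \<alpha> ^ K * M ^ 5 / (64 * N)) \<le> Tf / h ^ 5" by simp
    have "\<bar>card (sols5 a A) - Tf / h ^ 5\<bar> \<le> \<epsilon> * M * E"
    proof -
      have 1: "\<And>j. j < 5 \<Longrightarrow> a j \<noteq> 0" and 2: "0 \<le> \<epsilon> * M" using a \<epsilon> pos by auto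
      have 3: "\<And>u h. u \<in> spec n A (\<epsilon> * M) \<Longrightarrow> h \<in> H \<Longrightarrow> dot n u h = 0"
        by (auto simp: H_def annihilator_def S_def)
      show ?thesis
        using transference_error[OF subspace_of_axioms A(1) 1 2 3] by (simp add: Tf_def h_def E_def)
    qed
    also have "\<dots> \<le> \<epsilon> * M * (2 * R * M\<^sup>2)" using E \<epsilon> pos by (intro mult_left_mono) auto
    also have "\<dots> = c * \<alpha> ^ K * M ^ 5 / (64 * N)"
    proof -
      have "\<epsilon> * M * (2 * R * M\<^sup>2) = c * \<alpha> ^ K / 8 * M ^ 3 * (\<alpha> * R)"
        by (simp add: \<epsilon>_def power2_eq_square power3_eq_cube)
      also have "\<alpha> * R = M\<^sup>2 / (8 * N)" using pos by (simp add: \<alpha>')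
      finally show ?thesis by (simp add: eval_nat_numeral mult_ac)
    qed
    finally have "Tf / h ^ 5 - c * \<alpha> ^ K * M ^ 5 / (64 * N) \<le> card (sols5 a A)" by linarith
    with main have "c * \<alpha> ^ K * M ^ 5 / (64 * N) \<le> card (sols5 a A)" by linarith
    then show "c * \<alpha> ^ K * card A ^ 5 / (64 * CARD('a) ^ n) \<le> card (sols5 a A)"
      by (simp add: M_def N_def)
  qed
qed

section \<open>Correlations of a set without complete bipartite patterns\<close>

text \<open>Sets of prescribed size stand in for the injective families of \<open>Kst_free\<close>,
  which suits counting by \<open>n_subsets\<close>.\<close>

definition kst_free :: "nat \<Rightarrow> nat \<Rightarrow> nat \<Rightarrow> (nat \<Rightarrow> 'a::field) set \<Rightarrow> bool" where
  "kst_free n s t A \<longleftrightarrow> \<not> (\<exists>X Y. X \<subseteq> fspace n \<and> Y \<subseteq> fspace n \<and> card X = s \<and> card Y = t \<and> (\<forall>x\<in>X. \<forall>y\<in>Y. x + y \<in> A))"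

text \<open>Double counting in the manner of Kovari, Sos and Turan: pair each \<open>y\<close> with
  the \<open>(s - 2)\<close>-sets \<open>Z\<close> such that \<open>z + y\<close> lies in
  \<open>A\<close> for all \<open>z\<close> in \<open>Z\<close>. As \<open>0\<close> and
  \<open>d\<close> are kept out of \<open>Z\<close>, joining them gives a set of size
  \<open>s\<close>, and more than \<open>t\<close> choices of \<open>y\<close> for one
  \<open>Z\<close> would yield a forbidden pattern.\<close>

lemma corr_mult_binomial_le:
  fixes A :: "(nat \<Rightarrow> 'a::{field,finite}) set"
  assumes A: "A \<subseteq> fspace n" and kst: "kst_free n s t A" and s: "2 \<le> s" and d: "d \<in> fspace n" "d \<noteq> 0"
  shows "card {y \<in> A. y + d \<in> A} * ((card A - 2) choose (s - 2)) \<le> t * ((CARD('a) ^ n) choose (s - 2))"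
proof -
  let ?G = "fspace n :: (nat \<Rightarrow> 'a) set"
  define B where "B = {y \<in> A. y + d \<in> A}"
  define W where "W = (\<lambda>y. {z\<in>?G. z + y \<in> A} - {0, d})"
  define \<Z> where "\<Z> = {Z. Z \<subseteq> ?G \<and> card Z = s - 2}"
  define rel where "rel = (\<lambda>y Z. Z \<subseteq> W y)"
  have finA: "finite A" using finite_subset[OF A] by simp
  have finB: "finite B" using finA by (simp add: B_def)
  have finZ: "finite \<Z>" unfolding \<Z>_def by (rule finite_subset[of _ "Pow ?G"]) auto
  have cardW: "card (W y) = card A - 2" if "y \<in> B" for y
  proof -
    have y: "y \<in> A" "y + d \<in> A" "y \<in> ?G" using that A by (auto simp: B_def)
    have "bij_betw (\<lambda>z. z + y) {z\<in>?G. z + y \<in> A} A"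
      by (rule bij_betwI[where g = "\<lambda>x. x - y"]) (use y subsetD[OF A] in auto)
    then have "card {z\<in>?G. z + y \<in> A} = card A" by (rule bij_betw_same_card)
    moreover have "{0, d} \<subseteq> {z\<in>?G. z + y \<in> A}" using y d by (auto simp: add.commute)
    ultimately show ?thesis using d by (simp add: W_def card_Diff_subset)
  qed
  have perY: "card {Z\<in>\<Z>. rel y Z} = (card A - 2) choose (s - 2)" if "y \<in> B" for y
  proof -
    have "{Z\<in>\<Z>. rel y Z} = {Z. Z \<subseteq> W y \<and> card Z = s - 2}"
      by (auto simp: \<Z>_def rel_def W_def)
    moreover have "finite (W y)" by (simp add: W_def)
    ultimately show ?thesis using n_subsets[of "W y" "s - 2"] cardW[OF that] by simp
  qed
  have perZ: "card {y\<in>B. rel y Z} \<le> t" if "Z \<in> \<Z>" for Z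
  proof (rule ccontr)
    assume "\<not> ?thesis"
    then have gt: "t < card {y\<in>B. rel y Z}" by simp
    then obtain Y where Y: "Y \<subseteq> {y\<in>B. rel y Z}" "card Y = t"
      using obtain_subset_with_card_n[OF less_imp_le[OF gt]] by blast
    have "{y\<in>B. rel y Z} \<noteq> {}"
    proof
      assume "{y\<in>B. rel y Z} = {}"
      then have "card {y\<in>B. rel y Z} = 0" by (simp only: card.empty)
      then show False using gt by linarith
    qed
    then obtain y0 where y0: "y0 \<in> B" "rel y0 Z" by blast
    have "finite Z" using that finite_subset[of Z ?G] by (auto simp: \<Z>_def)
    moreover have "0 \<notin> Z" "d \<notin> Z" using y0 by (auto simp: rel_def W_def)
    ultimately have "card ({0, d} \<union> Z) = s"
      using that d s by (simp add: \<Z>_def)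
    moreover have "{0, d} \<union> Z \<subseteq> ?G" using that d by (auto simp: \<Z>_def)
    moreover have "Y \<subseteq> ?G" using Y A by (auto simp: B_def)
    moreover have "\<forall>x\<in>{0, d} \<union> Z. \<forall>y\<in>Y. x + y \<in> A"
    proof (intro ballI)
      fix x y assume "x \<in> {0, d} \<union> Z" "y \<in> Y"
      moreover from this have "y \<in> A" "y + d \<in> A" "Z \<subseteq> W y" using Y(1) by (auto simp: B_def rel_def)
      ultimately show "x + y \<in> A" by (auto simp: W_def add.commute)
    qed
    ultimately show False using kst Y(2) unfolding kst_free_def by blast
  qed
  have "card B * ((card A - 2) choose (s - 2)) = (\<Sum>y\<in>B. card {Z\<in>\<Z>. rel y Z})"
    by (simp add: perY)
  also have "\<dots> = (\<Sum>Z\<in>\<Z>. card {y\<in>B. rel y Z})"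
    by (rule sum_multicount_gen) (auto simp: finB finZ)
  also have "\<dots> \<le> (\<Sum>Z\<in>\<Z>. t)" by (intro sum_mono perZ)
  also have "\<dots> = t * ((CARD('a) ^ n) choose (s - 2))"
    using n_subsets[of ?G "s - 2"] by (simp add: \<Z>_def card_fspace)
  finally show ?thesis by (simp add: B_def)
qed

text \<open>The binomials are replaced by powers: \<open>2 * s \<le> card A\<close> makes
  \<open>card A - 2\<close> at least half of \<open>card A\<close>, so the left binomial is at least
  \<open>(card A / (2 * s)) ^ (s - 2)\<close>.\<close>

lemma corr_le_of_kst_free:
  fixes A :: "(nat \<Rightarrow> 'a::{field,finite}) set"
  assumes A: "A \<subseteq> fspace n" and kst: "kst_free n s t A" and s: "2 \<le> s" "2 * s \<le> card A"
    and d: "d \<in> fspace n" "d \<noteq> 0"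
  shows "corr A d \<le> t * (2 * s * CARD('a) ^ n / card A) ^ (s - 2)"
proof -
  define j where "j = s - 2"
  define M N where "M = real (card A)" and "N = real (CARD('a) ^ n)"
  have M: "M \<ge> 4" "M > 0" using s by (auto simp: M_def)
  have lower: "(M / (2 * s)) ^ j \<le> real ((card A - 2) choose j)"
  proof (cases "j = 0")
    case False
    have "(M / (2 * s)) ^ j \<le> (real (card A - 2) / j) ^ j"
    proof (rule power_mono)
      have "M / (2 * s) \<le> M / (2 * j)" using M False by (intro divide_left_mono) (auto simp: j_def)
      also have "\<dots> = (M / 2) / j" by simp
      also have "\<dots> \<le> real (card A - 2) / j" using M by (intro divide_right_mono) (auto simp: M_def of_nat_diff)
      finally show "M / (2 * s) \<le> real (card A - 2) / j" .
    qed (use M in simp)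
    also have "\<dots> \<le> real ((card A - 2) choose j)"
      using s by (intro binomial_ge_n_over_k_pow_k) (auto simp: j_def)
    finally show ?thesis .
  qed simp
  have "corr A d * (M / (2 * s)) ^ j \<le> corr A d * real ((card A - 2) choose j)"
    by (intro mult_left_mono lower) auto
  also have "\<dots> = real (card {y \<in> A. y + d \<in> A} * ((card A - 2) choose (s - 2)))"
    by (simp add: corr_def j_def)
  also have "\<dots> \<le> real (t * ((CARD('a) ^ n) choose (s - 2)))"
    unfolding of_nat_le_iff by (rule corr_mult_binomial_le[OF A kst s(1) d])
  also have "\<dots> \<le> t * N ^ j"
  proof -
    have "(CARD('a) ^ n) choose j \<le> (CARD('a) ^ n) ^ j"
    proof (cases "j \<le> CARD('a) ^ n")
      case True
      then show ?thesis by (rule binomial_le_pow)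
    qed (simp add: binomial_eq_0)
    then have "real ((CARD('a) ^ n) choose j) \<le> N ^ j"
      unfolding N_def of_nat_power[symmetric] of_nat_le_iff by (simp add: of_nat_power)
    then show ?thesis by (simp add: j_def mult_left_mono)
  qed
  finally have "corr A d \<le> t * N ^ j / (M / (2 * s)) ^ j"
    using M s by (simp add: field_simps)
  also have "\<dots> = t * (2 * s * N / M) ^ j"
    using M s by (simp add: power_divide power_mult_distrib field_simps)
  finally show ?thesis by (simp add: M_def N_def j_def)
qed

section \<open>The bound for five variables\<close>

text \<open>In terms of \<alpha> this says that \<open>\<alpha> ^ Q * ln N\<close> is bounded.
  Integer powers keep the estimate free of roots until the very end, and \<open>Q\<close> and
  \<open>C\<close> are chosen before the coefficients.\<close>

lemma kst_free_solution_free_bound: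
  fixes s t :: nat
  assumes s: "2 \<le> s" and t: "1 \<le> t"
  shows "\<exists>Q (C::real). 1 \<le> Q \<and> 0 < C \<and> (\<forall>n (A :: (nat \<Rightarrow> 'a::{field,finite}) set) a. 1 \<le> n \<longrightarrow>
    (\<forall>j<5. a j \<noteq> 0) \<longrightarrow> (\<Sum>j<5. a j) = 0 \<longrightarrow> a 0 + a 1 \<noteq> 0 \<longrightarrow> a 2 + a 3 \<noteq> 0 \<longrightarrow>
    A \<subseteq> fspace n \<longrightarrow> kst_free n s t A \<longrightarrow> (\<forall>x\<in>sols5 a A. \<forall>i<5. \<forall>j<5. x i = x j) \<longrightarrow>
    real (card A) ^ (s * Q) * ln (real CARD('a) ^ n) \<le> C * (real CARD('a) ^ n) ^ ((s - 1) * Q))"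
proof -
  obtain c :: real and K where c: "0 < c" and many: "\<And>n (A :: (nat \<Rightarrow> 'a::{field,finite}) set) (R::real) a \<alpha> L.
      \<forall>j<5. a j \<noteq> 0 \<Longrightarrow> (\<Sum>j<5. a j) = 0 \<Longrightarrow> a 0 + a 1 \<noteq> 0 \<Longrightarrow> a 2 + a 3 \<noteq> 0 \<Longrightarrow>
      A \<subseteq> fspace n \<Longrightarrow> A \<noteq> {} \<Longrightarrow> 1 \<le> R \<Longrightarrow> \<forall>d\<in>fspace n. d \<noteq> 0 \<longrightarrow> corr A d \<le> R \<Longrightarrow>
      \<alpha> = (card A)\<^sup>2 / (8 * R * CARD('a) ^ n) \<Longrightarrow>
      1 / (4 * (c * \<alpha> ^ (K + 1) / 16) ^ 4 * \<alpha>) \<le> real L \<Longrightarrow> CARD('a) ^ L * card A \<le> CARD('a) ^ n * R \<Longrightarrow>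
      c * \<alpha> ^ K * card A ^ 5 / (64 * CARD('a) ^ n) \<le> card (sols5 a A)"
    using many_solutions[where 'a = 'a] by blast
  define q where "q = real CARD('a)"
  have q: "q \<ge> 2" using card_ge2_field[where 'a = 'a] by (simp add: q_def)
  \<comment> \<open>The exponent of \<alpha> in the spectral bound: four factors
    \<open>\<alpha> ^ (K + 1)\<close> from the threshold and one more from the energy.\<close>
  define Q where "Q = 4 * K + 5"
  define C2 where "C2 = 16 ^ 4 / (4 * c ^ 4)"
  have C2: "C2 > 0" using c by (simp add: C2_def)
  obtain r where r: "s = Suc (Suc r)" using s by (metis add_2_eq_Suc le_Suc_ex)
  have r': "s - 2 = r" using r by simp
  \<comment> \<open>Chosen so that \<open>M ^ s / (B * N ^ (s - 1))\<close> equals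
    \<open>M\<^sup>2 / (8 * R * N)\<close> for
    \<open>R = t * (2 * s * N / M) ^ (s - 2)\<close>.\<close>
  define B where "B = 8 * real t * (2 * real s) ^ r"
  have B: "B \<ge> 1"
  proof -
    have "1 \<le> (2 * real s) ^ r" using s by (intro one_le_power) auto
    then have "1 * 1 \<le> (8 * real t) * (2 * real s) ^ r" using t by (intro mult_mono) auto
    then show ?thesis by (simp add: B_def)
  qed
  \<comment> \<open>A sixteenth root of \<open>q\<close>: with \<open>Y = y ^ n\<close> the sizes to
    be compared become integer powers of \<open>Y\<close>, with \<open>N = Y ^ 16\<close>.\<close>
  define y where "y = q powr (1 / 16)"
  have y: "y > 1" using q by (simp add: y_def)
  have y16: "y ^ 16 = q" using q by (simp add: y_def powr_power)
  \<comment> \<open>The three summands give \<open>Y\<close> room for \<open>8 \<le> Y ^ 3\<close>,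
    for \<open>2 * s \<le> card A\<close> and for the final contradiction.\<close>
  define T where "T = 2 + 2 * real s + 65 / c"
  have T: "T \<ge> 2" "T \<ge> 2 * s" "T \<ge> 65 / c" using c by (auto simp: T_def)
  have lim: "(\<lambda>n. real n * (1 / y) ^ n) \<longlonglongrightarrow> 0"
    using y by (intro powser_times_n_limit_0) auto
  have "0 < min (8 * C2) (1 / T)" using C2 T by auto
  then obtain n1 where n1: "\<And>n. n \<ge> n1 \<Longrightarrow> real n * (1 / y) ^ n < min (8 * C2) (1 / T)"
    using order_tendstoD(2)[OF lim] unfolding eventually_sequentially by blast
  \<comment> \<open>From 6 on, \<open>n div 4\<close> is at least \<open>n / 8\<close>.\<close>
  define n0 where "n0 = max n1 6"
  have key: "\<alpha> ^ Q * n \<le> 8 * C2"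
    if n: "n \<ge> n0" and a: "\<forall>j<5. a j \<noteq> 0" "(\<Sum>j<5. a j) = 0" "a 0 + a 1 \<noteq> 0" "a 2 + a 3 \<noteq> 0"
      and A: "A \<subseteq> fspace n" and kst: "kst_free n s t A" and triv: "\<forall>x\<in>sols5 a A. \<forall>i<5. \<forall>j<5. x i = x j"
      and \<alpha>: "\<alpha> = real (card A) ^ s / (B * (q ^ n) ^ (s - 1))"
    for n and A :: "(nat \<Rightarrow> 'a) set" and a \<alpha>
  proof (rule ccontr)
    assume "\<not> ?thesis"
    then have big: "8 * C2 < \<alpha> ^ Q * n" by simp
    define M N Y where "M = real (card A)" and "N = q ^ n" and "Y = y ^ n"
    have NY: "N = Y ^ 16" by (simp add: N_def Y_def y16[symmetric] flip: power_mult) (simp add: mult.commute)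
    have n6: "n \<ge> 6" "n \<ge> n1" using n by (auto simp: n0_def)
    have Y1: "Y \<ge> 1" using y by (simp add: Y_def)
    have N1: "N \<ge> 1" using q by (simp add: N_def)
    have nY: "n / Y < min (8 * C2) (1 / T)" using n1[OF n6(2)] by (simp add: Y_def power_divide)
    then have nY1: "n < 8 * C2 * Y" using Y1 by (simp add: field_simps)
    have "n * T < Y" using nY Y1 T by (simp add: field_simps)
    moreover have "1 * T \<le> n * T" using n6 T by (intro mult_right_mono) auto
    ultimately have YT: "T \<le> Y" by linarith
    have finA: "finite A" using finite_subset[OF A] by simp
    have \<alpha>': "\<alpha> = M ^ s / (B * N ^ (s - 1))" by (simp add: \<alpha> M_def N_def)
    have \<alpha>0: "\<alpha> \<ge> 0" using B N1 by (simp add: \<alpha>' M_def)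
    have \<alpha>Q: "1 / Y < \<alpha> ^ Q"
    proof -
      have "1 / Y * n < 8 * C2" using nY1 Y1 by (simp add: field_simps)
      also note big
      finally show ?thesis by (rule mult_right_less_imp_less) simp
    qed
    have \<alpha>Y: "1 / Y \<le> \<alpha>"
    proof (cases "\<alpha> \<le> 1")
      case True
      then have "\<alpha> ^ Q \<le> \<alpha> ^ 1" using \<alpha>0 by (intro power_decreasing) (auto simp: Q_def)
      then show ?thesis using \<alpha>Q by simp
    next
      case False
      moreover have "1 / Y \<le> 1" using Y1 by simp
      ultimately show ?thesis by linarith
    qed
    \<comment> \<open>The bound \<open>1 / Y \<le> \<alpha>\<close> gives
      \<open>M ^ s \<ge> Y ^ (16 * (s - 1) - 1)\<close>, and \<open>7 * s\<close> does not exceed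
      this exponent when \<open>s \<ge> 2\<close>.\<close>
    have "M \<ge> Y ^ 7"
    proof (rule ccontr)
      assume "\<not> ?thesis"
      then have "M ^ s < (Y ^ 7) ^ s" using s by (intro power_strict_mono) (auto simp: M_def)
      also have "\<dots> = Y ^ (7 * s)" by (simp add: power_mult)
      also have "\<dots> \<le> Y ^ (16 * (s - 1) - 1)" using Y1 s by (intro power_increasing) auto
      finally have "M ^ s * Y < Y ^ (16 * (s - 1) - 1) * Y" using Y1 by simp
      also have "\<dots> = Y ^ (Suc (16 * (s - 1) - 1))" by simp
      also have "\<dots> = N ^ (s - 1)" using s by (simp add: NY flip: power_mult)
      also have "\<dots> \<le> B * N ^ (s - 1)" using B N1 by simp
      also have "\<dots> \<le> M ^ s * Y"
        using \<alpha>Y Y1 B N1 unfolding \<alpha>' by (simp add: field_simps)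
      finally show False by simp
    qed
    have Y7: "Y ^ 1 \<le> Y ^ 7" using Y1 by (intro power_increasing) auto
    have M2s: "2 * s \<le> card A"
    proof -
      have "real (2 * s) \<le> M" using T(2) YT Y7 \<open>M \<ge> Y ^ 7\<close> by simp
      then show ?thesis by (simp add: M_def)
    qed
    have Mpos: "M > 0" using M2s s by (simp add: M_def)
    have MN: "M \<le> N"
    proof -
      have "card A \<le> CARD('a) ^ n" unfolding card_fspace[symmetric] by (intro card_mono A) auto
      then have "real (card A) \<le> real (CARD('a) ^ n)" unfolding of_nat_le_iff .
      then show ?thesis by (simp add: M_def N_def q_def)
    qed
    define R where "R = t * (2 * s * N / M) ^ r"
    have R1: "1 \<le> R"
    proof -
      have "1 \<le> 2 * s * N / M" using MN Mpos s mult_mono[of 1 "2 * real s" M N] by (simp add: field_simps)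
      then have "1 \<le> (2 * s * N / M) ^ r" by (rule one_le_power)
      then have "1 * 1 \<le> t * (2 * s * N / M) ^ r" using t by (intro mult_mono) auto
      then show ?thesis by (simp add: R_def)
    qed
    have corrR: "\<forall>d\<in>fspace n. d \<noteq> 0 \<longrightarrow> corr A d \<le> R"
      using corr_le_of_kst_free[OF A kst s M2s] by (simp add: R_def N_def M_def q_def r')
    have \<alpha>R: "\<alpha> = M\<^sup>2 / (8 * R * N)"
    proof -
      have "M ^ s = M ^ r * M\<^sup>2" "N ^ (s - 1) = N ^ r * N" by (simp_all add: r power2_eq_square)
      then show ?thesis
        using Mpos N1 t s by (simp add: \<alpha>' R_def B_def power_divide power_mult_distrib field_simps)
    qed
    \<comment> \<open>All correlations sum to \<open>M\<^sup>2\<close>; difference 0 contributes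
      \<open>M\<close>, the others at most \<open>R * N\<close>.\<close>
    have \<alpha>1: "\<alpha> \<le> 1"
    proof -
      have "M\<^sup>2 = (\<Sum>d\<in>fspace n. corr A d)" by (simp add: sum_corr[OF A] M_def)
      also have "\<dots> = M + (\<Sum>d\<in>fspace n - {0}. corr A d)"
        by (subst sum.remove[of _ 0]) (auto simp: M_def)
      also have "(\<Sum>d\<in>fspace n - {0}. corr A d) \<le> (\<Sum>d\<in>fspace n - {0::nat \<Rightarrow> 'a}. R)"
        using corrR by (intro sum_mono) auto
      also have "\<dots> \<le> (\<Sum>d\<in>(fspace n :: (nat \<Rightarrow> 'a) set). R)" using R1 by (intro sum_mono2) auto
      also have "\<dots> = R * N" by (simp add: card_fspace N_def q_def)
      also have "M \<le> R * N" using MN R1 N1 mult_right_mono[of 1 R N] by linarith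
      finally have "M\<^sup>2 \<le> 8 * R * N" using R1 N1 mult_pos_pos[of R N] by linarith
      then show ?thesis using R1 N1 by (simp add: \<alpha>R)
    qed
    \<comment> \<open>Large enough to exceed the spectral bound, which is at most
      \<open>n / 8\<close> by \<open>big\<close>, yet \<open>q ^ L \<le> Y ^ 4 \<le> M / 8\<close>
      leaves the annihilator large.\<close>
    define L where "L = n div 4"
    have L8: "n / 8 \<le> L" using n6 by (simp add: L_def)
    have \<alpha>pos: "\<alpha> > 0" using Y1 by (intro less_le_trans[OF _ \<alpha>Y]) simp
    have "1 / (4 * (c * \<alpha> ^ (K + 1) / 16) ^ 4 * \<alpha>) = C2 / \<alpha> ^ Q"
    proof -
      have "(c * \<alpha> ^ (K + 1) / 16) ^ 4 * \<alpha> = c ^ 4 / 16 ^ 4 * (\<alpha> ^ ((K + 1) * 4) * \<alpha>)"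
        by (simp only: power_mult_distrib power_divide power_mult) simp
      also have "\<alpha> ^ ((K + 1) * 4) * \<alpha> = \<alpha> ^ (Suc ((K + 1) * 4))" by (rule power_Suc2[symmetric])
      also have "Suc ((K + 1) * 4) = Q" by (simp add: Q_def)
      finally have "1 / (4 * (c * \<alpha> ^ (K + 1) / 16) ^ 4 * \<alpha>) = 1 / (4 * (c ^ 4 / 16 ^ 4 * \<alpha> ^ Q))"
        by (simp only: mult.assoc)
      also have "\<dots> = C2 / \<alpha> ^ Q" using c \<alpha>pos by (simp add: C2_def)
      finally show ?thesis .
    qed
    also have "\<dots> \<le> n / 8" using big \<alpha>pos by (simp add: field_simps)
    also note L8
    finally have cond1: "1 / (4 * (c * \<alpha> ^ (K + 1) / 16) ^ 4 * \<alpha>) \<le> L" .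
    have "(q ^ L) ^ 4 \<le> (Y ^ 4) ^ 4"
    proof -
      have "(q ^ L) ^ 4 = q ^ (4 * L)" by (simp add: mult.commute flip: power_mult)
      also have "\<dots> \<le> q ^ n" using q by (intro power_increasing) (auto simp: L_def)
      also have "\<dots> = (Y ^ 4) ^ 4" using NY by (simp add: N_def flip: power_mult)
      finally show ?thesis .
    qed
    then have qL: "q ^ L \<le> Y ^ 4" by (rule power_le_imp_le_base[of _ 3, simplified]) (use Y1 in auto)
    have "8 * Y ^ 4 \<le> Y ^ 3 * Y ^ 4"
    proof -
      have "2 ^ 3 \<le> Y ^ 3" using YT T by (intro power_mono) auto
      then show ?thesis using Y1 by (intro mult_right_mono) auto
    qed
    also have "\<dots> = Y ^ 7" by (simp flip: power_add)
    also note \<open>Y ^ 7 \<le> M\<close>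
    finally have "q ^ L \<le> M / 8" using qL by simp
    then have "q ^ L * M \<le> M / 8 * M" using Mpos by (intro mult_right_mono) auto
    also have "\<dots> = \<alpha> * (N * R)" using R1 N1 by (simp add: \<alpha>R power2_eq_square)
    also have "\<dots> \<le> 1 * (N * R)" using \<alpha>1 R1 N1 by (intro mult_right_mono) auto
    finally have cond2: "q ^ L * M \<le> N * R" by simp
    have "c * \<alpha> ^ K * M ^ 5 / (64 * N) \<le> card (sols5 a A)"
    proof -
      have "A \<noteq> {}" using Mpos by (auto simp: M_def)
      from many[OF a A this R1 corrR _ cond1] show ?thesis
        using cond2 \<alpha>R by (simp add: M_def N_def q_def)
    qed
    \<comment> \<open>All solutions are constant, hence determined by their value at 0.\<close>
    also have "card (sols5 a A) \<le> card A"
    proof (rule card_inj_on_le[where f = "\<lambda>x. x 0"])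
      show "inj_on (\<lambda>x. x 0) (sols5 a A)"
      proof (rule inj_onI)
        fix x x' assume x: "x \<in> sols5 a A" "x' \<in> sols5 a A" "x 0 = x' 0"
        have "x j = x' j" if "j < 5" for j
          using triv x that by (metis zero_less_numeral)
        then show "x = x'" using x by (intro PiE_ext[of x "{..<5}" "\<lambda>_. A"]) (auto simp: sols5_def)
      qed
      show "(\<lambda>x. x 0) ` sols5 a A \<subseteq> A"
      proof (rule image_subsetI)
        fix x assume "x \<in> sols5 a A"
        then have "x \<in> {..<5} \<rightarrow>\<^sub>E A" unfolding sols5_def by blast
        then show "x 0 \<in> A" by (rule PiE_mem) simp
      qed
    qed (rule finA)
    finally have "c * \<alpha> ^ K * M ^ 5 / (64 * N) \<le> M" by (simp add: M_def)
    moreover have "c * \<alpha> ^ K * M ^ 5 / (64 * N) = c * \<alpha> ^ K * M ^ 4 / (64 * N) * M"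
      by (simp add: eval_nat_numeral)
    ultimately have "c * \<alpha> ^ K * M ^ 4 / (64 * N) * M \<le> 1 * M" by simp
    then have "c * \<alpha> ^ K * M ^ 4 / (64 * N) \<le> 1" using Mpos by (rule mult_right_le_imp_le)
    then have le1: "c * \<alpha> ^ K * M ^ 4 \<le> 64 * N" using N1 by simp
    have \<alpha>K: "1 / Y \<le> \<alpha> ^ K"
    proof -
      have "\<alpha> ^ Q \<le> \<alpha> ^ K" using \<alpha>1 \<alpha>0 by (intro power_decreasing) (auto simp: Q_def)
      then show ?thesis using \<alpha>Q by linarith
    qed
    \<comment> \<open>The count forces \<open>c * \<alpha> ^ K * M ^ 4 \<le> 64 * N\<close>, but the
      left side is at least \<open>c * Y ^ 27\<close>, which already exceeds
      \<open>64 * Y ^ 16\<close>.\<close>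
    have "65 / c \<le> Y" using YT T(3) by linarith
    then have "65 * Y ^ 16 \<le> (c * Y) * Y ^ 16"
      using c Y1 by (intro mult_right_mono) (auto simp: field_simps)
    also have "\<dots> = c * Y ^ 17" by (simp add: eval_nat_numeral)
    also have "\<dots> \<le> c * Y ^ 27" using c Y1 by (intro mult_left_mono power_increasing) auto
    also have "\<dots> = c * (1 / Y) * (Y ^ 7) ^ 4"
    proof -
      have "(Y ^ 7) ^ 4 = Y * Y ^ 27" by (simp flip: power_mult power_Suc)
      then show ?thesis using Y1 by simp
    qed
    also have "\<dots> \<le> c * \<alpha> ^ K * M ^ 4"
      using c \<alpha>0 \<alpha>K Y1 \<open>Y ^ 7 \<le> M\<close> by (intro mult_mono power_mono) auto
    also note le1
    finally show False using Y1 by (simp add: NY)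
  qed
  \<comment> \<open>The first summand serves \<open>n \<ge> n0\<close> through \<open>key\<close>,
    the second the finitely many smaller dimensions through \<open>M \<le> N\<close>.\<close>
  define C where "C = 8 * C2 * B ^ Q * ln q + (q ^ n0) ^ (s * Q) * (n0 * ln q)"
  show ?thesis
  proof (intro exI[of _ Q] exI[of _ C] conjI allI impI)
    show "1 \<le> Q" by (simp add: Q_def)
    show "0 < C" using C2 B q by (auto simp: C_def intro!: add_pos_nonneg)
    fix n and A :: "(nat \<Rightarrow> 'a) set" and a :: "nat \<Rightarrow> 'a"
    assume n: "1 \<le> n" and a: "\<forall>j<5. a j \<noteq> 0" "(\<Sum>j<5. a j) = 0" "a 0 + a 1 \<noteq> 0" "a 2 + a 3 \<noteq> 0"
      and A: "A \<subseteq> fspace n" and kst: "kst_free n s t A" and triv: "\<forall>x\<in>sols5 a A. \<forall>i<5. \<forall>j<5. x i = x j"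
    define M N where "M = real (card A)" and "N = q ^ n"
    have N1: "N \<ge> 1" using q by (simp add: N_def)
    have lnq: "ln q > 0" using q by simp
    have lnN: "ln N = n * ln q" using q by (simp add: N_def ln_realpow)
    have C_ge: "8 * C2 * B ^ Q * ln q \<le> C" "(q ^ n0) ^ (s * Q) * (n0 * ln q) \<le> C"
      using lnq C2 B q by (auto simp: C_def)
    have "M ^ (s * Q) * ln N \<le> C * N ^ ((s - 1) * Q)"
    proof (cases "n \<ge> n0")
      case True
      have "(M ^ s / (B * N ^ (s - 1))) ^ Q * n \<le> 8 * C2"
        using key[OF True a A kst triv refl] by (simp add: M_def N_def)
      then have "(M ^ s) ^ Q * n \<le> 8 * C2 * (B ^ Q * (N ^ (s - 1)) ^ Q)"
        using B N1 by (simp add: power_divide power_mult_distrib field_simps)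
      then have "M ^ (s * Q) * n \<le> 8 * C2 * (B ^ Q * N ^ ((s - 1) * Q))"
        by (simp only: power_mult)
      then have "M ^ (s * Q) * n * ln q \<le> 8 * C2 * (B ^ Q * N ^ ((s - 1) * Q)) * ln q"
        using lnq by (intro mult_right_mono) auto
      also have "\<dots> = 8 * C2 * B ^ Q * ln q * N ^ ((s - 1) * Q)" by simp
      also have "\<dots> \<le> C * N ^ ((s - 1) * Q)" using C_ge N1 by (intro mult_right_mono) auto
      finally show ?thesis by (simp add: lnN mult.assoc)
    next
      case False
      have "card A \<le> CARD('a) ^ n" unfolding card_fspace[symmetric] by (intro card_mono A) auto
      then have "real (card A) \<le> real (CARD('a) ^ n)" unfolding of_nat_le_iff .
      then have "M \<le> q ^ n" by (simp add: M_def q_def)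
      also have "\<dots> \<le> q ^ n0" using False q by (intro power_increasing) auto
      finally have "M ^ (s * Q) * (n * ln q) \<le> (q ^ n0) ^ (s * Q) * (n0 * ln q)"
        using False lnq q by (intro mult_mono power_mono) (auto simp: M_def)
      also have "\<dots> \<le> C * 1" using C_ge by simp
      also have "\<dots> \<le> C * N ^ ((s - 1) * Q)"
        using \<open>0 < C\<close> N1 by (intro mult_left_mono one_le_power) auto
      finally show ?thesis by (simp add: lnN)
    qed
    then show "real (card A) ^ (s * Q) * ln (real CARD('a) ^ n) \<le> C * (real CARD('a) ^ n) ^ ((s - 1) * Q)"
      by (simp add: M_def N_def q_def)
  qed
qed

section \<open>Merging variables\<close>

text \<open>If all three pairwise sums of three coefficients vanished, twice one of them would be
  0.\<close>

lemma ex_pair_nonzero_sum: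
  fixes a :: "'i \<Rightarrow> 'a::field"
  assumes two: "(2::'a) \<noteq> 0" and I: "3 \<le> card I" and a: "\<And>i. i \<in> I \<Longrightarrow> a i \<noteq> 0"
  shows "\<exists>i\<in>I. \<exists>j\<in>I. i \<noteq> j \<and> a i + a j \<noteq> 0"
proof -
  obtain J where J: "J \<subseteq> I" "card J = 3" using obtain_subset_with_card_n[OF I] by blast
  then obtain i j k where "J = {i, j, k}" "i \<noteq> j" "j \<noteq> k" "i \<noteq> k"
    by (auto simp: card_3_iff)
  then have ijk: "i \<in> I" "j \<in> I" "k \<in> I" "i \<noteq> j" "j \<noteq> k" "i \<noteq> k" using J by auto
  show ?thesis
  proof (rule ccontr)
    assume "\<not> ?thesis"
    then have "a i + a j = 0" "a j + a k = 0" "a i + a k = 0" using ijk by blast+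
    moreover have "2 * a i = (a i + a j) + (a i + a k) - (a j + a k)" by simp
    ultimately show False using two a[OF ijk(1)] by simp
  qed
qed

text \<open>Each induction step fuses two variables whose coefficients have nonzero sum, so all
  coefficients stay nonzero. With five left, one good pair is taken first and a second among the
  other three. The map \<open>g\<close> records the class of each original index and
  \<open>b\<close> the class sums.\<close>

lemma merge_to_five:
  fixes a :: "'i \<Rightarrow> 'a::field"
  assumes "(2::'a) \<noteq> 0" "card I = m + 5" "\<And>i. i \<in> I \<Longrightarrow> a i \<noteq> 0"
  shows "\<exists>g b. g ` I \<subseteq> {..<5::nat} \<and> (\<forall>l. b l = (\<Sum>i\<in>{i\<in>I. g i = l}. a i)) \<and> (\<forall>l<5. b l \<noteq> 0) \<and>
    b 0 + b 1 \<noteq> 0 \<and> b 2 + b 3 \<noteq> 0"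
  using assms(2,3)
proof (induction m arbitrary: I a)
  case 0
  note aI = 0(2)
  have fin: "finite I" using 0 by (simp add: card_ge_0_finite)
  obtain i0 i1 where i01: "i0 \<in> I" "i1 \<in> I" "i0 \<noteq> i1" "a i0 + a i1 \<noteq> 0"
    using ex_pair_nonzero_sum[OF assms(1), of I a] 0 by auto
  have "card (I - {i0, i1}) = 3" using i01 0 fin by (simp add: card_Diff_subset)
  then obtain i2 i3 where i23: "i2 \<in> I - {i0, i1}" "i3 \<in> I - {i0, i1}" "i2 \<noteq> i3" "a i2 + a i3 \<noteq> 0"
    using ex_pair_nonzero_sum[OF assms(1), of "I - {i0, i1}" a] aI by auto
  have "card (I - {i0, i1, i2, i3}) = 1"
    using i01 i23 0 fin by (subst card_Diff_subset) auto
  then obtain i4 where i4: "I - {i0, i1, i2, i3} = {i4}" by (auto simp: card_1_singleton_iff)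
  have I: "I = {i0, i1, i2, i3, i4}" and dist: "distinct [i0, i1, i2, i3, i4]"
    using i01 i23 i4 by auto
  define g where "g = (\<lambda>i. if i = i0 then 0 else if i = i1 then 1 else if i = i2 then 2 else if i = i3 then 3 else 4::nat)"
  define b where "b = (\<lambda>l. \<Sum>i\<in>{i\<in>I. g i = l}. a i)"
  have "{i\<in>I. g i = 0} = {i0}" "{i\<in>I. g i = 1} = {i1}" "{i\<in>I. g i = 2} = {i2}" "{i\<in>I. g i = 3} = {i3}" "{i\<in>I. g i = 4} = {i4}"
    using dist by (auto simp: I g_def split: if_splits)
  then have b: "b 0 = a i0" "b 1 = a i1" "b 2 = a i2" "b 3 = a i3" "b 4 = a i4" by (simp_all add: b_def)
  have "b l \<noteq> 0" if "l < 5" for l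
  proof -
    have "l \<in> {0, 1, 2, 3, 4}" using that unfolding lessThan_5[symmetric] by simp
    then show ?thesis using b aI by (auto simp: I)
  qed
  moreover have "g ` I \<subseteq> {..<5}" by (auto simp: g_def)
  ultimately show ?case using i01(4) i23(4) b by (intro exI[of _ g] exI[of _ b]) (auto simp: b_def)
next
  case (Suc m)
  have fin: "finite I" using Suc.prems by (simp add: card_ge_0_finite)
  obtain i j where ij: "i \<in> I" "j \<in> I" "i \<noteq> j" "a i + a j \<noteq> 0"
    using ex_pair_nonzero_sum[OF assms(1), of I a] Suc.prems by auto
  \<comment> \<open>Index \<open>i\<close> represents the fused pair and \<open>j\<close> is
    dropped; afterwards \<open>g'\<close> puts \<open>j\<close> into the class of
    \<open>i\<close>.\<close>
  define a' where "a' = a(i := a i + a j)"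
  have "card (I - {j}) = m + 5" using ij Suc.prems fin by simp
  moreover have "a' l \<noteq> 0" if "l \<in> I - {j}" for l
    using that ij Suc.prems by (auto simp: a'_def)
  ultimately obtain g b where g: "g ` (I - {j}) \<subseteq> {..<5::nat}" and b: "\<And>l. b l = (\<Sum>k\<in>{k\<in>I - {j}. g k = l}. a' k)"
    and rest: "\<forall>l<5. b l \<noteq> 0" "b 0 + b 1 \<noteq> 0" "b 2 + b 3 \<noteq> 0"
    using Suc.IH[of "I - {j}" a'] by blast
  define g' where "g' = g(j := g i)"
  have "b l = (\<Sum>k\<in>{k\<in>I. g' k = l}. a k)" for l
  proof (cases "g i = l")
    case True
    have "b l = a' i + (\<Sum>k\<in>{k\<in>I - {j}. g k = l} - {i}. a' k)"
      unfolding b using ij True fin by (subst sum.remove[of _ i]) auto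
    also have "(\<Sum>k\<in>{k\<in>I - {j}. g k = l} - {i}. a' k) = (\<Sum>k\<in>{k\<in>I - {j}. g k = l} - {i}. a k)"
      by (intro sum.cong) (auto simp: a'_def)
    also have "a' i + \<dots> = a j + (a i + (\<Sum>k\<in>{k\<in>I - {j}. g k = l} - {i}. a k))" by (simp add: a'_def)
    also have "\<dots> = a j + (\<Sum>k\<in>{k\<in>I - {j}. g k = l}. a k)"
      using ij True fin by (subst (2) sum.remove[of _ i]) auto
    also have "\<dots> = (\<Sum>k\<in>insert j {k\<in>I - {j}. g k = l}. a k)" using fin by simp
    also have "insert j {k\<in>I - {j}. g k = l} = {k\<in>I. g' k = l}" using ij True by (auto simp: g'_def)
    finally show ?thesis .
  next
    case False
    then have "{k\<in>I - {j}. g k = l} = {k\<in>I. g' k = l}" by (auto simp: g'_def)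
    then show ?thesis unfolding b using False by (intro sum.cong) (auto simp: a'_def g'_def split: if_splits)
  qed
  moreover have "g' ` I \<subseteq> {..<5}" using g ij by (auto simp: g'_def)
  ultimately show ?case using rest by (intro exI[of _ g'] exI[of _ b]) auto
qed

section \<open>Passage between functions and vectors\<close>

definition fun_of_vec :: "nat \<Rightarrow> 'a::zero vec \<Rightarrow> nat \<Rightarrow> 'a" where
  "fun_of_vec n v = (\<lambda>i. if i < n then v $ i else 0)"

lemma fun_of_vec_in_fspace: "fun_of_vec n v \<in> fspace n"
  by (simp add: fun_of_vec_def fspace_def)

lemma vec_fun_of_vec: "v \<in> carrier_vec n \<Longrightarrow> vec n (fun_of_vec n v) = v"
  by (intro eq_vecI) (auto simp: fun_of_vec_def)

lemma inj_on_vec_fspace: "inj_on (vec n) (fspace n)"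
proof (rule inj_onI)
  fix x y :: "nat \<Rightarrow> 'a" assume x: "x \<in> fspace n" "y \<in> fspace n" and eq: "vec n x = vec n y"
  show "x = y"
  proof
    fix i show "x i = y i"
    proof (cases "i < n")
      case True
      then show ?thesis using arg_cong[OF eq, of "\<lambda>v. v $ i"] by simp
    qed (use x in \<open>auto simp: fspace_def\<close>)
  qed
qed

lemma kst_free_fun_of_vec:
  fixes A :: "'a::field vec set"
  assumes A: "A \<subseteq> carrier_vec n" and kst: "Kst_free n s t A"
  shows "kst_free n s t (fun_of_vec n ` A)"
  unfolding kst_free_def
proof (rule notI, elim exE conjE)
  fix X Y :: "(nat \<Rightarrow> 'a) set"
  assume XY: "X \<subseteq> fspace n" "Y \<subseteq> fspace n" "card X = s" "card Y = t" "\<forall>x\<in>X. \<forall>y\<in>Y. x + y \<in> fun_of_vec n ` A"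
  \<comment> \<open>For infinite \<open>Z\<close> the convention \<open>card Z = 0\<close> makes the
    index set \<open>{1..card Z}\<close> empty.\<close>
  have enum: "\<exists>f. f ` {1..card Z} \<subseteq> Z \<and> inj_on f {1..card Z}" for Z :: "(nat \<Rightarrow> 'a) set"
  proof (cases "finite Z")
    case True
    then obtain f where "bij_betw f {1..card Z} Z" using ex_bij_betw_nat_finite_1 by blast
    then show ?thesis by (auto simp: bij_betw_def)
  qed simp
  obtain x y where x: "x ` {1..s} \<subseteq> X" "inj_on x {1..s}" and y: "y ` {1..t} \<subseteq> Y" "inj_on y {1..t}"
    using enum[of X] enum[of Y] XY by auto
  have inj: "inj_on (vec n \<circ> x) {1..s}" "inj_on (vec n \<circ> y) {1..t}"
  proof -
    have im: "x ` {1..s} \<subseteq> fspace n" "y ` {1..t} \<subseteq> fspace n" using x y XY by blast+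
    show "inj_on (vec n \<circ> x) {1..s}" by (rule comp_inj_on[OF x(2) inj_on_subset[OF inj_on_vec_fspace im(1)]])
    show "inj_on (vec n \<circ> y) {1..t}" by (rule comp_inj_on[OF y(2) inj_on_subset[OF inj_on_vec_fspace im(2)]])
  qed
  have "vec n (x i) + vec n (y j) \<in> A" if "i \<in> {1..s}" "j \<in> {1..t}" for i j
  proof -
    have "x i + y j \<in> fun_of_vec n ` A" using XY(5) x y that by blast
    then obtain v where v: "v \<in> A" "x i + y j = fun_of_vec n v" by blast
    have "vec n (x i) + vec n (y j) = vec n (x i + y j)" by (intro eq_vecI) auto
    also have "\<dots> = v" using v A by (auto simp: vec_fun_of_vec)
    finally show ?thesis using v by simp
  qed
  then have "\<exists>x y. x ` {1..s} \<subseteq> carrier_vec n \<and> inj_on x {1..s} \<and> y ` {1..t} \<subseteq> carrier_vec n \<and> inj_on y {1..t} \<and>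
      (\<forall>i\<in>{1..s}. \<forall>j\<in>{1..t}. x i + y j \<in> A)"
    using inj by (intro exI[of _ "vec n \<circ> x"] exI[of _ "vec n \<circ> y"]) auto
  then show False using kst unfolding Kst_free_def by blast
qed

text \<open>Giving every index the value of its class turns a five-term solution into a
  \<open>k\<close>-term one, which must be constant. No class is empty, because its coefficient
  would then be an empty sum, so all five values coincide.\<close>

lemma sols5_trivial_of_no_solution:
  fixes A :: "'a::field vec set"
  assumes A: "A \<subseteq> carrier_vec n" and nosol: "\<not> (\<exists>x. lin_solution n k a A x \<and> \<not> trivial_solution k x)"
    and g: "g ` {1..k} \<subseteq> {..<5::nat}" and b: "\<And>l. b l = (\<Sum>i\<in>{i\<in>{1..k}. g i = l}. a i)" "\<forall>l<5. b l \<noteq> 0"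
    and x: "x \<in> sols5 b (fun_of_vec n ` A)" and ij: "i < 5" "j < 5"
  shows "x i = x j"
proof -
  have xA: "x l \<in> fun_of_vec n ` A" if "l < 5" for l using x that by (auto simp: sols5_def)
  define v where "v = (\<lambda>i. vec n (x (g i)))"
  have "v i \<in> A" if "i \<in> {1..k}" for i
  proof -
    obtain w where "w \<in> A" "x (g i) = fun_of_vec n w" using xA[of "g i"] g \<open>i \<in> {1..k}\<close> by blast
    then show ?thesis using A by (auto simp: v_def vec_fun_of_vec)
  qed
  moreover have "finsum_vec TYPE('a) n (\<lambda>i. a i \<cdot>\<^sub>v v i) {1..k} = 0\<^sub>v n"
  proof (rule eq_vecI)
    show "dim_vec (finsum_vec TYPE('a) n (\<lambda>i. a i \<cdot>\<^sub>v v i) {1..k}) = dim_vec (0\<^sub>v n :: 'a vec)"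
      using finsum_vec_closed[of "\<lambda>i. a i \<cdot>\<^sub>v v i" "{1..k}" n] by (auto simp: v_def)
    fix m assume "m < dim_vec (0\<^sub>v n :: 'a vec)"
    then have m: "m < n" by simp
    have "finsum_vec TYPE('a) n (\<lambda>i. a i \<cdot>\<^sub>v v i) {1..k} $ m = (\<Sum>i\<in>{1..k}. a i * x (g i) m)"
      using m by (subst index_finsum_vec) (auto simp: v_def)
    also have "\<dots> = (\<Sum>l<5. \<Sum>i\<in>{i\<in>{1..k}. g i = l}. a i * x (g i) m)"
      by (rule sum.group[symmetric]) (use g in auto)
    also have "\<dots> = (\<Sum>l<5. b l * x l m)"
      by (intro sum.cong refl) (auto simp: b(1) sum_distrib_right intro!: sum.cong)
    also have "\<dots> = (\<Sum>l<5. b l \<star> x l) m" by (simp add: lessThan_5)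
    also have "\<dots> = 0" using x by (simp add: sols5_def)
    finally show "finsum_vec TYPE('a) n (\<lambda>i. a i \<cdot>\<^sub>v v i) {1..k} $ m = 0\<^sub>v n $ m" using m by simp
  qed
  ultimately have "lin_solution n k a A v" by (simp add: lin_solution_def)
  then have triv: "v i' = v j'" if "i' \<in> {1..k}" "j' \<in> {1..k}" for i' j'
    using nosol that by (auto simp: trivial_solution_def)
  have surj: "\<exists>i'\<in>{1..k}. g i' = l" if "l < 5" for l
  proof (rule ccontr)
    assume "\<not> ?thesis"
    then have "{i\<in>{1..k}. g i = l} = {}" by blast
    then have "b l = 0" unfolding b(1) by (simp only: sum.empty)
    then show False using b(2) that by blast
  qed
  obtain i' j' where "i' \<in> {1..k}" "g i' = i" "j' \<in> {1..k}" "g j' = j" using surj ij by blast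
  then have "vec n (x i) = vec n (x j)" using triv[of i' j'] by (simp add: v_def)
  moreover have "x i \<in> fspace n" "x j \<in> fspace n"
    using xA ij fun_of_vec_in_fspace by (metis imageE)+
  ultimately show ?thesis using inj_on_vec_fspace by (auto dest: inj_onD)
qed

text \<open>The exponent of the logarithm is \<open>1 / (s * Q)\<close>, from the root taken of the
  integer-power bound. The coefficients enter only through the merging, so the constants come from
  the field, \<open>s\<close> and \<open>t\<close>.\<close>

theorem theorem1p2:
  fixes q s t k :: nat
  assumes "CARD('a::{field,finite}) = q" and "odd q"
    and "2 \<le> s" and "s \<le> t" and "5 \<le> k"
  shows "\<exists>c::real. c > 0 \<and>
    (\<forall>a :: nat \<Rightarrow> 'a.
      (\<forall>i\<in>{1..k}. a i \<noteq> 0) \<and> (\<Sum>i=1..k. a i) = 0 \<longrightarrow>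
      (\<exists>C::real. C > 0 \<and>
        (\<forall>n N :: nat. \<forall>A :: 'a vec set.
          n \<ge> 1 \<and> N = q ^ n \<and> A \<subseteq> carrier_vec n \<and> Kst_free n s t A \<and>
          \<not> (\<exists>x. lin_solution n k a A x \<and> \<not> trivial_solution k x) \<longrightarrow>
          real (card A) \<le> C * real N powr (1 - 1 / real s) * ln (real N) powr (- c))))"
proof -
  have two: "(2::'a) \<noteq> 0"
  proof
    assume "(2::'a) = 0"
    then have "of_nat 2 = (0::'a)" by simp
    then have "CHAR('a) dvd 2" by (simp only: of_nat_eq_0_iff_char_dvd)
    moreover have "odd CHAR('a)" using CHAR_dvd_CARD[where 'a = 'a] assms(1,2) by (auto intro: dvd_trans)
    ultimately have "CHAR('a) = 1"
      by (metis dvd_refl one_dvd prime_nat_iff two_is_prime_nat)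
    then have "of_nat 1 = (0::'a)" unfolding of_nat_eq_0_iff_char_dvd by simp
    then show False by simp
  qed
  have "1 \<le> t" using assms(3,4) by simp
  from kst_free_solution_free_bound[where 'a = 'a, OF assms(3) this]
  obtain Q and C :: real where Q: "1 \<le> Q" and C: "0 < C" and bound: "\<And>n (A :: (nat \<Rightarrow> 'a) set) a.
    1 \<le> n \<Longrightarrow> \<forall>j<5. a j \<noteq> 0 \<Longrightarrow> (\<Sum>j<5. a j) = 0 \<Longrightarrow> a 0 + a 1 \<noteq> 0 \<Longrightarrow> a 2 + a 3 \<noteq> 0 \<Longrightarrow>
    A \<subseteq> fspace n \<Longrightarrow> kst_free n s t A \<Longrightarrow> \<forall>x\<in>sols5 a A. \<forall>i<5. \<forall>j<5. x i = x j \<Longrightarrow>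
    real (card A) ^ (s * Q) * ln (real CARD('a) ^ n) \<le> C * (real CARD('a) ^ n) ^ ((s - 1) * Q)"
    by blast
  define W where "W = s * Q"
  have W: "0 < W" using assms(3) Q by (simp add: W_def)
  show ?thesis
  proof (rule exI[of _ "1 / real W"], intro conjI allI impI)
    show "0 < 1 / real W" using W by simp
  next
    fix a :: "nat \<Rightarrow> 'a"
    assume a: "(\<forall>i\<in>{1..k}. a i \<noteq> 0) \<and> (\<Sum>i=1..k. a i) = 0"
    have "card {1..k} = (k - 5) + 5" using assms(5) by simp
    then obtain g b where g: "g ` {1..k} \<subseteq> {..<5::nat}" and b: "\<And>l. b l = (\<Sum>i\<in>{i\<in>{1..k}. g i = l}. a i)"
      and b0: "\<forall>l<5. b l \<noteq> 0" "b 0 + b 1 \<noteq> 0" "b 2 + b 3 \<noteq> 0"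
      using merge_to_five[OF two, of "{1..k}" "k - 5" a] a by blast
    have bsum: "(\<Sum>l<5. b l) = 0"
      unfolding b using sum.group[of "{1..k}" "{..<5}" g a] g a by simp
    show "\<exists>C::real. C > 0 \<and>
        (\<forall>n N :: nat. \<forall>A :: 'a vec set.
          n \<ge> 1 \<and> N = q ^ n \<and> A \<subseteq> carrier_vec n \<and> Kst_free n s t A \<and>
          \<not> (\<exists>x. lin_solution n k a A x \<and> \<not> trivial_solution k x) \<longrightarrow>
          real (card A) \<le> C * real N powr (1 - 1 / real s) * ln (real N) powr (- (1 / real W)))"
    proof (rule exI[of _ "C powr (1 / W)"], intro conjI allI impI, use C in simp, elim conjE)
      fix n N :: nat and A :: "'a vec set"
      assume n: "1 \<le> n" and N: "N = q ^ n" and A: "A \<subseteq> carrier_vec n" and kst: "Kst_free n s t A"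
        and nosol: "\<not> (\<exists>x. lin_solution n k a A x \<and> \<not> trivial_solution k x)"
      define M where "M = real (card A)"
      have "inj_on (fun_of_vec n) A"
        using A by (intro inj_on_inverseI[where g = "vec n"]) (auto simp: vec_fun_of_vec)
      then have cardA: "card (fun_of_vec n ` A) = card A" by (rule card_image)
      have triv: "\<forall>x\<in>sols5 b (fun_of_vec n ` A). \<forall>i<5. \<forall>j<5. x i = x j"
        using sols5_trivial_of_no_solution[OF A nosol g b b0(1)] by blast
      have sub: "fun_of_vec n ` A \<subseteq> fspace n" by (rule image_subsetI) (rule fun_of_vec_in_fspace)
      have "real (card (fun_of_vec n ` A)) ^ (s * Q) * ln (real CARD('a) ^ n) \<le> C * (real CARD('a) ^ n) ^ ((s - 1) * Q)"
        by (rule bound[OF n b0(1) bsum b0(2,3) sub kst_free_fun_of_vec[OF A kst] triv])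
      then have le: "M ^ W * ln N \<le> C * real N ^ ((s - 1) * Q)"
        by (simp add: cardA M_def W_def N assms(1))
      have "q \<ge> 2" using card_ge2_field[where 'a = 'a] assms(1) by simp
      then have "2 ^ 1 \<le> q ^ n" using n by (meson le_trans power_increasing power_mono one_le_numeral zero_le)
      then have N2: "2 \<le> N" by (simp add: N)
      then have lnN: "ln N > 0" by simp
      \<comment> \<open>The comparison is made after raising to the power \<open>W\<close>, which
        turns the real exponents into those of \<open>le\<close>; \<open>2 \<le> N\<close> makes the
        logarithm positive.\<close>
      let ?r = "C powr (1 / W) * real N powr (1 - 1 / s) * ln N powr (- (1 / W))"
      have "?r ^ W = C powr (W * (1 / W)) * real N powr (W * (1 - 1 / s)) * ln N powr (W * - (1 / W))"
        using C N2 lnN by (simp add: power_mult_distrib powr_power)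
      also have "C powr (W * (1 / W)) = C" using C W by simp
      also have "W * (1 - 1 / s) = real ((s - 1) * Q)" using assms(3) by (simp add: W_def field_simps of_nat_diff)
      also have "real N powr real ((s - 1) * Q) = real N ^ ((s - 1) * Q)" using N2 by (subst powr_realpow) auto
      also have "ln N powr (W * - (1 / W)) = 1 / ln N" using W lnN by (simp add: powr_minus_divide)
      finally have r: "?r ^ W = C * real N ^ ((s - 1) * Q) / ln N" by simp
      have "M ^ W \<le> C * real N ^ ((s - 1) * Q) / ln N" using le lnN by (simp add: pos_le_divide_eq)
      then have "M ^ W \<le> ?r ^ W" by (simp only: r)
      moreover have "0 \<le> ?r" using C by simp
      ultimately show "real (card A) \<le> ?r"
        using W power_mono_iff[of M ?r W] by (simp add: M_def)
    qed
  qed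
qed

end
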